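(* Let $\mathbf i=(1,\dots,r,\,1,\dots,r,\,\dots,\,1,\dots,r,\,1,\dots,i_n)$ ($m-1$ full cycles followed by the $m$-th cycle $1,\dots,i_n$) with $1\le m\le r$, $1\le i_n\le r$, $n=(m-1)r+i_n$, and let $k\in\{1,\dots,n\}$ be such that its $k$-th entry $i_k$ belongs to the $m'$-th cycle and $i_k=i_n$. Put $d:=i_k=i_n$ and $$\mathbf Y:=(Y_{1,1},\dots,Y_{1,r},\dots,Y_{m-1,1},\dots,Y_{m-1,r},Y_{m,1},\dots,Y_{m,i_n})\in(\mathbb C^\times)^n .$$ Then $$\Delta^L(k;\mathbf i)(\mathbf Y)=\sum_{( * )}\prod_{i=1}^{d}\overline C(m-l^{(1)}_i,k^{(1)}_i)\cdots\overline C(m-l^{(\delta_i)}_i,k^{(\delta_i)}_i)\cdot C(m-l^{(\delta_i+1)}_i,|k^{(\delta_i+1)}_i|-1)\cdots C(m-l^{(m-m')}_i,|k^{(m-m')}_i|-1),$$ where $$l^{(s)}_i:=\begin{cases}k^{(s)}_i+s-i-1&\text{if } s\le\delta_i,\\ s-i+r&\text{if } s>\delta_i\end{cases}\qquad(1\le i\le d),$$ and the sum runs over all families $(k^{(s)}_i)_{1\le s\le m-m',\,1\le i\le d}$ of elements of $J$ satisfying the conditions $( * )$: - $1\le k^{(s)}_1<k^{(s)}_2<\cdots<k^{(s)}_d\le\overline 1$ for $1\le s\le m-m'$; - $1\le k^{(1)}_i\le\cdots\le k^{(m-m')}_i\le m'+i$ for those $i\in\{1,\dots,d\}$ with $1\le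 i\le r-m'$; - $1\le k^{(1)}_i\le\cdots\le k^{(m-m')}_i\le\overline 1$ for $r-m'+1\le i\le d$; and, for each such family, $\delta_i$ ($1\le i\le d$, $0\le\delta_i\le m-m'$) is the number determined by $1\le k^{(1)}_i\le\cdots\le k^{(\delta_i)}_i\le r$ and $\overline r\le k^{(\delta_i+1)}_i\le\cdots\le k^{(m-m')}_i\le\overline 1$.
   Context: **Index set.** $J=\{i,\overline i\mid 1\le i\le r\}$ is totally ordered by $1<2<\cdots<r<\overline r<\overline{r-1}<\cdots<\overline 1$; for $1\le l\le r$, $|l|=|\overline l|=l$. **Group.** $G=Sp_{2r}(\mathbb C)$, of type $C_r$, with Chevalley generators $e_i,f_i,h_i$ ($1\le i\le r$) of its Lie algebra, Cartan matrix $a_{i,j}=\alpha_j(h_i)$ with $a_{i,i}=2$, $a_{i,j}=-1$ if $|i-j|=1$ and $(i,j)\ne(r-1,r)$, $a_{r-1,r}=-2$, and $a_{i,j}=0$ otherwise. $\Lambda_i$ are the fundamental weights, $\Lambda_i(h_j)=\delta_{i,j}$, $\Lambda_0=0$. The vector representation $V(\Lambda_1)=\mathbb C^{2r}$ has basis $v_j$ ($j\in J$) with weights $\mathrm{wt}(v_i)=\Lambda_i-\Lambda_{i-1}$, $\mathrm{wt}(v_{\overline i})=\Lambda_{i-1}-\Lambda_i$, and action $f_iv_i=v_{i+1}$, $f_iv_{\overline{i+1}}=v_{\overline i}$, $e_iv_{i+1}=v_i$, $e_iv_{\overline i}=v_{\overline{i+1}}$ ($1\le i<r$), $f_rv_r=v_{\overline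 r}$, $e_rv_{\overline r}=v_r$, all other actions of $e_i,f_i$ on basis vectors being zero. $B,B_-$ are the opposite Borel subgroups (generated by $H$ and the $x_i(t)$, resp. by $H$ and the $y_i(t)$ below), $N,N_-$ their unipotent radicals, $H=B\cap B_-$. $W=\langle s_1,\dots,s_r\rangle=\mathrm{Norm}_G(H)/H$. For $t\in\mathbb C$: $x_i(t)=\exp(te_i)$, $y_i(t)=\exp(tf_i)$. For $t\in\mathbb C^\times$: $\alpha_i^\vee(t)=t^{h_i}\in H$ (acting on a vector of weight $\mu$ by $t^{\mu(h_i)}$) and $x_{-i}(t)=y_i(t)\alpha_i^\vee(t^{-1})$. Representatives: $\overline{s_i}=x_i(-1)y_i(1)x_i(-1)$ and $\overline w=\overline{s_{j_1}}\cdots\overline{s_{j_p}}$ for a reduced expression $w=s_{j_1}\cdots s_{j_p}$. **Generalized minors.** Let $G_0=N_-HN$; for $x\in G_0$ write $x=[x]_-[x]_0[x]_+$ with $[x]_-\in N_-$, $[x]_0\in H$, $[x]_+\in N$. For $w,w'\in W$, $\Delta_{w\Lambda_i,w'\Lambda_i}$ is the regular function on $G$ whose restriction to $\overline wG_0\overline{w'}^{-1}$ is $x\mapsto([\overline w^{-1}x\overline{w'}]_0)^{\Lambda_i}$. **The words.** $\mathbf i=(i_1,\dots,i_n)$ is a reduced word for $u=(s_1s_2\cdots s_r)^{m-1}s_1\cdots s_{i_n}$. For $1\le k\le n$ in the $m'$-th cycle, $u_{\le k}=s_{i_1}\cdots s_{i_k}=(s_1\cdots s_r)^{m'-1}s_1\cdots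 s_{i_k}$, and $\Delta(k;\mathbf i):=\Delta_{u_{\le k}\Lambda_{i_k},\Lambda_{i_k}}$. Put $$x^L_{\mathbf i}(\mathbf Y)=\big(x_{-1}(Y_{1,1})\cdots x_{-r}(Y_{1,r})\big)\cdots\big(x_{-1}(Y_{m-1,1})\cdots x_{-r}(Y_{m-1,r})\big)\,x_{-1}(Y_{m,1})\cdots x_{-i_n}(Y_{m,i_n})$$ and $\Delta^L(k;\mathbf i)(\mathbf Y):=\Delta(k;\mathbf i)(x^L_{\mathbf i}(\mathbf Y))$. **Monomials.** $\overline C(l,k):=\dfrac{Y_{l,k-1}}{Y_{l,k}}$ and $C(l,k):=\dfrac{Y_{l,k+1}}{Y_{l+1,k}}$, with the convention $Y_{s,0}=Y_{s,r+1}=1$ for all $s$. Empty products equal $1$; in particular if $m=m'$ the sum consists of the single term $1$. *)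

theory Defs
  imports
    Complex_Main
    "HOL-Library.FuncSet"
    "HOL-Algebra.Group_Action"
    "HOL-Algebra.Generated_Groups"
    "Jordan_Normal_Form.Matrix"
begin

section \<open>The index set\<close>

text \<open>The order on \<open>jelt\<close> is \<open>1 < 2 < \<dots>\<close> for the plain elements, followed by the barred
  ones in reverse order. It does not depend on the rank \<open>r\<close>; \<open>J r\<close> cuts out the finite
  ordered set \<open>1 < \<dots> < r < bar r < \<dots> < bar 1\<close>.\<close>

datatype jelt = Plain nat | Bar nat

instantiation jelt :: linorder
begin

fun less_eq_jelt :: "jelt \<Rightarrow> jelt \<Rightarrow> bool" where
  "less_eq_jelt (Plain i) (Plain j) = (i \<le> j)"
| "less_eq_jelt (Plain i) (Bar j) = True"
| "less_eq_jelt (Bar i) (Plain j) = False"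
| "less_eq_jelt (Bar i) (Bar j) = (j \<le> i)"

definition less_jelt :: "jelt \<Rightarrow> jelt \<Rightarrow> bool" where
  "less_jelt x y = (x \<le> y \<and> \<not> y \<le> x)"

instance
proof
  fix x y z :: jelt
  show "x < y \<longleftrightarrow> x \<le> y \<and> \<not> y \<le> x" by (simp add: less_jelt_def)
  show "x \<le> x" by (cases x) auto
  show "x \<le> y \<Longrightarrow> y \<le> z \<Longrightarrow> x \<le> z" by (cases x; cases y; cases z) auto
  show "x \<le> y \<Longrightarrow> y \<le> x \<Longrightarrow> x = y" by (cases x; cases y) auto
  show "x \<le> y \<or> y \<le> x" by (cases x; cases y) auto
qed

end

definition J :: "nat \<Rightarrow> jelt set" where
  "J r = Plain ` {1..r} \<union> Bar ` {1..r}"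

fun absJ :: "jelt \<Rightarrow> nat" where
  "absJ (Plain l) = l"
| "absJ (Bar l) = l"

text \<open>Matrices are indexed from \<open>0\<close>; row and column \<open>p < 2 * r\<close> belong to the
  basis vector \<open>v\<^sub>j\<close>, where \<open>j\<close> is the \<open>(p + 1)\<close>-st element of \<open>J r\<close>.\<close>

definition elt :: "nat \<Rightarrow> nat \<Rightarrow> jelt" where
  "elt r p = (if p < r then Plain (p + 1) else Bar (2 * r - p))"


section \<open>Weights and Chevalley generators in the vector representation\<close>

text \<open>A weight \<open>\<mu>\<close> is represented by the function \<open>j \<mapsto> \<mu>(h\<^sub>j)\<close> (\<open>1 \<le> j \<le> r\<close>).\<close>

type_synonym weight = "nat \<Rightarrow> int"

definition fund_weight :: "nat \<Rightarrow> weight" where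
  "fund_weight i = (\<lambda>j. if i \<noteq> 0 \<and> i = j then 1 else 0)"

fun wt :: "jelt \<Rightarrow> weight" where
  "wt (Plain i) = (\<lambda>j. fund_weight i j - fund_weight (i - 1) j)"
| "wt (Bar i) = (\<lambda>j. fund_weight (i - 1) j - fund_weight i j)"

text \<open>\<open>f_act r i j = Some j'\<close> means \<open>f\<^sub>i v\<^sub>j = v\<^sub>j'\<close>, and \<open>f_act r i j = None\<close> means
  \<open>f\<^sub>i v\<^sub>j = 0\<close>; likewise \<open>e_act\<close>.\<close>

fun f_act :: "nat \<Rightarrow> nat \<Rightarrow> jelt \<Rightarrow> jelt option" where
  "f_act r i (Plain j) =
     (if j = i then Some (if i < r then Plain (i + 1) else Bar r) else None)"
| "f_act r i (Bar j) = (if i < r \<and> j = i + 1 then Some (Bar i) else None)"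

fun e_act :: "nat \<Rightarrow> nat \<Rightarrow> jelt \<Rightarrow> jelt option" where
  "e_act r i (Plain j) = (if i < r \<and> j = i + 1 then Some (Plain i) else None)"
| "e_act r i (Bar j) =
     (if j = i then Some (if i < r then Bar (i + 1) else Plain r) else None)"

definition act_mat :: "nat \<Rightarrow> (jelt \<Rightarrow> jelt option) \<Rightarrow> complex mat" where
  "act_mat r a = mat (2 * r) (2 * r)
     (\<lambda>(p, q). if a (elt r q) = Some (elt r p) then 1 else 0)"

definition e_mat :: "nat \<Rightarrow> nat \<Rightarrow> complex mat" where
  "e_mat r i = act_mat r (e_act r i)"

definition f_mat :: "nat \<Rightarrow> nat \<Rightarrow> complex mat" where
  "f_mat r i = act_mat r (f_act r i)"

definition mat_exp :: "complex mat \<Rightarrow> complex mat" where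
  "mat_exp A = mat (dim_row A) (dim_col A) (\<lambda>pq. \<Sum>k. (A ^\<^sub>m k) $$ pq / fact k)"

definition xg :: "nat \<Rightarrow> nat \<Rightarrow> complex \<Rightarrow> complex mat" where
  "xg r i t = mat_exp (t \<cdot>\<^sub>m e_mat r i)"

definition yg :: "nat \<Rightarrow> nat \<Rightarrow> complex \<Rightarrow> complex mat" where
  "yg r i t = mat_exp (t \<cdot>\<^sub>m f_mat r i)"

definition coroot :: "nat \<Rightarrow> nat \<Rightarrow> complex \<Rightarrow> complex mat" where
  "coroot r i t = mat (2 * r) (2 * r)
     (\<lambda>(p, q). if p = q then t powi (wt (elt r p) i) else 0)"

definition xneg :: "nat \<Rightarrow> nat \<Rightarrow> complex \<Rightarrow> complex mat" where
  "xneg r i t = yg r i t * coroot r i (inverse t)"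


section \<open>The symplectic group\<close>

text \<open>The signs of the form are forced (up to a common scalar) by invariance under the
  \<open>e\<^sub>i\<close> and \<open>f\<^sub>i\<close>: for \<open>i < r\<close>, invariance under \<open>f\<^sub>i\<close> gives
  \<open>\<langle>v\<^sub>i\<^sub>+\<^sub>1, v\<^bsub>bar(i+1)\<^esub>\<rangle> = - \<langle>v\<^sub>i, v\<^bsub>bar i\<^esub>\<rangle>\<close>.\<close>

fun form :: "jelt \<Rightarrow> jelt \<Rightarrow> complex" where
  "form (Plain i) (Bar j) = (if i = j then (- 1) ^ i else 0)"
| "form (Bar i) (Plain j) = (if i = j then - ((- 1) ^ i) else 0)"
| "form _ _ = 0"

definition form_mat :: "nat \<Rightarrow> complex mat" where
  "form_mat r = mat (2 * r) (2 * r) (\<lambda>(p, q). form (elt r p) (elt r q))"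

definition Sp :: "nat \<Rightarrow> complex mat monoid" where
  "Sp r = \<lparr>carrier = {A \<in> carrier_mat (2 * r) (2 * r).
                        transpose_mat A * form_mat r * A = form_mat r},
           monoid.mult = (*), one = 1\<^sub>m (2 * r)\<rparr>"

definition gprod :: "('a, 'b) monoid_scheme \<Rightarrow> 'a list \<Rightarrow> 'a" where
  "gprod G xs = foldr (\<otimes>\<^bsub>G\<^esub>) xs \<one>\<^bsub>G\<^esub>"

definition torus :: "nat \<Rightarrow> complex mat set" where
  "torus r = {h \<in> carrier (Sp r). diagonal_mat h}"

definition borel_pos :: "nat \<Rightarrow> complex mat set" where
  "borel_pos r = generate (Sp r) (torus r \<union> {xg r i t |i t. i \<in> {1..r}})"

definition borel_neg :: "nat \<Rightarrow> complex mat set" where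
  "borel_neg r = generate (Sp r) (torus r \<union> {yg r i t |i t. i \<in> {1..r}})"

definition unipotent_mat :: "complex mat \<Rightarrow> bool" where
  "unipotent_mat A \<longleftrightarrow> square_mat A \<and>
     (\<exists>k. (A - 1\<^sub>m (dim_row A)) ^\<^sub>m k = 0\<^sub>m (dim_row A) (dim_row A))"

text \<open>The unipotent radical is the largest connected normal unipotent subgroup.
  Connectedness need not be demanded: over \<open>\<complex>\<close> the closure of a normal unipotent subgroup
  is again normal and unipotent, and unipotent algebraic groups are connected.\<close>

definition unip_radical :: "nat \<Rightarrow> complex mat set \<Rightarrow> complex mat set" where
  "unip_radical r B =
     \<Union> {U. normal U ((Sp r)\<lparr>carrier := B\<rparr>) \<and> (\<forall>u\<in>U. unipotent_mat u)}"

definition N_pos :: "nat \<Rightarrow> complex mat set" where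
  "N_pos r = unip_radical r (borel_pos r)"

definition N_neg :: "nat \<Rightarrow> complex mat set" where
  "N_neg r = unip_radical r (borel_neg r)"


section \<open>The Weyl group\<close>

definition weyl :: "nat \<Rightarrow> complex mat set monoid" where
  "weyl r = ((Sp r)\<lparr>carrier := normalizer (Sp r) (torus r)\<rparr>) Mod torus r"

definition s_bar :: "nat \<Rightarrow> nat \<Rightarrow> complex mat" where
  "s_bar r i = xg r i (- 1) * yg r i 1 * xg r i (- 1)"

definition simple_refl :: "nat \<Rightarrow> nat \<Rightarrow> complex mat set" where
  "simple_refl r i = torus r #>\<^bsub>Sp r\<^esub> s_bar r i"

definition weyl_word :: "nat \<Rightarrow> nat list \<Rightarrow> complex mat set" where
  "weyl_word r js = gprod (weyl r) (map (simple_refl r) js)"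

definition reduced_expr :: "nat \<Rightarrow> complex mat set \<Rightarrow> nat list \<Rightarrow> bool" where
  "reduced_expr r w js \<longleftrightarrow> set js \<subseteq> {1..r} \<and> weyl_word r js = w \<and>
     (\<forall>js'. set js' \<subseteq> {1..r} \<and> weyl_word r js' = w \<longrightarrow> length js \<le> length js')"

text \<open>The representative does not depend on the reduced expression, since the \<open>s_bar r i\<close>
  satisfy the braid relations.\<close>

definition weyl_rep :: "nat \<Rightarrow> complex mat set \<Rightarrow> complex mat" where
  "weyl_rep r w = gprod (Sp r) (map (s_bar r) (SOME js. reduced_expr r w js))"


section \<open>Generalized minors\<close>

definition G0 :: "nat \<Rightarrow> complex mat set" where
  "G0 r = {a * h * b |a h b. a \<in> N_neg r \<and> h \<in> torus r \<and> b \<in> N_pos r}"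

definition torus_part :: "nat \<Rightarrow> complex mat \<Rightarrow> complex mat" where
  "torus_part r x =
     (THE h. h \<in> torus r \<and> (\<exists>a\<in>N_neg r. \<exists>b\<in>N_pos r. x = a * h * b))"

text \<open>The character \<open>h \<mapsto> h\<^sup>\<mu>\<close>: the product of the \<open>\<alpha>\<^sub>j\<^sup>\<or>(c\<^sub>j) = c\<^sub>j\<^bsup>h\<^sub>j\<^esup>\<close>
  is sent to the product of the \<open>c\<^sub>j\<^bsup>\<mu>(h\<^sub>j)\<^esup>\<close>.\<close>

definition torus_char :: "nat \<Rightarrow> weight \<Rightarrow> complex mat \<Rightarrow> complex" where
  "torus_char r \<mu> h =
     (THE z. \<exists>c. (\<forall>j\<in>{1..r}. c j \<noteq> 0) \<and>
        h = gprod (Sp r) (map (\<lambda>j. coroot r j (c j)) [1..<Suc r]) \<and>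
        z = (\<Prod>j=1..r. c j powi \<mu> j))"

text \<open>\<open>Sp r\<close> is Zariski closed in the space of matrices, so its regular functions are the
  restrictions of polynomial functions in the matrix entries.\<close>

inductive_set poly_funs :: "nat \<Rightarrow> (complex mat \<Rightarrow> complex) set" for n where
  const: "(\<lambda>_. c) \<in> poly_funs n"
| entry: "p < n \<Longrightarrow> q < n \<Longrightarrow> (\<lambda>x. x $$ (p, q)) \<in> poly_funs n"
| add: "F \<in> poly_funs n \<Longrightarrow> F' \<in> poly_funs n \<Longrightarrow> (\<lambda>x. F x + F' x) \<in> poly_funs n"
| mul: "F \<in> poly_funs n \<Longrightarrow> F' \<in> poly_funs n \<Longrightarrow> (\<lambda>x. F x * F' x) \<in> poly_funs n"

definition regular_on_Sp :: "nat \<Rightarrow> (complex mat \<Rightarrow> complex) \<Rightarrow> bool" where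
  "regular_on_Sp r F \<longleftrightarrow> (\<exists>P\<in>poly_funs (2 * r). \<forall>x\<in>carrier (Sp r). F x = P x)"

definition is_gen_minor ::
  "nat \<Rightarrow> complex mat set \<Rightarrow> complex mat set \<Rightarrow> nat \<Rightarrow> (complex mat \<Rightarrow> complex) \<Rightarrow> bool" where
  "is_gen_minor r w w' i F \<longleftrightarrow> regular_on_Sp r F \<and>
     (\<forall>x\<in>carrier (Sp r).
        let x' = inv\<^bsub>Sp r\<^esub> (weyl_rep r w) * x * weyl_rep r w'
        in x' \<in> G0 r \<longrightarrow> F x = torus_char r (fund_weight i) (torus_part r x'))"

text \<open>\<open>gen_minor r w w' i\<close> is the generalized minor for the weights \<open>w\<Lambda>\<^sub>i\<close> and
  \<open>w'\<Lambda>\<^sub>i\<close>. Its values on the group are determined by \<open>is_gen_minor\<close> (the open cell is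
  dense); off the group they are meaningless, whence \<open>SOME\<close> rather than \<open>THE\<close>.\<close>

definition gen_minor ::
  "nat \<Rightarrow> complex mat set \<Rightarrow> complex mat set \<Rightarrow> nat \<Rightarrow> complex mat \<Rightarrow> complex" where
  "gen_minor r w w' i = (SOME F. is_gen_minor r w w' i F)"


section \<open>The word and the minors along it\<close>

text \<open>The positions of the word \<open>(1, \<dots>, r, \<dots>, 1, \<dots>, r, 1, \<dots>, d)\<close> with \<open>m\<close> cycles, as
  pairs (number of the cycle, letter). They also enumerate the subscripts of \<open>\<^bold>Y\<close>.\<close>

definition cycle_letters :: "nat \<Rightarrow> nat \<Rightarrow> nat \<Rightarrow> (nat \<times> nat) list" where
  "cycle_letters r m d =
     concat (map (\<lambda>l. map (Pair l) [1..<Suc r]) [1..<m]) @ map (Pair m) [1..<Suc d]"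

definition word :: "nat \<Rightarrow> nat \<Rightarrow> nat \<Rightarrow> nat list" where
  "word r m d = map snd (cycle_letters r m d)"

definition xL :: "nat \<Rightarrow> nat \<Rightarrow> nat \<Rightarrow> (nat \<Rightarrow> nat \<Rightarrow> complex) \<Rightarrow> complex mat" where
  "xL r m d Y = gprod (Sp r) (map (\<lambda>(l, i). xneg r i (Y l i)) (cycle_letters r m d))"

definition Delta :: "nat \<Rightarrow> nat \<Rightarrow> nat \<Rightarrow> nat \<Rightarrow> complex mat \<Rightarrow> complex" where
  "Delta r m d k = gen_minor r (weyl_word r (take k (word r m d))) \<one>\<^bsub>weyl r\<^esub>
     (word r m d ! (k - 1))"

definition DeltaL :: "nat \<Rightarrow> nat \<Rightarrow> nat \<Rightarrow> nat \<Rightarrow> (nat \<Rightarrow> nat \<Rightarrow> complex) \<Rightarrow> complex" where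
  "DeltaL r m d k Y = Delta r m d k (xL r m d Y)"


section \<open>The monomials and the families of indices\<close>

definition Yconv :: "nat \<Rightarrow> (nat \<Rightarrow> nat \<Rightarrow> complex) \<Rightarrow> nat \<Rightarrow> nat \<Rightarrow> complex" where
  "Yconv r Y s k = (if k = 0 \<or> k = r + 1 then 1 else Y s k)"

definition Cbar :: "nat \<Rightarrow> (nat \<Rightarrow> nat \<Rightarrow> complex) \<Rightarrow> nat \<Rightarrow> nat \<Rightarrow> complex" where
  "Cbar r Y l k = Yconv r Y l (k - 1) / Yconv r Y l k"

definition C :: "nat \<Rightarrow> (nat \<Rightarrow> nat \<Rightarrow> complex) \<Rightarrow> nat \<Rightarrow> nat \<Rightarrow> complex" where
  "C r Y l k = Yconv r Y l (k + 1) / Yconv r Y (l + 1) k"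

text \<open>\<open>\<kappa> s i\<close> stands for \<open>k\<^sub>i\<^bsup>(s)\<^esup>\<close>. The extensional function spaces make each family
  occur exactly once.\<close>

definition families :: "nat \<Rightarrow> nat \<Rightarrow> nat \<Rightarrow> nat \<Rightarrow> (nat \<Rightarrow> nat \<Rightarrow> jelt) set" where
  "families r m m' d =
     {\<kappa> \<in> {1..m - m'} \<rightarrow>\<^sub>E ({1..d} \<rightarrow>\<^sub>E J r).
        (\<forall>s\<in>{1..m - m'}. \<forall>i\<in>{1..<d}. \<kappa> s i < \<kappa> s (i + 1)) \<and>
        (\<forall>i\<in>{1..d}. \<forall>s\<in>{1..<m - m'}. \<kappa> s i \<le> \<kappa> (s + 1) i) \<and>
        (\<forall>i\<in>{1..d}. i \<le> r - m' \<longrightarrow> (\<forall>s\<in>{1..m - m'}. \<kappa> s i \<le> Plain (m' + i)))}"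

definition delta :: "nat \<Rightarrow> nat \<Rightarrow> (nat \<Rightarrow> nat \<Rightarrow> jelt) \<Rightarrow> nat \<Rightarrow> nat" where
  "delta r M \<kappa> i = (THE \<delta>. \<delta> \<le> M \<and>
     (\<forall>s\<in>{1..\<delta>}. \<kappa> s i \<le> Plain r) \<and> (\<forall>s\<in>{\<delta> + 1..M}. Bar r \<le> \<kappa> s i))"

text \<open>On \<open>families r m m' d\<close> no truncated subtraction occurs: \<open>i \<le> absJ (\<kappa> s i)\<close> for plain
  \<open>\<kappa> s i\<close> because \<open>\<kappa> s\<close> is strictly increasing, \<open>i \<le> d \<le> r\<close>, and the value never
  exceeds \<open>m - 1\<close>.\<close>

definition ell :: "nat \<Rightarrow> nat \<Rightarrow> (nat \<Rightarrow> nat \<Rightarrow> jelt) \<Rightarrow> nat \<Rightarrow> nat \<Rightarrow> nat" where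
  "ell r M \<kappa> s i =
     (if s \<le> delta r M \<kappa> i then absJ (\<kappa> s i) + s - i - 1 else s + r - i)"

definition monomial ::
  "nat \<Rightarrow> nat \<Rightarrow> nat \<Rightarrow> nat \<Rightarrow> (nat \<Rightarrow> nat \<Rightarrow> complex) \<Rightarrow> (nat \<Rightarrow> nat \<Rightarrow> jelt) \<Rightarrow> complex" where
  "monomial r m m' d Y \<kappa> =
     (let M = m - m' in
      \<Prod>i = 1..d.
        (\<Prod>s = 1..delta r M \<kappa> i. Cbar r Y (m - ell r M \<kappa> s i) (absJ (\<kappa> s i))) *
        (\<Prod>s = delta r M \<kappa> i + 1..M. C r Y (m - ell r M \<kappa> s i) (absJ (\<kappa> s i) - 1)))"

end

theory Submission
  imports Defs "Jordan_Normal_Form.Determinant"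
begin

text \<open>
  The elements \<open>x\<^sub>i(t)\<close>, \<open>y\<^sub>i(t)\<close> and the torus generate a group in which the big cell
  is Zariski dense, so a generalized minor is determined there by its values on the big cell. It is the
  leading minor of \<open>w\<^sup>-\<^sup>1 x\<close>, with \<open>w\<close> the representative of the Weyl group element: up to
  signs, which are governed by inversions, a minor of \<open>x\<close> with permuted rows.

  The matrix \<open>x\<close> is a product of cycles. Applying one cycle moves a plain row by at most one position, but
  a barred row by arbitrarily many. Following the barred half of the network diagonally, so that barred
  positions are visited with a delay, turns every matrix entry into a sum over lattice paths that move by at
  most one position per step. Row operations bring the minor into the form in which row \<open>i\<close> counts the paths
  with a prescribed number of stays and a prescribed end, and such a determinant is a sum over tableaux, in
  the manner of the Jacobi-Trudi identity for flagged Schur functions. Every stay has as its weight one of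
  the factors \<open>Cbar\<close> and \<open>C\<close>.
\<close>

section \<open>Lattice paths and flagged tableaux\<close>

text \<open>Weights may depend on the step as well as on the position. In the path of row i, box s
  is a stay at some position \<kappa> after \<kappa> - i moves and s earlier stays, so its step
  \<kappa> + s - i can be read off the tableau. Hence cycles with unrelated parameters still give a
  tableau formula.

  The shape is a rectangle with m - m' boxes per row, and every row of the minor has to fit it. A
  plain row does: m steps lift a path from i to m' + i and leave m - m' stays. A barred row, counted
  with its delay, leaves i - (r - m') stays too many. Exactly so many cycles are stripped from it by
  the row operations. It is also rescaled, since a barred row carries a normalizing factor that
  changes from cycle to cycle.

  The barred rows of the minor occur in decreasing order. The signs that the representative puts on
  them multiply to the sign of their reversal, so sorting the rows leaves a formula without signs.

  Minors and representatives are given by choice operators and the unipotent radicals as unions of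
  subgroups. The radicals enter through an inner bound by generators and an outer bound by
  unitriangular matrices.\<close>

fun paths :: "(nat \<Rightarrow> nat \<Rightarrow> 'a::comm_ring_1) \<Rightarrow> nat \<Rightarrow> nat \<Rightarrow> nat \<Rightarrow> 'a" where
  "paths W 0 b c = (if b = Suc c then 1 else 0)"
| "paths W (Suc \<tau>) 0 c = 0"
| "paths W (Suc \<tau>) (Suc b) c = W \<tau> b * paths W \<tau> (Suc b) c + paths W \<tau> b c"

text \<open>The index \<open>b\<close> is the current position plus one, and 0 stands for having
  left the range at its lower end. Followed backwards in time, the position drops by at most one per
  step and never rises.\<close>

lemma paths_eq_0: "b \<le> c \<or> Suc c + \<tau> < b \<Longrightarrow> paths W \<tau> b c = 0"
  by (induction W \<tau> b c rule: paths.induct) auto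

lemma paths_unit: "b = Suc c + \<tau> \<Longrightarrow> paths W \<tau> b c = 1"
proof (induction \<tau> arbitrary: b)
  case (Suc \<tau>)
  then show ?case by (cases b) (auto simp: paths_eq_0)
qed simp

definition tab_shape :: "nat \<Rightarrow> (nat \<Rightarrow> nat) \<Rightarrow> (nat \<times> nat) set" where
  "tab_shape d n = (SIGMA i:{..<d}. {..<n i})"

definition tableaux :: "nat \<Rightarrow> (nat \<Rightarrow> nat) \<Rightarrow> (nat \<Rightarrow> nat) \<Rightarrow> (nat \<times> nat \<Rightarrow> nat) set" where
  "tableaux d n b =
     {\<kappa> \<in> (\<Pi>\<^sub>E (i, s)\<in>tab_shape d n. {..<b i}).
        (\<forall>i s. i < d \<longrightarrow> Suc s < n i \<longrightarrow> \<kappa> (i, s) \<le> \<kappa> (i, Suc s)) \<and>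
        (\<forall>i s. Suc i < d \<longrightarrow> s < n (Suc i) \<longrightarrow> \<kappa> (i, s) < \<kappa> (Suc i, s))}"

text \<open>The first argument of \<open>W\<close> is the step at which the stay takes place. On
  tableaux with decreasing row lengths the subtraction is exact by
  \<open>tableaux_lower\<close>.\<close>

definition tab_weight ::
  "(nat \<Rightarrow> nat \<Rightarrow> 'a::comm_ring_1) \<Rightarrow> nat \<Rightarrow> (nat \<Rightarrow> nat) \<Rightarrow> (nat \<times> nat \<Rightarrow> nat) \<Rightarrow> 'a" where
  "tab_weight W d n \<kappa> = (\<Prod>(i, s)\<in>tab_shape d n. W (\<kappa> (i, s) + s - i) (\<kappa> (i, s)))"

lemma finite_tab_shape [simp]: "finite (tab_shape d n)"
  by (simp add: tab_shape_def)

lemma finite_tableaux [simp]: "finite (tableaux d n b)"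
  unfolding tableaux_def by (rule finite_subset[OF _ finite_PiE[of "tab_shape d n" "\<lambda>(i, s). {..<b i}"]]) auto

lemma tab_shape_iff [simp]: "(i, s) \<in> tab_shape d n \<longleftrightarrow> i < d \<and> s < n i"
  by (auto simp: tab_shape_def)

lemma tableaux_iff:
  "\<kappa> \<in> tableaux d n b \<longleftrightarrow> \<kappa> \<in> extensional (tab_shape d n) \<and>
     (\<forall>i s. i < d \<longrightarrow> s < n i \<longrightarrow> \<kappa> (i, s) < b i) \<and>
     (\<forall>i s. i < d \<longrightarrow> Suc s < n i \<longrightarrow> \<kappa> (i, s) \<le> \<kappa> (i, Suc s)) \<and>
     (\<forall>i s. Suc i < d \<longrightarrow> s < n (Suc i) \<longrightarrow> \<kappa> (i, s) < \<kappa> (Suc i, s))"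
  by (auto simp: tableaux_def PiE_def Pi_def)

lemma tableaux_row_mono:
  assumes "\<kappa> \<in> tableaux d n b" "i < d" "s \<le> t" "t < n i"
  shows "\<kappa> (i, s) \<le> \<kappa> (i, t)"
  using assms(3,4)
proof (induction t rule: dec_induct)
  case (step t)
  then have "\<kappa> (i, t) \<le> \<kappa> (i, Suc t)" using assms(1,2) unfolding tableaux_def by blast
  with step show ?case by simp
qed simp

lemma tableaux_bound:
  assumes "\<kappa> \<in> tableaux d n b" "i < d" "s < n i"
  shows "\<kappa> (i, s) < b i"
proof -
  have "\<kappa> \<in> (\<Pi>\<^sub>E (i, s)\<in>tab_shape d n. {..<b i})" using assms(1) by (simp add: tableaux_def)
  from PiE_mem[OF this, of "(i, s)"] show ?thesis using assms by simp
qed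

text \<open>Each of the i boxes above forces an increase by one; decreasing row lengths guarantee
  that these boxes exist.\<close>

lemma tableaux_lower:
  assumes "\<kappa> \<in> tableaux d n b" "\<And>i. Suc i < d \<Longrightarrow> n (Suc i) \<le> n i" "i < d" "s < n i"
  shows "i \<le> \<kappa> (i, s)"
  using assms(3,4)
proof (induction i)
  case (Suc i)
  then have "i \<le> \<kappa> (i, s)" using assms(2)[of i] by simp
  moreover have "\<kappa> (i, s) < \<kappa> (Suc i, s)" using assms(1) Suc.prems unfolding tableaux_def by blast
  ultimately show ?case by simp
qed simp

section \<open>Determinants: expansion and vanishing criteria\<close>

lemma det_row_linear:
  fixes f :: "nat \<Rightarrow> nat \<Rightarrow> 'a::comm_ring_1"
  assumes "j < d" and "\<And>c. c < d \<Longrightarrow> f j c = a * g c + h c"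
  shows "det (mat d d (\<lambda>(i, c). f i c)) =
    a * det (mat d d (\<lambda>(i, c). if i = j then g c else f i c)) +
    det (mat d d (\<lambda>(i, c). if i = j then h c else f i c))"
proof -
  let ?A = "mat d d (\<lambda>(i, c). f i c)"
  let ?B = "\<lambda>g. mat d d (\<lambda>(i, c). if i = j then g c else f i c)"
  have cof: "cofactor (?B g) j c = cofactor ?A j c" if "c < d" for c g
  proof -
    have "mat_delete (?B g) j c = mat_delete ?A j c"
      by (rule eq_matI) (auto simp: mat_delete_def)
    then show ?thesis by (simp add: cofactor_def)
  qed
  have lap: "det (?B g) = (\<Sum>c<d. g c * cofactor ?A j c)" for g
    using laplace_expansion_row[of "?B g" d j] assms(1) by (simp add: cof)
  have "det ?A = (\<Sum>c<d. f j c * cofactor ?A j c)"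
    using laplace_expansion_row[of ?A d j] assms(1) by simp
  then show ?thesis
    by (simp add: lap assms(2) algebra_simps sum.distrib sum_distrib_left)
qed

lemma det_eq_0_rows_eq:
  fixes f :: "nat \<Rightarrow> nat \<Rightarrow> 'a::comm_ring_1"
  assumes "i < d" "j < d" "i \<noteq> j" "\<And>c. c < d \<Longrightarrow> f i c = f j c"
  shows "det (mat d d (\<lambda>(i, c). f i c)) = 0"
  by (rule det_identical_rows[OF _ assms(3,1,2)]) (use assms in \<open>auto intro!: eq_vecI\<close>)

text \<open>The first j + 1 rows are supported on j columns, so by the pigeonhole principle every
  permutation picks a zero entry.\<close>

lemma det_eq_0_zero_block:
  fixes f :: "nat \<Rightarrow> nat \<Rightarrow> 'a::comm_ring_1"
  assumes "j < d" and z: "\<And>i c. i \<le> j \<Longrightarrow> j \<le> c \<Longrightarrow> c < d \<Longrightarrow> f i c = 0"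
  shows "det (mat d d (\<lambda>(i, c). f i c)) = 0"
proof -
  have "(\<Prod>i = 0..<d. mat d d (\<lambda>(i, c). f i c) $$ (i, p i)) = 0" if p: "p permutes {0..<d}" for p
  proof -
    have "\<not> p ` {0..j} \<subseteq> {0..<j}"
    proof
      assume "p ` {0..j} \<subseteq> {0..<j}"
      then have "card (p ` {0..j}) \<le> j" using card_mono[of "{0..<j}"] by force
      then show False using card_image[OF permutes_inj_on[OF p], of "{0..j}"] by simp
    qed
    then obtain i where i: "i \<le> j" "j \<le> p i" by force
    moreover have "p i < d" using permutes_in_image[OF p, of i] i assms(1) by simp
    ultimately show ?thesis
      using z[of i "p i"] assms(1) by (intro prod_zero bexI[of _ i]) auto
  qed
  then show ?thesis by (subst det_def'[of _ d]) (auto intro!: sum.neutral)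
qed

lemma det_last_row_unit:
  fixes f :: "nat \<Rightarrow> nat \<Rightarrow> 'a::comm_ring_1"
  assumes "\<And>c. c < d \<Longrightarrow> f d c = 0" and "f d d = 1"
  shows "det (mat (Suc d) (Suc d) (\<lambda>(i, c). f i c)) = det (mat d d (\<lambda>(i, c). f i c))"
proof -
  let ?A = "mat (Suc d) (Suc d) (\<lambda>(i, c). f i c)"
  have "mat_delete ?A d d = mat d d (\<lambda>(i, c). f i c)"
    by (rule eq_matI) (auto simp: mat_delete_def)
  then have c: "cofactor ?A d d = det (mat d d (\<lambda>(i, c). f i c))"
    by (simp add: cofactor_def flip: power2_eq_square mult_2)
  show ?thesis
    using laplace_expansion_row[of ?A "Suc d" d] assms c by simp
qed

section \<open>Splitting boxes off a tableau\<close>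

lemma tableaux_drop_empty_row:
  assumes "n d = 0"
  shows "tableaux (Suc d) n b = tableaux d n b" "tab_weight W (Suc d) n = tab_weight W d n"
proof -
  have sh: "tab_shape (Suc d) n = tab_shape d n"
    using assms by (auto simp: tab_shape_def less_Suc_eq)
  show "tab_weight W (Suc d) n = tab_weight W d n" by (simp add: tab_weight_def sh fun_eq_iff)
  show "tableaux (Suc d) n b = tableaux d n b"
    unfolding tableaux_def sh using assms by (auto simp: less_Suc_eq)
qed

text \<open>Rows increase weakly, so the last box of row j carries its maximum: either it attains
  the largest admissible value e, or the whole row obeys the bound e.\<close>

lemma tableaux_split:
  assumes "j < d" "n j = Suc k" "b j = Suc e"
  shows "tableaux d n b = tableaux d n (b(j := e)) \<union> {\<kappa> \<in> tableaux d n b. \<kappa> (j, k) = e}"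
    and "tableaux d n (b(j := e)) \<inter> {\<kappa> \<in> tableaux d n b. \<kappa> (j, k) = e} = {}"
proof -
  show "tableaux d n (b(j := e)) \<inter> {\<kappa> \<in> tableaux d n b. \<kappa> (j, k) = e} = {}"
    using tableaux_bound[of _ d n "b(j := e)" j k] assms by auto
  have "\<kappa> \<in> tableaux d n b" if k: "\<kappa> \<in> tableaux d n (b(j := e))" for \<kappa>
  proof -
    have "\<kappa> (i, s) < b i" if "i < d" "s < n i" for i s
      using tableaux_bound[OF k that] assms by (cases "i = j") auto
    moreover have "\<kappa> \<in> extensional (tab_shape d n)"
      using k by (auto simp: tableaux_def PiE_def)
    ultimately show ?thesis using k unfolding tableaux_def PiE_def by (auto simp: Pi_def)
  qed
  moreover have "\<kappa> \<in> tableaux d n (b(j := e))" if k: "\<kappa> \<in> tableaux d n b" and ne: "\<kappa> (j, k) \<noteq> e" for \<kappa>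
  proof -
    have "\<kappa> (j, k) < e" using tableaux_bound[OF k, of j k] assms ne by simp
    then have "\<kappa> (j, s) < e" if "s < n j" for s
      using tableaux_row_mono[OF k, of j s k] that assms by simp
    then have "\<kappa> (i, s) < (b(j := e)) i" if "i < d" "s < n i" for i s
      using tableaux_bound[OF k that] that by (cases "i = j") auto
    moreover have "\<kappa> \<in> extensional (tab_shape d n)"
      using k by (auto simp: tableaux_def PiE_def)
    ultimately show ?thesis using k unfolding tableaux_def PiE_def by (auto simp: Pi_def)
  qed
  ultimately show "tableaux d n b = tableaux d n (b(j := e)) \<union> {\<kappa> \<in> tableaux d n b. \<kappa> (j, k) = e}"
    by auto
qed

lemma tab_shape_remove:
  assumes "j < d" "n j = Suc k"
  shows "tab_shape d n = insert (j, k) (tab_shape d (n(j := k)))"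
    and "(j, k) \<notin> tab_shape d (n(j := k))"
  using assms by (auto simp: tab_shape_def split: if_splits)

text \<open>Counterpart of the stay term in the path recursion: the box removed is the last stay of
  row j, at step e + k - j. Refilling it with e respects the columns, because the entries of the row
  above are smaller than e and the row below ends before column k.\<close>

lemma tableaux_remove_last:
  assumes j: "j < d" "n j = Suc k" "b j = Suc e"
    and above: "\<And>i. j = Suc i \<Longrightarrow> n j \<le> n i \<and> b i \<le> e"
    and below: "Suc j < d \<Longrightarrow> n (Suc j) \<le> k"
  shows "(\<Sum>\<kappa>\<in>{\<kappa> \<in> tableaux d n b. \<kappa> (j, k) = e}. tab_weight W d n \<kappa>) =
    W (e + k - j) e * (\<Sum>\<kappa>\<in>tableaux d (n(j := k)) b. tab_weight W d (n(j := k)) \<kappa>)"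
proof -
  let ?n = "n(j := k)"
  note sh = tab_shape_remove[of j d n k, OF j(1,2)]
  have wt: "tab_weight W d n (\<kappa>((j, k) := e)) = W (e + k - j) e * tab_weight W d ?n \<kappa>" for \<kappa>
  proof -
    have "(\<Prod>(i, s)\<in>tab_shape d ?n. W ((\<kappa>((j, k) := e)) (i, s) + s - i) ((\<kappa>((j, k) := e)) (i, s)))
        = tab_weight W d ?n \<kappa>"
      unfolding tab_weight_def
      by (rule prod.cong) (use sh(2) in auto)
    then show ?thesis
      unfolding tab_weight_def[of W d n] sh(1)
      by (subst prod.insert) (use sh(2) in auto)
  qed
  have "(\<Sum>\<kappa>\<in>{\<kappa> \<in> tableaux d n b. \<kappa> (j, k) = e}. tab_weight W d n \<kappa>) =
    (\<Sum>\<kappa>\<in>tableaux d ?n b. tab_weight W d n (\<kappa>((j, k) := e)))"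
  proof (rule sum.reindex_bij_witness[where i = "\<lambda>\<kappa>. \<kappa>((j, k) := e)" and j = "\<lambda>\<kappa>. \<kappa>((j, k) := undefined)"])
    fix \<kappa> assume "\<kappa> \<in> {\<kappa> \<in> tableaux d n b. \<kappa> (j, k) = e}"
    then have k: "\<kappa> \<in> tableaux d n b" and e: "\<kappa> (j, k) = e" by auto
    show "(\<kappa>((j, k) := undefined))((j, k) := e) = \<kappa>" using e by auto
    then show "tab_weight W d n ((\<kappa>((j, k) := undefined))((j, k) := e)) = tab_weight W d n \<kappa>" by simp
    show "\<kappa>((j, k) := undefined) \<in> tableaux d ?n b"
      using k j below unfolding tableaux_iff
      by (auto simp: extensional_def)
  next
    fix \<kappa> assume k: "\<kappa> \<in> tableaux d ?n b"
    have ex: "\<kappa> \<in> extensional (tab_shape d ?n)" using k by (simp add: tableaux_def PiE_def)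
    then have un: "\<kappa> (j, k) = undefined"
      using sh(2) by (auto simp: extensional_def)
    then show "(\<kappa>((j, k) := e))((j, k) := undefined) = \<kappa>" by auto
    have bd: "\<kappa> (i, s) < b i" if "i < d" "s < ?n i" for i s using tableaux_bound[OF k that] .
    have row: "\<kappa> (i, s) \<le> \<kappa> (i, Suc s)" if "i < d" "Suc s < ?n i" for i s
      using k that unfolding tableaux_def by blast
    have col: "\<kappa> (i, s) < \<kappa> (Suc i, s)" if "Suc i < d" "s < ?n (Suc i)" for i s
      using k that unfolding tableaux_def by blast
    let ?k = "\<kappa>((j, k) := e)"
    have "?k \<in> (\<Pi>\<^sub>E (i, s)\<in>tab_shape d n. {..<b i})"
    proof (rule PiE_I)
      fix x assume "x \<in> tab_shape d n"
      then show "?k x \<in> (case x of (i, s) \<Rightarrow> {..<b i})"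
        using bd bd[of j "snd x"] j by (cases x; cases "fst x = j") (auto simp: less_Suc_eq)
    next
      fix x assume "x \<notin> tab_shape d n"
      then show "?k x = undefined" using extensional_arb[OF ex, of x] unfolding sh(1) by auto
    qed
    moreover have "?k (i, s) \<le> ?k (i, Suc s)" if "i < d" "Suc s < n i" for i s
    proof (cases "i = j")
      case True
      then show ?thesis using that j row[of j s] bd[of j s] by (cases "Suc s = k") auto
    next
      case False
      then show ?thesis using row[of i s] that by simp
    qed
    moreover have "?k (i, s) < ?k (Suc i, s)" if "Suc i < d" "s < n (Suc i)" for i s
    proof (cases "Suc i = j \<and> s = k")
      case True
      then show ?thesis using bd[of i s] above[of i] that j by auto
    next
      case False
      then show ?thesis using that below col[of i s] j
        by (cases "Suc i = j"; cases "i = j") (auto simp: less_Suc_eq)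
    qed
    ultimately show "?k \<in> {\<kappa> \<in> tableaux d n b. \<kappa> (j, k) = e}" by (auto simp: tableaux_def)
  qed
  then show ?thesis by (simp add: wt sum_distrib_left)
qed


text \<open>Row \<open>i\<close> of the determinant counts lattice paths with \<open>n i\<close> stays that end at \<open>b i\<close>. The recursion
  for the paths is expanded in the first row of the last block of rows with equal ends.\<close>

theorem det_paths_eq_sum_tableaux:
  fixes W :: "nat \<Rightarrow> nat \<Rightarrow> 'a::comm_ring_1"
  assumes "\<And>i. i < d \<Longrightarrow> i < b i"
    and "\<And>i. Suc i < d \<Longrightarrow> n (Suc i) \<le> n i"
    and "\<And>i. Suc i < d \<Longrightarrow> b i \<le> b (Suc i)"
  shows "det (mat d d (\<lambda>(i, c). paths W (n i + b i - Suc i) (b i) c)) =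
    (\<Sum>\<kappa>\<in>tableaux d n b. tab_weight W d n \<kappa>)"
  using assms
proof (induction "d + (\<Sum>i<d. n i + b i)" arbitrary: d n b rule: less_induct)
  case less
  define f where "f n b = (\<lambda>i. paths W (n i + b i - Suc i) (b i))" for n b :: "nat \<Rightarrow> nat"
  define S where "S d n b = (\<Sum>\<kappa>\<in>tableaux d n b. tab_weight W d n \<kappa>)" for d n b
  have IH: "det (mat d' d' (\<lambda>(i, c). f n' b' i c)) = S d' n' b'"
    if "d' + (\<Sum>i<d'. n' i + b' i) < d + (\<Sum>i<d. n i + b i)" "\<And>i. i < d' \<Longrightarrow> i < b' i"
      "\<And>i. Suc i < d' \<Longrightarrow> n' (Suc i) \<le> n' i" "\<And>i. Suc i < d' \<Longrightarrow> b' i \<le> b' (Suc i)" for d' n' b'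
    unfolding f_def S_def by (rule less.hyps) (use that in blast)+
  note b = less.prems(1) and n = less.prems(2) and bm = less.prems(3)
  have "det (mat d d (\<lambda>(i, c). f n b i c)) = S d n b"
  proof (cases d)
    case 0
    then show ?thesis
      by (simp add: S_def tableaux_def tab_shape_def tab_weight_def det_dim_zero)
  next
    case (Suc p)
    show ?thesis
    proof (cases "n p = 0")
      case True
      \<comment> \<open>With no stay left, b p - Suc p steps just suffice to climb from p to the
        final position b p - 1, which is out of reach from lower starting points: the last row is a
        unit vector.\<close>
      have "det (mat d d (\<lambda>(i, c). f n b i c)) = det (mat p p (\<lambda>(i, c). f n b i c))"
        unfolding Suc
      proof (rule det_last_row_unit)
        show "f n b p c = 0" if "c < p" for c
          using b[of p] Suc that True by (simp add: f_def paths_eq_0)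
        show "f n b p p = 1" using b[of p] Suc True by (simp add: f_def paths_unit)
      qed
      also have "\<dots> = S p n b"
        by (rule IH) (use Suc b n bm in auto)
      also have "\<dots> = S d n b"
        by (simp add: S_def Suc tableaux_drop_empty_row[of n p, OF True])
      finally show ?thesis .
    next
      case False
      \<comment> \<open>The first row of the block is taken because the row above it has a strictly
        smaller bound: lowering \<open>b j\<close> by one then keeps the bounds monotone, and the
        value e in row j exceeds everything above it.\<close>
      define j where "j = (LEAST j. b j = b p)"
      have bj: "b j = b p" unfolding j_def by (rule LeastI) simp
      have jp: "j \<le> p" unfolding j_def by (rule Least_le) simp
      then have jd: "j < d" using Suc by simp
      have bmono: "b i \<le> b k" if "i \<le> k" "k < d" for i k
        using that by (induction k rule: dec_induct) (use bm order_trans in \<open>force+\<close>)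
      have nmono: "n k \<le> n i" if "i \<le> k" "k < d" for i k
        using that by (induction k rule: dec_induct) (use n order_trans in \<open>force+\<close>)
      have "n j > 0" using nmono[of j p] jp Suc False by simp
      then obtain k where k: "n j = Suc k" using gr0_implies_Suc by blast
      obtain e where e: "b j = Suc e" using b[OF jd] by (cases "b j") auto
      have above: "b i \<le> e" if "j = Suc i" for i
      proof -
        have "b i \<noteq> b p" using not_less_Least[of i "\<lambda>j. b j = b p"] that unfolding j_def[symmetric] by simp
        then show ?thesis using bmono[of i j] that jd bj e by simp
      qed
      have je: "j \<le> e" using b[OF jd] e by simp
      let ?n = "n(j := k)" and ?b = "b(j := e)"
      have less_n: "d + (\<Sum>i<d. ?n i + b i) < d + (\<Sum>i<d. n i + b i)"
        using jd k by (intro add_strict_left_mono sum_strict_mono_ex1) auto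
      have less_b: "d + (\<Sum>i<d. n i + ?b i) < d + (\<Sum>i<d. n i + b i)"
        using jd e by (intro add_strict_left_mono sum_strict_mono_ex1) auto
      have "f n b j c = W (e + k - j) e * f ?n b j c + f n ?b j c" for c
      proof -
        have "n j + b j - Suc j = Suc (e + k - j)" "?n j + b j - Suc j = e + k - j"
          "n j + ?b j - Suc j = e + k - j" using je k e by simp_all
        then show ?thesis unfolding f_def by (simp only: e fun_upd_same paths.simps)
      qed
      then have "det (mat d d (\<lambda>(i, c). f n b i c)) =
        W (e + k - j) e * det (mat d d (\<lambda>(i, c). if i = j then f ?n b j c else f n b i c)) +
        det (mat d d (\<lambda>(i, c). if i = j then f n ?b j c else f n b i c))"
        using det_row_linear[OF jd, of "f n b"] by blast
      also have "(\<lambda>(i, c). if i = j then f ?n b j c else f n b i c) = (\<lambda>(i, c). f ?n b i c)"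
        by (auto simp: f_def fun_eq_iff)
      also have "(\<lambda>(i, c). if i = j then f n ?b j c else f n b i c) = (\<lambda>(i, c). f n ?b i c)"
        by (auto simp: f_def fun_eq_iff)
      also have "det (mat d d (\<lambda>(i, c). f n ?b i c)) = S d n ?b"
      \<comment> \<open>For e = j the lowered bound admits no tableau, as the entries of row j are
        at least j. On the determinant side the rows 0 to j vanish from column j on.\<close>
      proof (cases "e = j")
        case False
        show ?thesis
        proof (rule IH[OF less_b])
          show "i < ?b i" if "i < d" for i using b[OF that] je False by auto
          show "?b i \<le> ?b (Suc i)" if "Suc i < d" for i
            using bm[OF that] above[of i] e by (cases "Suc i = j"; cases "i = j") auto
        qed (rule n)
      next
        case True
        have "det (mat d d (\<lambda>(i, c). f n ?b i c)) = 0"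
        proof (rule det_eq_0_zero_block[OF jd])
          fix i c assume i: "i \<le> j" "j \<le> c" "c < d"
          have "?b i \<le> e"
          proof (cases "i = j")
            case False
            then obtain j' where j': "j = Suc j'" "i \<le> j'" using i by (cases j) auto
            then show ?thesis using above[of j'] bmono[of i j'] jd False by simp
          qed simp
          then show "f n ?b i c = 0" using True i by (simp add: f_def paths_eq_0)
        qed
        moreover have "tableaux d n ?b = {}"
        proof (rule equals0I)
          fix \<kappa> assume k': "\<kappa> \<in> tableaux d n ?b"
          show False
            using tableaux_lower[OF k' n jd, of 0] tableaux_bound[OF k' jd, of 0] True k by simp
        qed
        ultimately show ?thesis by (simp add: S_def)
      qed
      also have "W (e + k - j) e * det (mat d d (\<lambda>(i, c). f ?n b i c)) =
        (\<Sum>\<kappa>\<in>{\<kappa> \<in> tableaux d n b. \<kappa> (j, k) = e}. tab_weight W d n \<kappa>)"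
      \<comment> \<open>If the next row is equally long, removing the box would break the shape.
        Then the shortened row j of the determinant coincides with row j + 1, and no tableau has the
        maximal value e in a box that has another one with the same bound beneath it.\<close>
      proof (cases "Suc j < d \<and> n (Suc j) = n j")
        case True
        have bj': "b (Suc j) = b j"
          using True bmono[of "Suc j" p] bmono[of j "Suc j"] bj Suc by simp
        have "det (mat d d (\<lambda>(i, c). f ?n b i c)) = 0"
          by (rule det_eq_0_rows_eq[of j d "Suc j"]) (use True jd bj' k in \<open>auto simp: f_def\<close>)
        moreover have "{\<kappa> \<in> tableaux d n b. \<kappa> (j, k) = e} = {}"
        proof (rule equals0I)
          fix \<kappa> assume "\<kappa> \<in> {\<kappa> \<in> tableaux d n b. \<kappa> (j, k) = e}"
          then have k': "\<kappa> \<in> tableaux d n b" "\<kappa> (j, k) = e" by auto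
          then have "\<kappa> (j, k) < \<kappa> (Suc j, k)" using True k unfolding tableaux_def by auto
          then show False using tableaux_bound[OF k'(1), of "Suc j" k] True k k'(2) bj' e by simp
        qed
        ultimately show ?thesis by (simp only: sum.empty mult_zero_right)
      next
        case False
        have below: "n (Suc j) \<le> k" if "Suc j < d" using False that n[OF that] k by simp
        have "det (mat d d (\<lambda>(i, c). f ?n b i c)) = S d ?n b"
        proof (rule IH[OF less_n])
          show "?n (Suc i) \<le> ?n i" if "Suc i < d" for i
            using n[OF that] below k that by (cases "Suc i = j"; cases "i = j") auto
        qed (use b bm in auto)
        moreover have ab: "n j \<le> n i \<and> b i \<le> e" if "j = Suc i" for i
          using above[OF that] n[of i] that jd by simp
        have "(\<Sum>\<kappa>\<in>{\<kappa> \<in> tableaux d n b. \<kappa> (j, k) = e}. tab_weight W d n \<kappa>) =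
          W (e + k - j) e * S d ?n b"
          unfolding S_def by (rule tableaux_remove_last[OF jd k e ab below])
        ultimately show ?thesis by (simp only:)
      qed
      also have "(\<Sum>\<kappa>\<in>{\<kappa> \<in> tableaux d n b. \<kappa> (j, k) = e}. tab_weight W d n \<kappa>) + S d n ?b = S d n b"
      proof -
        have "S d n b = (\<Sum>\<kappa>\<in>tableaux d n ?b \<union> {\<kappa> \<in> tableaux d n b. \<kappa> (j, k) = e}. tab_weight W d n \<kappa>)"
          unfolding S_def by (rule sum.cong[OF tableaux_split(1)[of j d n k b e, OF jd k e] refl])
        also have "\<dots> = S d n ?b + (\<Sum>\<kappa>\<in>{\<kappa> \<in> tableaux d n b. \<kappa> (j, k) = e}. tab_weight W d n \<kappa>)"
          unfolding S_def
          by (rule sum.union_disjoint) (use tableaux_split(2)[of j d n k b e, OF jd k e] in auto)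
        finally show ?thesis by (simp only: add.commute)
      qed
      finally show ?thesis .
    qed
  qed
  then show ?case by (simp add: f_def S_def)
qed

section \<open>The symplectic group and its generators\<close>

declare index_mult_mat(1) [simp del]

text \<open>Both generators with index i couple the rows p - 1 and p exactly for p in this set: i in
  the plain half and its mirror image in the barred half. For i = r the two coincide and join the
  halves.\<close>

definition chips :: "nat \<Rightarrow> nat \<Rightarrow> nat set" where
  "chips r i = {i, 2 * r - i}"

text \<open>The two elements differ by the even number 2 * (r - i), so they are never neighbours.
  This makes the squares of \<open>e_mat\<close> and \<open>f_mat\<close> vanish and their
  exponentials linear.\<close>

lemma chips_bounds:
  assumes "i \<in> {1..r}" "p \<in> chips r i"
  shows "0 < p" "p < 2 * r" "Suc p \<notin> chips r i"
proof -
  have p: "p = i \<or> p = 2 * r - i" and i: "1 \<le> i" "i \<le> r" using assms by (auto simp: chips_def)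
  then show "0 < p" "p < 2 * r" by linarith+
  have "Suc p \<noteq> i" "Suc p \<noteq> 2 * r - i" using p i by presburger+
  then show "Suc p \<notin> chips r i" by (simp add: chips_def)
qed

lemma Suc_chips_bounds:
  assumes "i \<in> {1..r}" "Suc p \<in> chips r i"
  shows "Suc p < 2 * r" "p \<notin> chips r i"
  using chips_bounds[OF assms(1), of p] chips_bounds(2)[OF assms] assms(2) by blast+

lemma chips_disjoint: "i \<in> {1..r} \<Longrightarrow> j \<in> {1..r} \<Longrightarrow> i \<noteq> j \<Longrightarrow> p \<in> chips r i \<Longrightarrow> p \<notin> chips r j"
  by (auto simp: chips_def)

lemma elt_eq_iff: "p < 2 * r \<Longrightarrow> q < 2 * r \<Longrightarrow> elt r p = elt r q \<longleftrightarrow> p = q"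
  by (auto simp: elt_def)

lemma f_act_elt:
  assumes i: "1 \<le> i" "i \<le> r" and q: "q < 2 * r"
  shows "f_act r i (elt r q) = (if Suc q \<in> chips r i then Some (elt r (Suc q)) else None)"
proof (cases "q < r")
  case True
  then have "Suc q \<in> chips r i \<longleftrightarrow> Suc q = i" using i by (auto simp: chips_def)
  then show ?thesis using True by (auto simp: elt_def)
next
  case False
  then have "Suc q \<in> chips r i \<longleftrightarrow> i < r \<and> 2 * r - q = Suc i" using i q by (auto simp: chips_def)
  then show ?thesis using False by (auto simp: elt_def)
qed

lemma e_act_elt:
  assumes i: "1 \<le> i" "i \<le> r" and q: "q < 2 * r"
  shows "e_act r i (elt r q) = (if q \<in> chips r i then Some (elt r (q - 1)) else None)"
proof (cases "q < r")
  case True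
  then have "q \<in> chips r i \<longleftrightarrow> i < r \<and> q = i" using i by (auto simp: chips_def)
  then show ?thesis using True i by (auto simp: elt_def)
next
  case False
  then have "q \<in> chips r i \<longleftrightarrow> 2 * r - q = i" using i q by (auto simp: chips_def)
  then show ?thesis using False i q by (auto simp: elt_def)
qed

lemma f_mat_index:
  assumes "i \<in> {1..r}" "p < 2 * r" "q < 2 * r"
  shows "f_mat r i $$ (p, q) = (if p = Suc q \<and> p \<in> chips r i then 1 else 0)"
  using assms chips_bounds(2)[OF assms(1), of "Suc q"] elt_eq_iff[of "Suc q" r p]
  by (auto simp: f_mat_def act_mat_def f_act_elt)

lemma e_mat_index:
  assumes "i \<in> {1..r}" "p < 2 * r" "q < 2 * r"
  shows "e_mat r i $$ (p, q) = (if q = Suc p \<and> q \<in> chips r i then 1 else 0)"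
  using assms chips_bounds(1)[OF assms(1), of q] elt_eq_iff[of "q - 1" r p]
  by (auto simp: e_mat_def act_mat_def e_act_elt)

lemma f_mat_carrier [simp]: "f_mat r i \<in> carrier_mat (2 * r) (2 * r)"
  by (simp add: f_mat_def act_mat_def)

lemma e_mat_carrier [simp]: "e_mat r i \<in> carrier_mat (2 * r) (2 * r)"
  by (simp add: e_mat_def act_mat_def)

lemmas f_mat_dim [simp] = carrier_matD[OF f_mat_carrier]
lemmas e_mat_dim [simp] = carrier_matD[OF e_mat_carrier]

lemma index_mult_mat_sum:
  "A \<in> carrier_mat n m \<Longrightarrow> B \<in> carrier_mat m k \<Longrightarrow> p < n \<Longrightarrow> q < k \<Longrightarrow>
   (A * B) $$ (p, q) = (\<Sum>s<m. A $$ (p, s) * B $$ (s, q))"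
  by (simp add: index_mult_mat scalar_prod_def atLeast0LessThan)

lemma f_mat_square:
  assumes i: "i \<in> {1..r}"
  shows "f_mat r i * f_mat r i = 0\<^sub>m (2 * r) (2 * r)"
proof (rule eq_matI)
  fix p q assume "p < dim_row (0\<^sub>m (2 * r) (2 * r) :: complex mat)"
    "q < dim_col (0\<^sub>m (2 * r) (2 * r) :: complex mat)"
  then have pq: "p < 2 * r" "q < 2 * r" by simp_all
  have "f_mat r i $$ (p, s) * f_mat r i $$ (s, q) = 0" if "s < 2 * r" for s
    using chips_bounds(3)[OF i, of s] pq that by (auto simp: f_mat_index[OF i])
  then show "(f_mat r i * f_mat r i) $$ (p, q) = 0\<^sub>m (2 * r) (2 * r) $$ (p, q)"
    using pq by (simp add: index_mult_mat_sum[OF f_mat_carrier f_mat_carrier] sum.neutral)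
qed simp_all

lemma e_mat_square:
  assumes i: "i \<in> {1..r}"
  shows "e_mat r i * e_mat r i = 0\<^sub>m (2 * r) (2 * r)"
proof (rule eq_matI)
  fix p q assume "p < dim_row (0\<^sub>m (2 * r) (2 * r) :: complex mat)"
    "q < dim_col (0\<^sub>m (2 * r) (2 * r) :: complex mat)"
  then have pq: "p < 2 * r" "q < 2 * r" by simp_all
  have "e_mat r i $$ (p, s) * e_mat r i $$ (s, q) = 0" if "s < 2 * r" for s
    using chips_bounds(3)[OF i, of s] pq that by (auto simp: e_mat_index[OF i])
  then show "(e_mat r i * e_mat r i) $$ (p, q) = 0\<^sub>m (2 * r) (2 * r) $$ (p, q)"
    using pq by (simp add: index_mult_mat_sum[OF e_mat_carrier e_mat_carrier] sum.neutral)
qed simp_all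

lemma mat_exp_square_zero:
  assumes A: "A \<in> carrier_mat n n" and sq: "A * A = 0\<^sub>m n n"
  shows "mat_exp (t \<cdot>\<^sub>m A) = 1\<^sub>m n + t \<cdot>\<^sub>m A"
proof (rule eq_matI)
  let ?T = "t \<cdot>\<^sub>m A"
  have T: "?T \<in> carrier_mat n n" using A by simp
  have T2: "?T * ?T = 0\<^sub>m n n"
    using A sq by (simp add: mult_smult_distrib[of "t \<cdot>\<^sub>m A" n n A n] mult_smult_assoc_mat[of A n n A n])
  have pow: "?T ^\<^sub>m (Suc (Suc k)) = 0\<^sub>m n n" for k
  proof (induction k)
    case 0
    then show ?case using T T2 by simp
  next
    case (Suc k)
    have "?T ^\<^sub>m (Suc (Suc (Suc k))) = ?T ^\<^sub>m (Suc (Suc k)) * ?T" by simp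
    then show ?case unfolding Suc using left_mult_zero_mat[OF T] by simp
  qed
  fix p q assume "p < dim_row (1\<^sub>m n + ?T)" "q < dim_col (1\<^sub>m n + ?T)"
  then have pq: "p < n" "q < n" using A by auto
  have "(\<Sum>k. (?T ^\<^sub>m k) $$ (p, q) / fact k) = (\<Sum>k<2. (?T ^\<^sub>m k) $$ (p, q) / fact k)"
  proof (rule suminf_finite)
    fix k assume "k \<notin> {..<2::nat}"
    then obtain l where "k = Suc (Suc l)" by (metis One_nat_def Suc_1 lessThan_iff not_less_less_Suc_eq old.nat.exhaust zero_less_Suc lessI)
    then show "(?T ^\<^sub>m k) $$ (p, q) / fact k = 0" using pow[of l] pq by simp
  qed simp
  also have "\<dots> = (1\<^sub>m n + ?T) $$ (p, q)"
    using pq A T by (simp add: numeral_2_eq_2)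
  finally show "mat_exp ?T $$ (p, q) = (1\<^sub>m n + ?T) $$ (p, q)"
    using pq A by (simp add: mat_exp_def)
qed (use A in \<open>auto simp: mat_exp_def\<close>)

lemma yg_eq: "i \<in> {1..r} \<Longrightarrow> yg r i t = 1\<^sub>m (2 * r) + t \<cdot>\<^sub>m f_mat r i"
  unfolding yg_def by (rule mat_exp_square_zero) (simp_all add: f_mat_square)

lemma xg_eq: "i \<in> {1..r} \<Longrightarrow> xg r i t = 1\<^sub>m (2 * r) + t \<cdot>\<^sub>m e_mat r i"
  unfolding xg_def by (rule mat_exp_square_zero) (simp_all add: e_mat_square)

lemma yg_carrier [simp]: "yg r i t \<in> carrier_mat (2 * r) (2 * r)"
  by (simp add: yg_def mat_exp_def f_mat_def act_mat_def)

lemma xg_carrier [simp]: "xg r i t \<in> carrier_mat (2 * r) (2 * r)"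
  by (simp add: xg_def mat_exp_def e_mat_def act_mat_def)

lemma coroot_carrier [simp]: "coroot r i t \<in> carrier_mat (2 * r) (2 * r)"
  by (simp add: coroot_def)

lemma xneg_carrier [simp]: "xneg r i t \<in> carrier_mat (2 * r) (2 * r)"
  using yg_carrier coroot_carrier unfolding xneg_def by (rule mult_carrier_mat)

lemmas yg_dim [simp] = carrier_matD[OF yg_carrier]
lemmas xg_dim [simp] = carrier_matD[OF xg_carrier]
lemmas coroot_dim [simp] = carrier_matD[OF coroot_carrier]
lemmas xneg_dim [simp] = carrier_matD[OF xneg_carrier]

lemma yg_index:
  assumes "i \<in> {1..r}" "p < 2 * r" "q < 2 * r"
  shows "yg r i t $$ (p, q) = (if p = q then 1 else if p = Suc q \<and> p \<in> chips r i then t else 0)"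
  unfolding yg_eq[OF assms(1)] using assms f_mat_carrier[of r i]
  by (subst index_add_mat) (auto simp: f_mat_index)

lemma xg_index:
  assumes "i \<in> {1..r}" "p < 2 * r" "q < 2 * r"
  shows "xg r i t $$ (p, q) = (if p = q then 1 else if q = Suc p \<and> q \<in> chips r i then t else 0)"
  unfolding xg_eq[OF assms(1)] using assms e_mat_carrier[of r i]
  by (subst index_add_mat) (auto simp: e_mat_index)

lemma wt_elt:
  assumes "i \<in> {1..r}" "p < 2 * r"
  shows "wt (elt r p) i = (if Suc p \<in> chips r i then 1 else if p \<in> chips r i then - 1 else 0)"
proof (cases "p < r")
  case True
  then have "Suc p \<in> chips r i \<longleftrightarrow> i = Suc p" "p \<in> chips r i \<longleftrightarrow> i = p"
    using assms by (auto simp: chips_def)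
  then show ?thesis using True assms(1) by (auto simp: elt_def fund_weight_def)
next
  case False
  then have "Suc p \<in> chips r i \<longleftrightarrow> i = 2 * r - Suc p" "p \<in> chips r i \<longleftrightarrow> i = 2 * r - p"
    using assms by (auto simp: chips_def)
  then show ?thesis using False assms by (auto simp: elt_def fund_weight_def)
qed

lemma coroot_index:
  assumes "i \<in> {1..r}" "p < 2 * r" "q < 2 * r"
  shows "coroot r i t $$ (p, q) =
    (if p \<noteq> q then 0 else if Suc p \<in> chips r i then t else if p \<in> chips r i then inverse t else 1)"
  using assms(2,3) wt_elt[OF assms(1,3)] by (cases "p = q") (simp_all add: coroot_def power_int_minus)

lemma yg_mult_index:
  assumes "i \<in> {1..r}" "A \<in> carrier_mat (2 * r) n" "p < 2 * r" "q < n"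
  shows "(yg r i t * A) $$ (p, q) = A $$ (p, q) + (if p \<in> chips r i then t * A $$ (p - 1, q) else 0)"
proof -
  have "(yg r i t * A) $$ (p, q) = (\<Sum>s<2*r. yg r i t $$ (p, s) * A $$ (s, q))"
    using assms by (intro index_mult_mat_sum) auto
  also have "\<dots> = (\<Sum>s<2*r. (if s = p then A $$ (p, q) else 0) +
      (if s = p - 1 then if p \<in> chips r i then t * A $$ (p - 1, q) else 0 else 0))"
    by (rule sum.cong) (use assms chips_bounds(1)[OF assms(1), of p] in \<open>auto simp: yg_index\<close>)
  finally show ?thesis using assms(3) by (simp add: sum.distrib less_imp_diff_less)
qed

lemma xg_mult_index:
  assumes "i \<in> {1..r}" "A \<in> carrier_mat (2 * r) n" "p < 2 * r" "q < n"
  shows "(xg r i t * A) $$ (p, q) = A $$ (p, q) + (if Suc p \<in> chips r i then t * A $$ (Suc p, q) else 0)"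
proof -
  have "(xg r i t * A) $$ (p, q) = (\<Sum>s<2*r. xg r i t $$ (p, s) * A $$ (s, q))"
    using assms by (intro index_mult_mat_sum) auto
  also have "\<dots> = (\<Sum>s<2*r. (if s = p then A $$ (p, q) else 0) +
      (if s = Suc p then if Suc p \<in> chips r i then t * A $$ (Suc p, q) else 0 else 0))"
    by (rule sum.cong) (use assms in \<open>auto simp: xg_index\<close>)
  finally show ?thesis using assms(3) Suc_chips_bounds[OF assms(1), of p] by (auto simp: sum.distrib)
qed

lemma diagonal_mult_index:
  assumes "h \<in> carrier_mat n n" "diagonal_mat h" "A \<in> carrier_mat n m" "p < n" "q < m"
  shows "(h * A) $$ (p, q) = h $$ (p, p) * A $$ (p, q)"
proof -
  have "(h * A) $$ (p, q) = (\<Sum>s<n. h $$ (p, s) * A $$ (s, q))"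
    using assms by (intro index_mult_mat_sum) auto
  also have "\<dots> = (\<Sum>s<n. if s = p then h $$ (p, p) * A $$ (p, q) else 0)"
    by (rule sum.cong) (use assms in \<open>auto simp: diagonal_mat_def\<close>)
  finally show ?thesis using assms(4) by simp
qed

lemma mult_diagonal_index:
  assumes "h \<in> carrier_mat m m" "diagonal_mat h" "A \<in> carrier_mat n m" "p < n" "q < m"
  shows "(A * h) $$ (p, q) = A $$ (p, q) * h $$ (q, q)"
proof -
  have "(A * h) $$ (p, q) = (\<Sum>s<m. A $$ (p, s) * h $$ (s, q))"
    using assms by (intro index_mult_mat_sum) auto
  also have "\<dots> = (\<Sum>s<m. if s = q then A $$ (p, q) * h $$ (q, q) else 0)"
    by (rule sum.cong) (use assms in \<open>auto simp: diagonal_mat_def\<close>)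
  finally show ?thesis using assms(5) by simp
qed

lemma coroot_diagonal: "i \<in> {1..r} \<Longrightarrow> diagonal_mat (coroot r i t)"
  by (auto simp: diagonal_mat_def coroot_def)

text \<open>The torus factor divides row p - 1 by t before \<open>yg\<close> adds t times that row
  to row p. The two factors cancel, which is why moves have weight 1 and only stays carry
  parameters.\<close>

lemma xneg_mult_index:
  assumes "i \<in> {1..r}" "A \<in> carrier_mat (2 * r) n" "p < 2 * r" "q < n" "t \<noteq> 0"
  shows "(xneg r i t * A) $$ (p, q) =
    (if p \<in> chips r i then t * A $$ (p, q) + A $$ (p - 1, q)
     else if Suc p \<in> chips r i then A $$ (p, q) / t else A $$ (p, q))"
proof -
  have "xneg r i t * A = yg r i t * (coroot r i (inverse t) * A)"
    unfolding xneg_def using assms(2) by (rule assoc_mult_mat[OF yg_carrier coroot_carrier])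
  moreover have "(coroot r i (inverse t) * A) $$ (p, q) =
    (if Suc p \<in> chips r i then A $$ (p, q) / t else if p \<in> chips r i then t * A $$ (p, q) else A $$ (p, q))"
    if "p < 2 * r" for p
    using assms that
    by (subst diagonal_mult_index[OF coroot_carrier coroot_diagonal assms(2)])
       (auto simp: coroot_index field_simps)
  ultimately show ?thesis
    using assms chips_bounds[OF assms(1), of p] Suc_chips_bounds[OF assms(1), of p]
    by (auto simp: yg_mult_index[OF assms(1) mult_carrier_mat[OF coroot_carrier assms(2)]])
qed

text \<open>The adjoint with respect to the symplectic form, written in coordinates: reflection in
  the antidiagonal with checkerboard signs. On the symplectic group it is the inverse, with explicit
  entries.\<close>

definition adj :: "nat \<Rightarrow> complex mat \<Rightarrow> complex mat" where
  "adj r A = mat (2 * r) (2 * r) (\<lambda>(p, q). (- 1) ^ (p + q) * A $$ (2 * r - Suc q, 2 * r - Suc p))"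

lemma adj_carrier [simp]: "adj r A \<in> carrier_mat (2 * r) (2 * r)"
  by (simp add: adj_def)

lemmas adj_dim [simp] = carrier_matD[OF adj_carrier]

lemma adj_one: "adj r (1\<^sub>m (2 * r)) = 1\<^sub>m (2 * r)"
  by (rule eq_matI) (auto simp: adj_def)

lemma adj_adj: "A \<in> carrier_mat (2 * r) (2 * r) \<Longrightarrow> adj r (adj r A) = A"
proof (rule eq_matI)
  fix p q assume A: "A \<in> carrier_mat (2 * r) (2 * r)" and pq: "p < dim_row A" "q < dim_col A"
  have "even ((p + q) + (2 * r - Suc q + (2 * r - Suc p)))" using A pq by auto
  then have "(- 1 :: complex) ^ (p + q) * (- 1) ^ (2 * r - Suc q + (2 * r - Suc p)) = 1"
    unfolding power_add[symmetric] by simp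
  then show "adj r (adj r A) $$ (p, q) = A $$ (p, q)"
    using A pq by (auto simp: adj_def simp flip: mult.assoc)
qed (auto simp: adj_def)

lemma sum_reverse: "(\<Sum>s<n. g (n - Suc s)) = (\<Sum>s<n. g s :: 'a::comm_monoid_add)"
  by (rule sum.nat_diff_reindex)

lemma adj_mult:
  assumes "A \<in> carrier_mat (2 * r) (2 * r)" "B \<in> carrier_mat (2 * r) (2 * r)"
  shows "adj r (A * B) = adj r B * adj r A"
proof (rule eq_matI)
  fix p q assume "p < dim_row (adj r B * adj r A)" "q < dim_col (adj r B * adj r A)"
  then have pq: "p < 2 * r" "q < 2 * r" by (auto simp: adj_def)
  have sgn: "(- 1 :: complex) ^ (p + s) * (- 1) ^ (s + q) = (- 1) ^ (p + q)" for s
    by (simp add: minus_one_power_iff)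
  have "(adj r B * adj r A) $$ (p, q) = (\<Sum>s<2*r. adj r B $$ (p, s) * adj r A $$ (s, q))"
    using pq by (subst index_mult_mat_sum[of _ "2 * r" "2 * r" _ "2 * r"]) auto
  also have "\<dots> = (\<Sum>s<2*r. (- 1) ^ (p + q) * (A $$ (2 * r - Suc q, 2 * r - Suc s) * B $$ (2 * r - Suc s, 2 * r - Suc p)))"
  proof (rule sum.cong[OF refl])
    fix s assume "s \<in> {..<2*r}"
    then show "adj r B $$ (p, s) * adj r A $$ (s, q) =
      (- 1) ^ (p + q) * (A $$ (2 * r - Suc q, 2 * r - Suc s) * B $$ (2 * r - Suc s, 2 * r - Suc p))"
      unfolding sgn[of s, symmetric] using pq by (simp add: adj_def)
  qed
  also have "\<dots> = (\<Sum>s<2*r. (- 1) ^ (p + q) * (A $$ (2 * r - Suc q, s) * B $$ (s, 2 * r - Suc p)))"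
    by (rule sum_reverse)
  also have "\<dots> = adj r (A * B) $$ (p, q)"
    using pq assms by (simp add: adj_def index_mult_mat_sum[of A "2 * r" "2 * r" B "2 * r"] sum_distrib_left)
  finally show "adj r (A * B) $$ (p, q) = (adj r B * adj r A) $$ (p, q)" by simp
qed (auto simp: adj_def)

lemma form_mat_index:
  assumes "p < 2 * r" "q < 2 * r"
  shows "form_mat r $$ (p, q) = (if p + q = 2 * r - 1 then (- 1) ^ Suc p else 0)"
proof -
  have sgn: "(- 1 :: complex) ^ (2 * r - p) = (- 1) ^ p"
    using assms by (simp add: minus_one_power_iff)
  have pq: "p + q = 2 * r - Suc 0 \<longleftrightarrow> q = 2 * r - Suc p" using assms by linarith
  show ?thesis
  proof (cases "p < r")
    case True
    have "elt r q = Bar (Suc p) \<longleftrightarrow> q = 2 * r - Suc p" using True assms by (auto simp: elt_def)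
    moreover have "form (Plain (Suc p)) j = (if j = Bar (Suc p) then (- 1) ^ Suc p else 0)" for j
      by (cases j) auto
    ultimately show ?thesis
      using True assms pq by (auto simp: form_mat_def elt_def[of r p])
  next
    case False
    have "elt r q = Plain (2 * r - p) \<longleftrightarrow> q = 2 * r - Suc p" using False assms by (auto simp: elt_def)
    moreover have "form (Bar (2 * r - p)) j = (if j = Plain (2 * r - p) then - ((- 1) ^ p) else 0)" for j
      by (cases j) (auto simp: sgn)
    ultimately show ?thesis
      using False assms pq by (auto simp: form_mat_def elt_def[of r p])
  qed
qed

lemma form_mat_carrier [simp]: "form_mat r \<in> carrier_mat (2 * r) (2 * r)"
  by (simp add: form_mat_def)

lemmas form_mat_dim [simp] = carrier_matD[OF form_mat_carrier]

text \<open>Up to the sign (-1)^p, row p of \<open>adj r A * A\<close> is row 2 * r - 1 - p of the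
  transformed form. Invariance of the form thus says that \<open>adj r A\<close> is a left
  inverse.\<close>

lemma Sp_iff: "A \<in> carrier (Sp r) \<longleftrightarrow>
  A \<in> carrier_mat (2 * r) (2 * r) \<and> adj r A * A = 1\<^sub>m (2 * r)"
proof (cases "A \<in> carrier_mat (2 * r) (2 * r)")
  case A: True
  let ?F = "transpose_mat A * form_mat r * A"
  have TF: "(transpose_mat A * form_mat r) $$ (p, s) = (- 1) ^ s * A $$ (2 * r - Suc s, p)"
    if "p < 2 * r" "s < 2 * r" for p s
  proof -
    have "(transpose_mat A * form_mat r) $$ (p, s) =
      (\<Sum>u<2*r. transpose_mat A $$ (p, u) * form_mat r $$ (u, s))"
      using A that by (subst index_mult_mat_sum[of _ "2 * r" "2 * r" _ "2 * r"]) auto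
    also have "\<dots> = (\<Sum>u<2*r. if u = 2 * r - Suc s then (- 1) ^ s * A $$ (2 * r - Suc s, p) else 0)"
    proof (rule sum.cong[OF refl])
      fix u assume u: "u \<in> {..<2*r}"
      have "(- 1 :: complex) ^ Suc u = (- 1) ^ s" if "u + s = 2 * r - 1"
        using that \<open>s < 2 * r\<close> by (auto simp: minus_one_power_iff) presburger+
      then show "transpose_mat A $$ (p, u) * form_mat r $$ (u, s) =
        (if u = 2 * r - Suc s then (- 1) ^ s * A $$ (2 * r - Suc s, p) else 0)"
        using A that u by (auto simp: form_mat_index simp del: power_Suc)
    qed
    finally show ?thesis using that by simp
  qed
  have key: "(adj r A * A) $$ (p, q) = (- 1) ^ p * ?F $$ (2 * r - Suc p, q)"
    if pq: "p < 2 * r" "q < 2 * r" for p q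
  proof -
    have "?F $$ (2 * r - Suc p, q) = (\<Sum>s<2*r. (- 1) ^ s * A $$ (2 * r - Suc s, 2 * r - Suc p) * A $$ (s, q))"
      using A pq by (subst index_mult_mat_sum[of _ "2 * r" "2 * r" _ "2 * r"]) (auto simp: TF)
    moreover have "(adj r A * A) $$ (p, q) =
        (\<Sum>s<2*r. (- 1) ^ (p + s) * A $$ (2 * r - Suc s, 2 * r - Suc p) * A $$ (s, q))"
      using A pq by (subst index_mult_mat_sum[of _ "2 * r" "2 * r" _ "2 * r"]) (auto simp: adj_def)
    ultimately show ?thesis by (simp add: power_add sum_distrib_left mult.assoc)
  qed
  have one: "(1\<^sub>m (2 * r) :: complex mat) $$ (p, q) = (- 1) ^ p * form_mat r $$ (2 * r - Suc p, q)"
    if pq: "p < 2 * r" "q < 2 * r" for p q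
  proof -
    have "(- 1 :: complex) ^ p * (- 1) ^ Suc (2 * r - Suc p) = 1"
      using pq unfolding power_add[symmetric] by simp
    moreover have "2 * r - Suc p + q = 2 * r - 1 \<longleftrightarrow> p = q" using pq by auto
    ultimately show ?thesis using pq by (auto simp: form_mat_index simp del: power_Suc)
  qed
  have "?F = form_mat r \<longleftrightarrow> adj r A * A = 1\<^sub>m (2 * r)"
  proof
    assume "?F = form_mat r"
    then show "adj r A * A = 1\<^sub>m (2 * r)"
      using A by (intro eq_matI) (simp_all add: key one del: index_one_mat(1))
  next
    assume e: "adj r A * A = 1\<^sub>m (2 * r)"
    have "?F $$ (p, q) = form_mat r $$ (p, q)" if pq: "p < 2 * r" "q < 2 * r" for p q
    proof -
      define p' where "p' = 2 * r - Suc p"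
      have p': "p' < 2 * r" "2 * r - Suc p' = p" using pq by (auto simp: p'_def)
      have "(- 1) ^ p' * ?F $$ (p, q) = (- 1) ^ p' * form_mat r $$ (p, q)"
        using key[OF p'(1) pq(2)] one[OF p'(1) pq(2)] unfolding e p'(2) by (rule trans[OF sym])
      then show ?thesis by simp
    qed
    then show "?F = form_mat r"
      using A by (intro eq_matI) (simp_all only: form_mat_dim, simp_all)
  qed
  then show ?thesis using A by (simp add: Sp_def)
qed (simp add: Sp_def)

lemma mult_Sp [simp]: "x \<otimes>\<^bsub>Sp r\<^esub> y = x * y"
  by (simp add: Sp_def)

lemma one_Sp [simp]: "\<one>\<^bsub>Sp r\<^esub> = 1\<^sub>m (2 * r)"
  by (simp add: Sp_def)

lemma Sp_carrier_mat: "A \<in> carrier (Sp r) \<Longrightarrow> A \<in> carrier_mat (2 * r) (2 * r)"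
  by (simp add: Sp_def)

lemma Sp_dim: "A \<in> carrier (Sp r) \<Longrightarrow> dim_row A = 2 * r" "A \<in> carrier (Sp r) \<Longrightarrow> dim_col A = 2 * r"
  by (auto simp: Sp_def)

lemma adj_mult_self: "A \<in> carrier (Sp r) \<Longrightarrow> adj r A * A = 1\<^sub>m (2 * r)"
  by (simp add: Sp_iff)

lemma mult_adj_self: "A \<in> carrier (Sp r) \<Longrightarrow> A * adj r A = 1\<^sub>m (2 * r)"
  by (rule mat_mult_left_right_inverse[OF adj_carrier]) (auto simp: Sp_iff)

lemma adj_Sp: "A \<in> carrier (Sp r) \<Longrightarrow> adj r A \<in> carrier (Sp r)"
  by (subst Sp_iff) (simp add: adj_adj mult_adj_self Sp_carrier_mat)

lemma Sp_group: "group (Sp r)"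
proof (rule groupI)
  fix x y assume xy: "x \<in> carrier (Sp r)" "y \<in> carrier (Sp r)"
  note c = Sp_carrier_mat[OF xy(1)] Sp_carrier_mat[OF xy(2)]
  have "adj r (x * y) * (x * y) = adj r y * (adj r x * (x * y))"
    unfolding adj_mult[OF c] by (rule assoc_mult_mat[OF adj_carrier adj_carrier mult_carrier_mat[OF c]])
  also have "adj r x * (x * y) = (adj r x * x) * y"
    by (rule assoc_mult_mat[OF adj_carrier c, symmetric])
  also have "adj r y * \<dots> = 1\<^sub>m (2 * r)"
    using c xy by (simp add: adj_mult_self)
  finally show "x \<otimes>\<^bsub>Sp r\<^esub> y \<in> carrier (Sp r)" using c by (simp add: Sp_iff)
  fix z assume z: "z \<in> carrier (Sp r)"
  show "x \<otimes>\<^bsub>Sp r\<^esub> y \<otimes>\<^bsub>Sp r\<^esub> z = x \<otimes>\<^bsub>Sp r\<^esub> (y \<otimes>\<^bsub>Sp r\<^esub> z)"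
    using assoc_mult_mat[OF c Sp_carrier_mat[OF z]] by simp
next
  fix x assume x: "x \<in> carrier (Sp r)"
  show "\<one>\<^bsub>Sp r\<^esub> \<otimes>\<^bsub>Sp r\<^esub> x = x" using Sp_carrier_mat[OF x] by simp
  show "\<exists>y\<in>carrier (Sp r). y \<otimes>\<^bsub>Sp r\<^esub> x = \<one>\<^bsub>Sp r\<^esub>"
    using adj_Sp[OF x] adj_mult_self[OF x] by auto
qed (simp add: Sp_iff adj_one)

lemma inv_Sp: "A \<in> carrier (Sp r) \<Longrightarrow> inv\<^bsub>Sp r\<^esub> A = adj r A"
  by (rule group.inv_equality[OF Sp_group]) (auto simp: adj_mult_self adj_Sp)

lemma Sp_mult: "A \<in> carrier (Sp r) \<Longrightarrow> B \<in> carrier (Sp r) \<Longrightarrow> A * B \<in> carrier (Sp r)"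
  using monoid.m_closed[OF group.is_monoid[OF Sp_group], of A r B] by simp

lemma Sp_one: "1\<^sub>m (2 * r) \<in> carrier (Sp r)"
  using monoid.one_closed[OF group.is_monoid[OF Sp_group], of r] by simp

lemma Sp_assoc: "A \<in> carrier (Sp r) \<Longrightarrow> B \<in> carrier (Sp r) \<Longrightarrow> D \<in> carrier (Sp r) \<Longrightarrow>
    A * B * D = A * (B * D)"
  using assoc_mult_mat[of A "2*r" "2*r" B "2*r" D "2*r"] Sp_carrier_mat by blast

section \<open>Relations between the one-parameter subgroups and the torus\<close>

lemma yg_mult_yg:
  assumes i: "i \<in> {1..r}"
  shows "yg r i s * yg r i t = yg r i (s + t)"
proof (rule eq_matI)
  fix p q assume "p < dim_row (yg r i (s + t))" "q < dim_col (yg r i (s + t))"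
  then have pq: "p < 2 * r" "q < 2 * r" by simp_all
  show "(yg r i s * yg r i t) $$ (p, q) = yg r i (s + t) $$ (p, q)"
    using pq chips_bounds(1)[OF i, of p] Suc_chips_bounds(2)[OF i, of "p - 1"]
    by (cases p) (auto simp: yg_mult_index[OF i yg_carrier] yg_index[OF i])
qed simp_all

lemma xg_mult_xg:
  assumes i: "i \<in> {1..r}"
  shows "xg r i s * xg r i t = xg r i (s + t)"
proof (rule eq_matI)
  fix p q assume "p < dim_row (xg r i (s + t))" "q < dim_col (xg r i (s + t))"
  then have pq: "p < 2 * r" "q < 2 * r" by simp_all
  show "(xg r i s * xg r i t) $$ (p, q) = xg r i (s + t) $$ (p, q)"
    using pq Suc_chips_bounds(1)[OF i, of p] chips_bounds(3)[OF i, of "Suc p"]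
    by (cases "Suc p \<in> chips r i") (auto simp: xg_mult_index[OF i xg_carrier] xg_index[OF i])
qed simp_all

lemma yg_zero: "i \<in> {1..r} \<Longrightarrow> yg r i 0 = 1\<^sub>m (2 * r)"
  by (rule eq_matI) (auto simp: yg_index)

lemma xg_zero: "i \<in> {1..r} \<Longrightarrow> xg r i 0 = 1\<^sub>m (2 * r)"
  by (rule eq_matI) (auto simp: xg_index)

lemma chips_refl_Suc:
  assumes "i \<in> {1..r}" "p < 2 * r"
  shows "2 * r - Suc p \<in> chips r i \<longleftrightarrow> Suc p \<in> chips r i"
    and "Suc (2 * r - Suc p) \<in> chips r i \<longleftrightarrow> p \<in> chips r i"
proof -
  have "p = i \<or> p = 2 * r - i \<longleftrightarrow> 2 * r - p = i \<or> 2 * r - p = 2 * r - i"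
    using assms by auto
  moreover have "Suc (2 * r - Suc p) = 2 * r - p" using assms by simp
  ultimately show "Suc (2 * r - Suc p) \<in> chips r i \<longleftrightarrow> p \<in> chips r i"
    by (auto simp: chips_def)
  have "Suc p = i \<or> Suc p = 2 * r - i \<longleftrightarrow> 2 * r - Suc p = i \<or> 2 * r - Suc p = 2 * r - i"
    using assms by auto
  then show "2 * r - Suc p \<in> chips r i \<longleftrightarrow> Suc p \<in> chips r i"
    by (auto simp: chips_def)
qed

lemma adj_yg: "i \<in> {1..r} \<Longrightarrow> adj r (yg r i t) = yg r i (- t)"
proof (rule eq_matI)
  fix p q assume i: "i \<in> {1..r}" and "p < dim_row (yg r i (- t))" "q < dim_col (yg r i (- t))"
  then have pq: "p < 2 * r" "q < 2 * r" by simp_all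
  then have "2 * r - Suc q = 2 * r - Suc p \<longleftrightarrow> p = q" "2 * r - Suc q = Suc (2 * r - Suc p) \<longleftrightarrow> p = Suc q"
    by auto
  then show "adj r (yg r i t) $$ (p, q) = yg r i (- t) $$ (p, q)"
    using i pq chips_refl_Suc(1)[OF i pq(2)] by (auto simp: adj_def yg_index)
qed auto

lemma adj_xg: "i \<in> {1..r} \<Longrightarrow> adj r (xg r i t) = xg r i (- t)"
proof (rule eq_matI)
  fix p q assume i: "i \<in> {1..r}" and "p < dim_row (xg r i (- t))" "q < dim_col (xg r i (- t))"
  then have pq: "p < 2 * r" "q < 2 * r" by simp_all
  then have "2 * r - Suc q = 2 * r - Suc p \<longleftrightarrow> p = q" "2 * r - Suc p = Suc (2 * r - Suc q) \<longleftrightarrow> q = Suc p"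
    by auto
  then show "adj r (xg r i t) $$ (p, q) = xg r i (- t) $$ (p, q)"
    using i pq chips_refl_Suc(1)[OF i pq(1)] by (auto simp: adj_def xg_index)
qed auto

lemma yg_Sp: "i \<in> {1..r} \<Longrightarrow> yg r i t \<in> carrier (Sp r)"
  by (simp add: Sp_iff adj_yg yg_mult_yg yg_zero)

lemma xg_Sp: "i \<in> {1..r} \<Longrightarrow> xg r i t \<in> carrier (Sp r)"
  by (simp add: Sp_iff adj_xg xg_mult_xg xg_zero)

lemma diagonal_Sp_iff:
  assumes "h \<in> carrier_mat (2 * r) (2 * r)" "diagonal_mat h"
  shows "h \<in> carrier (Sp r) \<longleftrightarrow> (\<forall>p<2*r. h $$ (2 * r - Suc p, 2 * r - Suc p) * h $$ (p, p) = 1)"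
proof -
  have "(adj r h * h) $$ (p, q) =
    (if p = q then h $$ (2 * r - Suc p, 2 * r - Suc p) * h $$ (p, p) else 0)" if pq: "p < 2 * r" "q < 2 * r" for p q
  proof -
    have "(adj r h * h) $$ (p, q) = adj r h $$ (p, q) * h $$ (q, q)"
      by (rule mult_diagonal_index[OF assms adj_carrier pq])
    moreover have "2 * r - Suc q = 2 * r - Suc p \<longleftrightarrow> p = q" using pq by auto
    ultimately show ?thesis using assms pq by (auto simp: adj_def diagonal_mat_def)
  qed
  then have "adj r h * h = 1\<^sub>m (2 * r) \<longleftrightarrow> (\<forall>p<2*r. h $$ (2 * r - Suc p, 2 * r - Suc p) * h $$ (p, p) = 1)"
    using assms(1) by (auto simp: mat_eq_iff)
  then show ?thesis using assms(1) by (simp add: Sp_iff)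
qed

lemma coroot_torus:
  assumes i: "i \<in> {1..r}" and t: "t \<noteq> 0"
  shows "coroot r i t \<in> torus r"
proof -
  have "coroot r i t $$ (2 * r - Suc p, 2 * r - Suc p) * coroot r i t $$ (p, p) = 1" if "p < 2 * r" for p
    using that t chips_refl_Suc[OF i that] Suc_chips_bounds(2)[OF i, of p] by (simp add: coroot_index[OF i])
  then show ?thesis
    unfolding torus_def using i by (auto simp: diagonal_Sp_iff coroot_diagonal)
qed

lemma torus_Sp: "h \<in> torus r \<Longrightarrow> h \<in> carrier (Sp r)"
  by (simp add: torus_def)

lemma torus_diagonal: "h \<in> torus r \<Longrightarrow> diagonal_mat h"
  by (simp add: torus_def)

lemma torus_reflect:
  assumes "h \<in> torus r" "p < 2 * r"
  shows "h $$ (2 * r - Suc p, 2 * r - Suc p) * h $$ (p, p) = 1"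
  using assms diagonal_Sp_iff[of h r] by (simp add: torus_def Sp_carrier_mat)

lemma torus_nonzero: "h \<in> torus r \<Longrightarrow> p < 2 * r \<Longrightarrow> h $$ (p, p) \<noteq> 0"
  using torus_reflect by force

lemma xneg_Sp: "i \<in> {1..r} \<Longrightarrow> t \<noteq> 0 \<Longrightarrow> xneg r i t \<in> carrier (Sp r)"
  unfolding xneg_def by (intro Sp_mult yg_Sp torus_Sp coroot_torus) auto

lemma torus_one: "1\<^sub>m (2 * r) \<in> torus r"
  by (simp add: torus_def Sp_one diagonal_mat_def)

lemma torus_mult:
  assumes h: "h \<in> torus r" "h' \<in> torus r"
  shows "h * h' \<in> torus r"
proof -
  have "(h * h') $$ (p, q) = 0" if "p < 2 * r" "q < 2 * r" "p \<noteq> q" for p q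
  proof -
    have "(h * h') $$ (p, q) = h $$ (p, q) * h' $$ (q, q)"
      by (rule mult_diagonal_index[OF Sp_carrier_mat[OF torus_Sp] torus_diagonal Sp_carrier_mat[OF torus_Sp]])
         (use h that in auto)
    then show ?thesis using that torus_diagonal[OF h(1)] Sp_dim[OF torus_Sp[OF h(1)]]
      by (simp add: diagonal_mat_def)
  qed
  then show ?thesis using h by (auto simp: torus_def Sp_mult Sp_dim diagonal_mat_def)
qed

lemma torus_adj: "h \<in> torus r \<Longrightarrow> adj r h \<in> torus r"
  using adj_Sp[of h r] by (auto simp: torus_def adj_def diagonal_mat_def Sp_dim)

text \<open>The common ratio is the inverse of the simple root \<alpha>_i at \<open>h\<close>. It
  agrees at both chips because mirrored diagonal entries are inverse to each other.\<close>

lemma torus_chips: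
  assumes "h \<in> torus r" "i \<in> {1..r}" "p \<in> chips r i"
  shows "h $$ (p, p) / h $$ (p - 1, p - 1) = h $$ (i, i) / h $$ (i - 1, i - 1)"
proof (cases "p = i")
  case False
  then have p: "p = 2 * r - i" and i: "0 < i" "i < r" using assms by (auto simp: chips_def)
  have "h $$ (p, p) * h $$ (i - 1, i - 1) = 1" "h $$ (p - 1, p - 1) * h $$ (i, i) = 1"
    using torus_reflect[OF assms(1), of "i - 1"] torus_reflect[OF assms(1), of i] p i by simp_all
  then have "h $$ (p, p) = inverse (h $$ (i - 1, i - 1))" "h $$ (p - 1, p - 1) = inverse (h $$ (i, i))"
    using inverse_unique by (metis mult.commute)+
  then show ?thesis by (simp add: field_simps)
qed simp

lemma torus_conj_eqI:
  assumes h: "h \<in> torus r" and A: "A \<in> carrier_mat (2 * r) (2 * r)" and B: "B \<in> carrier_mat (2 * r) (2 * r)"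
    and "\<And>p q. p < 2 * r \<Longrightarrow> q < 2 * r \<Longrightarrow> h $$ (p, p) * A $$ (p, q) = B $$ (p, q) * h $$ (q, q)"
  shows "h * A * adj r h = B"
proof -
  have hc: "h \<in> carrier_mat (2 * r) (2 * r)" by (rule Sp_carrier_mat[OF torus_Sp[OF h]])
  note d = torus_diagonal[OF h]
  have "h * A = B * h"
  proof (rule eq_matI)
    fix p q assume "p < dim_row (B * h)" "q < dim_col (B * h)"
    then have pq: "p < 2 * r" "q < 2 * r" using hc B by auto
    show "(h * A) $$ (p, q) = (B * h) $$ (p, q)"
      unfolding diagonal_mult_index[OF hc d A pq] mult_diagonal_index[OF hc d B pq] by (rule assms(4)[OF pq])
  qed (use hc A B in auto)
  then have "h * A * adj r h = B * (h * adj r h)" using assoc_mult_mat[OF B hc adj_carrier] by simp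
  then show ?thesis using B by (simp add: mult_adj_self torus_Sp h)
qed

lemma torus_conj_yg:
  assumes h: "h \<in> torus r" and i: "i \<in> {1..r}"
  shows "h * yg r i t * adj r h = yg r i (t * (h $$ (i, i) / h $$ (i - 1, i - 1)))"
proof (rule torus_conj_eqI[OF h])
  fix p q assume pq: "p < 2 * r" "q < 2 * r"
  show "h $$ (p, p) * yg r i t $$ (p, q) = yg r i (t * (h $$ (i, i) / h $$ (i - 1, i - 1))) $$ (p, q) * h $$ (q, q)"
    using pq torus_nonzero[OF h pq(2)] torus_chips[OF h i, of p] by (auto simp: yg_index[OF i] field_simps)
qed simp_all

lemma torus_conj_xg:
  assumes h: "h \<in> torus r" and i: "i \<in> {1..r}"
  shows "h * xg r i t * adj r h = xg r i (t * (h $$ (i - 1, i - 1) / h $$ (i, i)))"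
proof (rule torus_conj_eqI[OF h])
  fix p q assume pq: "p < 2 * r" "q < 2 * r"
  have "h $$ (i - 1, i - 1) / h $$ (i, i) = h $$ (q - 1, q - 1) / h $$ (q, q)" if "q \<in> chips r i"
    using torus_chips[OF h i that] by (metis inverse_divide)
  then show "h $$ (p, p) * xg r i t $$ (p, q) = xg r i (t * (h $$ (i - 1, i - 1) / h $$ (i, i))) $$ (p, q) * h $$ (q, q)"
    using pq torus_nonzero[OF h pq(2)] by (cases "q \<in> chips r i") (auto simp: xg_index[OF i])
qed simp_all

lemma xg_yg_commute:
  assumes i: "i \<in> {1..r}" and j: "j \<in> {1..r}" and ij: "i \<noteq> j"
  shows "xg r i a * yg r j b = yg r j b * xg r i a"
proof (rule eq_matI)
  fix p q assume "p < dim_row (yg r j b * xg r i a)" "q < dim_col (yg r j b * xg r i a)"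
  then have pq: "p < 2 * r" "q < 2 * r" by simp_all
  have d: "p \<in> chips r i \<Longrightarrow> p \<notin> chips r j" for p by (rule chips_disjoint[OF i j ij])
  show "(xg r i a * yg r j b) $$ (p, q) = (yg r j b * xg r i a) $$ (p, q)"
    unfolding xg_mult_index[OF i yg_carrier pq] yg_mult_index[OF j xg_carrier pq]
    using pq d[of p] d[of "Suc p"] d[of q] Suc_chips_bounds(1)[OF i, of p] chips_bounds(1)[OF j, of p]
    by (cases p) (auto simp: yg_index[OF j] xg_index[OF i])
qed simp_all

text \<open>The factorization of a 2 by 2 matrix into lower triangular, diagonal and upper
  triangular part, inside the SL2 belonging to i; u is its upper left entry.\<close>

lemma xg_yg_exchange:
  assumes i: "i \<in> {1..r}" and u: "u = 1 + a * b" "u \<noteq> 0"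
  shows "xg r i a * yg r i b = yg r i (b / u) * (coroot r i u * xg r i (a / u))"
proof (rule eq_matI)
  fix p q assume "p < dim_row (yg r i (b / u) * (coroot r i u * xg r i (a / u)))"
    "q < dim_col (yg r i (b / u) * (coroot r i u * xg r i (a / u)))"
  then have pq: "p < 2 * r" "q < 2 * r" by simp_all
  have D: "(coroot r i u * xg r i (a / u)) $$ (p, q) = coroot r i u $$ (p, p) * xg r i (a / u) $$ (p, q)"
    if "p < 2 * r" for p
    by (rule diagonal_mult_index[OF coroot_carrier coroot_diagonal[OF i] xg_carrier that pq(2)])
  define \<alpha> where "\<alpha> = a / u"
  define \<beta> where "\<beta> = b / u"
  have e: "u * \<alpha> = a" "\<beta> * u = b" "inverse u + b * \<alpha> = 1" "1 + a * b = u"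
    using u by (auto simp: \<alpha>_def \<beta>_def field_simps)
  show "(xg r i a * yg r i b) $$ (p, q) =
    (yg r i (b / u) * (coroot r i u * xg r i (a / u))) $$ (p, q)"
    unfolding xg_mult_index[OF i yg_carrier pq] yg_mult_index[OF i mult_carrier_mat[OF coroot_carrier xg_carrier] pq]
    using pq Suc_chips_bounds[OF i, of p] chips_bounds[OF i, of p] Suc_chips_bounds(2)[OF i, of "p - 1"]
    unfolding \<alpha>_def[symmetric] \<beta>_def[symmetric]
    by (cases p; cases "p \<in> chips r i"; cases "Suc p \<in> chips r i")
       (auto simp: D[unfolded \<alpha>_def[symmetric]] yg_index[OF i] xg_index[OF i] coroot_index[OF i] e simp flip: mult.assoc)
qed simp_all

lemma Sp_left_one: "A \<in> carrier (Sp r) \<Longrightarrow> 1\<^sub>m (2 * r) * A = A"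
  by (rule left_mult_one_mat[OF Sp_carrier_mat])

lemma Sp_right_one: "A \<in> carrier (Sp r) \<Longrightarrow> A * 1\<^sub>m (2 * r) = A"
  by (rule right_mult_one_mat[OF Sp_carrier_mat])

lemma adj_mult_cancel: "A \<in> carrier (Sp r) \<Longrightarrow> B \<in> carrier (Sp r) \<Longrightarrow> adj r A * (A * B) = B"
  using Sp_assoc[of "adj r A" r A B] by (simp add: adj_Sp adj_mult_self Sp_left_one)

lemma mult_adj_cancel: "A \<in> carrier (Sp r) \<Longrightarrow> B \<in> carrier (Sp r) \<Longrightarrow> A * (adj r A * B) = B"
  using Sp_assoc[of A r "adj r A" B] by (simp add: adj_Sp mult_adj_self Sp_left_one)

lemmas Sp_closed = Sp_mult adj_Sp Sp_one

section \<open>Unipotent radicals and the Gauss decomposition\<close>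

text \<open>With \<open>(<)\<close> for \<open>R\<close> this is lower triangularity, with
  \<open>(>)\<close> upper triangularity. The relation is a parameter so that both Borel subgroups
  are treated at once.\<close>

definition tri :: "nat \<Rightarrow> (nat \<Rightarrow> nat \<Rightarrow> bool) \<Rightarrow> complex mat \<Rightarrow> bool" where
  "tri n R A \<longleftrightarrow> (\<forall>p<n. \<forall>q<n. R p q \<longrightarrow> A $$ (p, q) = 0)"

lemma tri_mult:
  assumes R: "R = (<) \<or> R = (>)" and A: "A \<in> carrier_mat n n" "tri n R A" and B: "B \<in> carrier_mat n n" "tri n R B"
  shows "tri n R (A * B)" and "p < n \<Longrightarrow> (A * B) $$ (p, p) = A $$ (p, p) * B $$ (p, p)"
proof -
  show "tri n R (A * B)"
    unfolding tri_def
  proof (intro allI impI)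
    fix p q assume pq: "p < n" "q < n" "R p q"
    have "A $$ (p, s) * B $$ (s, q) = 0" if "s < n" for s
    proof -
      have "R p s \<or> R s q" using R pq(3) by auto
      then show ?thesis using A(2) B(2) pq that by (auto simp: tri_def)
    qed
    then show "(A * B) $$ (p, q) = 0"
      unfolding index_mult_mat_sum[OF A(1) B(1) pq(1,2)] by (intro sum.neutral) auto
  qed
  assume p: "p < n"
  have diag: "A $$ (p, s) * B $$ (s, p) = (if s = p then A $$ (p, p) * B $$ (p, p) else 0)" if "s < n" for s
  proof -
    have "s = p \<or> R p s \<or> R s p" using R by auto
    then show ?thesis using A(2) B(2) p that by (auto simp: tri_def)
  qed
  have "(A * B) $$ (p, p) = (\<Sum>s<n. if s = p then A $$ (p, p) * B $$ (p, p) else 0)"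
    unfolding index_mult_mat_sum[OF A(1) B(1) p p] by (rule sum.cong[OF refl]) (rule diag, simp)
  then show "(A * B) $$ (p, p) = A $$ (p, p) * B $$ (p, p)" using p by simp
qed

lemma tri_adj:
  assumes "R = (<) \<or> R = (>)" "tri (2 * r) R A"
  shows "tri (2 * r) R (adj r A)"
  unfolding tri_def
proof (intro allI impI)
  fix p q assume pq: "p < 2 * r" "q < 2 * r" "R p q"
  then have "R (2 * r - Suc q) (2 * r - Suc p)" using assms(1) by auto
  then show "adj r A $$ (p, q) = 0" using assms(2) pq by (simp add: adj_def tri_def)
qed

lemma generate_Sp_carrier: "X \<subseteq> carrier (Sp r) \<Longrightarrow> A \<in> generate (Sp r) X \<Longrightarrow> A \<in> carrier (Sp r)"
  using group.generate_in_carrier[OF Sp_group] .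

lemma generate_tri:
  assumes R: "R = (<) \<or> R = (>)" and X: "X \<subseteq> carrier (Sp r)" "\<And>A. A \<in> X \<Longrightarrow> tri (2 * r) R A"
    and "A \<in> generate (Sp r) X"
  shows "tri (2 * r) R A"
  using assms(4)
proof induction
  case one
  then show ?case using R by (auto simp: tri_def)
next
  case (incl h)
  then show ?case by (rule X(2))
next
  case (inv h)
  then have "h \<in> carrier (Sp r)" "tri (2 * r) R h" using X by blast+
  then show ?case by (simp add: inv_Sp tri_adj[OF R])
next
  case (eng h1 h2)
  then show ?case
    using tri_mult(1)[OF R] generate_Sp_carrier[OF X(1)] by (auto simp: Sp_carrier_mat)
qed

lemma generate_unit_diag:
  assumes R: "R = (<) \<or> R = (>)" and X: "X \<subseteq> carrier (Sp r)" "\<And>A. A \<in> X \<Longrightarrow> tri (2 * r) R A"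
    "\<And>A p. A \<in> X \<Longrightarrow> p < 2 * r \<Longrightarrow> A $$ (p, p) = 1"
    and "A \<in> generate (Sp r) X" "p < 2 * r"
  shows "A $$ (p, p) = 1"
  using assms(5,6)
proof (induction arbitrary: p)
  case (inv h)
  have "h $$ (2 * r - Suc p, 2 * r - Suc p) = 1" using X(3)[OF inv(1)] inv(2) by simp
  then show ?case using inv X(1) by (auto simp: inv_Sp adj_def)
next
  case (eng h1 h2)
  have "(h1 * h2) $$ (p, p) = h1 $$ (p, p) * h2 $$ (p, p)"
    using generate_tri[OF R X(1,2)] generate_Sp_carrier[OF X(1)] eng
    by (intro tri_mult(2)[OF R]) (auto simp: Sp_carrier_mat)
  then show ?case using eng by simp
qed (use X in auto)

lemma unit_tri_unipotent:
  assumes R: "R = (<) \<or> R = (>)" and A: "A \<in> carrier_mat n n" "tri n R A" "\<And>p. p < n \<Longrightarrow> A $$ (p, p) = 1"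
  shows "unipotent_mat A"
proof -
  let ?N = "A - 1\<^sub>m n"
  \<comment> \<open>A height of the indices for which every nonzero entry of the nilpotent part
    leads from column to row strictly upwards. A k-fold product therefore climbs at least k levels,
    and only n levels exist.\<close>
  define D where "D p = (if R = (<) then p else n - Suc p)" for p
  have N: "?N \<in> carrier_mat n n" using A by auto
  have N0: "?N $$ (p, q) = 0" if "p < n" "q < n" "D p \<le> D q" for p q
  proof (cases "p = q")
    case False
    have "((<) :: nat \<Rightarrow> nat \<Rightarrow> bool) \<noteq> (>)" by (metis less_asym lessI)
    then have "R p q" using R that False by (auto simp: D_def split: if_splits)
    then show ?thesis using A that False by (auto simp: tri_def)
  qed (use A that in auto)
  have pow: "(?N ^\<^sub>m k) $$ (p, q) = 0" if "p < n" "q < n" "D p < D q + k" for k p q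
    using that
  proof (induction k arbitrary: q)
    case 0
    then show ?case using N by auto
  next
    case (Suc k)
    have "(?N ^\<^sub>m k) $$ (p, s) * ?N $$ (s, q) = 0" if "s < n" for s
    proof (cases "D p < D s + k")
      case True
      then show ?thesis using Suc.IH[OF Suc.prems(1) that] by simp
    next
      case False
      then have "D q \<ge> D s" using Suc.prems by simp
      then show ?thesis using N0[OF that Suc.prems(2)] by simp
    qed
    then show ?case
      using index_mult_mat_sum[OF pow_carrier_mat[OF N, of k] N Suc.prems(1,2)] by (simp add: sum.neutral)
  qed
  have "?N ^\<^sub>m n = 0\<^sub>m n n"
  proof (rule eq_matI)
    fix p q assume "p < dim_row (0\<^sub>m n n :: complex mat)" "q < dim_col (0\<^sub>m n n :: complex mat)"
    then have "p < n" "q < n" by auto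
    then show "(?N ^\<^sub>m n) $$ (p, q) = 0\<^sub>m n n $$ (p, q)"
      using pow[of p q n] by (cases "R = (<)") (simp_all add: D_def)
  qed (use carrier_matD[OF pow_carrier_mat[OF N, of n]] in auto)
  then show ?thesis using A(1) by (auto simp: unipotent_mat_def)
qed

text \<open>The diagonal of a power of a triangular matrix consists of the powers of its diagonal,
  so nilpotency of A - 1 forces zeros there.\<close>

lemma tri_unipotent_unit_diag:
  assumes R: "R = (<) \<or> R = (>)" and A: "A \<in> carrier_mat n n" "tri n R A" "unipotent_mat A" and p: "p < n"
  shows "A $$ (p, p) = 1"
proof -
  let ?N = "A - 1\<^sub>m n"
  have N: "?N \<in> carrier_mat n n" "tri n R ?N" using A R by (auto simp: tri_def)
  obtain k where k: "?N ^\<^sub>m k = 0\<^sub>m n n" using A by (auto simp: unipotent_mat_def)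
  have "tri n R (?N ^\<^sub>m k) \<and> (?N ^\<^sub>m k) $$ (p, p) = (?N $$ (p, p)) ^ k" for k
  proof (induction k)
    case 0
    then show ?case using R N p by (auto simp: tri_def)
  next
    case (Suc k)
    then show ?case using tri_mult[OF R pow_carrier_mat[OF N(1), of k] _ N] p by simp
  qed
  then have "(?N $$ (p, p)) ^ k = 0" using k p by (metis index_zero_mat(1))
  then show ?thesis using A p by simp
qed

lemma torus_tri: "R = (<) \<or> R = (>) \<Longrightarrow> h \<in> torus r \<Longrightarrow> tri (2 * r) R h"
  using torus_diagonal[of h r] Sp_dim[OF torus_Sp, of h r] by (auto simp: tri_def diagonal_mat_def)

section \<open>Inner and outer bounds for the unipotent radicals\<close>

definition y_gens :: "nat \<Rightarrow> complex mat set" where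
  "y_gens r = {yg r i t |i t. i \<in> {1..r}}"

definition x_gens :: "nat \<Rightarrow> complex mat set" where
  "x_gens r = {xg r i t |i t. i \<in> {1..r}}"

lemma y_gens_unitri: "A \<in> y_gens r \<Longrightarrow> tri (2 * r) (<) A" "A \<in> y_gens r \<Longrightarrow> p < 2 * r \<Longrightarrow> A $$ (p, p) = 1"
  by (auto simp: y_gens_def tri_def yg_index)

lemma x_gens_unitri: "A \<in> x_gens r \<Longrightarrow> tri (2 * r) (>) A" "A \<in> x_gens r \<Longrightarrow> p < 2 * r \<Longrightarrow> A $$ (p, p) = 1"
  by (auto simp: x_gens_def tri_def xg_index)

lemma y_gens_Sp: "y_gens r \<subseteq> carrier (Sp r)" and x_gens_Sp: "x_gens r \<subseteq> carrier (Sp r)"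
  by (auto simp: y_gens_def x_gens_def yg_Sp xg_Sp)

text \<open>The outer bound: members of the radical lie in the Borel subgroup, hence are triangular,
  and being unipotent they have unit diagonal. Uniqueness of the torus part follows from it.\<close>

lemma unip_radical_unitri:
  assumes R: "R = (<) \<or> R = (>)" and X: "X \<subseteq> carrier (Sp r)" "\<And>A. A \<in> X \<Longrightarrow> tri (2 * r) R A"
    and u: "u \<in> unip_radical r (generate (Sp r) (torus r \<union> X))"
  shows "u \<in> carrier (Sp r)" "tri (2 * r) R u" "p < 2 * r \<Longrightarrow> u $$ (p, p) = 1"
proof -
  have TX: "torus r \<union> X \<subseteq> carrier (Sp r)" using X torus_Sp by blast
  obtain U where "normal U ((Sp r)\<lparr>carrier := generate (Sp r) (torus r \<union> X)\<rparr>)" "u \<in> U" "unipotent_mat u"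
    using u by (auto simp: unip_radical_def)
  then have g: "u \<in> generate (Sp r) (torus r \<union> X)"
    by (auto simp: normal_def dest!: subgroup.subset)
  then show c: "u \<in> carrier (Sp r)" by (rule generate_Sp_carrier[OF TX])
  show t: "tri (2 * r) R u" by (rule generate_tri[OF R TX _ g]) (use X torus_tri[OF R] in auto)
  show "u $$ (p, p) = 1" if "p < 2 * r"
    by (rule tri_unipotent_unit_diag[OF R Sp_carrier_mat[OF c] t \<open>unipotent_mat u\<close> that])
qed

lemma Sp_conj_mult:
  assumes "h \<in> carrier (Sp r)" "u \<in> carrier (Sp r)" "v \<in> carrier (Sp r)"
  shows "h * (u * v) * adj r h = (h * u * adj r h) * (h * v * adj r h)"
  using assms by (simp add: Sp_assoc adj_mult_cancel Sp_closed del: assoc_mult_mat)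

lemma Sp_conj_conj:
  assumes "g \<in> carrier (Sp r)" "h \<in> carrier (Sp r)" "u \<in> carrier (Sp r)"
  shows "(g * h) * u * adj r (g * h) = g * (h * u * adj r h) * adj r g"
  using assms by (simp add: Sp_assoc adj_mult Sp_carrier_mat Sp_closed del: assoc_mult_mat)

lemma torus_conj_generate:
  assumes X: "X \<subseteq> carrier (Sp r)" "\<And>h A. h \<in> torus r \<Longrightarrow> A \<in> X \<Longrightarrow> h * A * adj r h \<in> X"
    "\<And>A. A \<in> X \<Longrightarrow> adj r A \<in> X"
    and h: "h \<in> torus r" and u: "u \<in> generate (Sp r) X"
  shows "h * u * adj r h \<in> generate (Sp r) X"
  using u
proof induction
  case one
  have "h * 1\<^sub>m (2 * r) * adj r h = 1\<^sub>m (2 * r)"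
    using torus_Sp[OF h] by (simp add: mult_adj_self Sp_right_one)
  then show ?case using generate.one[of "Sp r" X] by simp
next
  case (incl A)
  then show ?case using X(2)[OF h] by (auto intro: generate.incl)
next
  case (inv A)
  then have "inv\<^bsub>Sp r\<^esub> A = adj r A" using X(1) inv_Sp by blast
  then show ?case using X(2)[OF h X(3)[OF inv]] by (auto intro: generate.incl)
next
  case (eng u v)
  then show ?case
    using Sp_conj_mult[OF torus_Sp[OF h], of u v] generate_Sp_carrier[OF X(1)] generate.eng[of _ "Sp r" X] by auto
qed

text \<open>The inner bound: conjugation by the torus permutes X and conjugation by X is inner, so X
  generates a normal subgroup of the Borel group. It is unipotent because it consists of
  unitriangular matrices.\<close>

lemma generate_subset_unip_radical:
  assumes R: "R = (<) \<or> R = (>)"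
    and X: "X \<subseteq> carrier (Sp r)" "\<And>h A. h \<in> torus r \<Longrightarrow> A \<in> X \<Longrightarrow> h * A * adj r h \<in> X"
    "\<And>A. A \<in> X \<Longrightarrow> adj r A \<in> X" "\<And>A. A \<in> X \<Longrightarrow> tri (2 * r) R A"
    "\<And>A p. A \<in> X \<Longrightarrow> p < 2 * r \<Longrightarrow> A $$ (p, p) = 1"
  shows "generate (Sp r) X \<subseteq> unip_radical r (generate (Sp r) (torus r \<union> X))"
proof -
  interpret Sp: group "Sp r" by (rule Sp_group)
  let ?U = "generate (Sp r) X" and ?B = "generate (Sp r) (torus r \<union> X)"
  let ?G = "(Sp r)\<lparr>carrier := ?B\<rparr>"
  have TX: "torus r \<union> X \<subseteq> carrier (Sp r)" using X(1) torus_Sp by blast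
  note Uc = generate_Sp_carrier[OF X(1)] and Bc = generate_Sp_carrier[OF TX]
  have Bsub: "subgroup ?B (Sp r)" and Usub: "subgroup ?U (Sp r)"
    using Sp.generate_is_subgroup X(1) TX by blast+
  have UB: "?U \<subseteq> ?B" by (rule Sp.mono_generate) simp
  interpret B: group ?G by (rule subgroup.subgroup_is_group[OF Bsub Sp_group])
  have conj: "g * u * adj r g \<in> ?U" if "g \<in> ?B" "u \<in> ?U" for g u
    using that
  proof (induction arbitrary: u)
    case one
    then show ?case using Uc[OF one] by (simp add: adj_one Sp_left_one Sp_right_one)
  next
    case (incl A)
    show ?case
    proof (cases "A \<in> torus r")
      case True
      show ?thesis using torus_conj_generate[of X r A u] X(1-3) True incl(2) by blast
    next
      case False
      then have "A \<in> ?U" "adj r A \<in> ?U" using incl X(3) by (auto intro: generate.incl)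
      then show ?thesis using generate.eng[of _ "Sp r" X] incl(2) by auto
    qed
  next
    case (inv A)
    have A: "A \<in> carrier (Sp r)" using inv(1) TX by blast
    show ?case
    proof (cases "A \<in> torus r")
      case True
      then have "adj r A \<in> torus r" by (rule torus_adj)
      then show ?thesis unfolding inv_Sp[OF A]
        using torus_conj_generate[of X r "adj r A" u] X(1-3) inv(2) by blast
    next
      case False
      then have "A \<in> ?U" "adj r A \<in> ?U" using inv X(3) by (auto intro: generate.incl)
      then show ?thesis
        using generate.eng[of _ "Sp r" X] inv(2) by (auto simp: inv_Sp[OF A] adj_adj[OF Sp_carrier_mat[OF A]])
    qed
  next
    case (eng g h)
    then show ?case using Sp_conj_conj[OF Bc Bc Uc, of g h u] by auto
  qed
  have "normal ?U ?G"
    unfolding B.normal_inv_iff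
  proof (intro conjI ballI)
    show "subgroup ?U ?G" by (rule Sp.subgroup_incl[OF Usub Bsub UB])
    fix g u assume g: "g \<in> carrier ?G" and u: "u \<in> ?U"
    then have "inv\<^bsub>?G\<^esub> g = adj r g" using Sp.m_inv_consistent[OF Bsub] inv_Sp Bc by simp
    then show "g \<otimes>\<^bsub>?G\<^esub> u \<otimes>\<^bsub>?G\<^esub> inv\<^bsub>?G\<^esub> g \<in> ?U"
      using conj[of g u] g u by simp
  qed
  moreover have "unipotent_mat u" if "u \<in> ?U" for u
    using that by (intro unit_tri_unipotent[OF R Sp_carrier_mat[OF Uc]] generate_tri[OF R X(1,4)]
      generate_unit_diag[OF R X(1,4,5)]) auto
  ultimately show ?thesis unfolding unip_radical_def by blast
qed

lemma y_gens_torus: "h \<in> torus r \<Longrightarrow> A \<in> y_gens r \<Longrightarrow> h * A * adj r h \<in> y_gens r"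
  and x_gens_torus: "h \<in> torus r \<Longrightarrow> B \<in> x_gens r \<Longrightarrow> h * B * adj r h \<in> x_gens r"
  by (auto simp: y_gens_def x_gens_def torus_conj_yg torus_conj_xg) blast+

lemma y_gens_adj: "A \<in> y_gens r \<Longrightarrow> adj r A \<in> y_gens r"
  and x_gens_adj: "B \<in> x_gens r \<Longrightarrow> adj r B \<in> x_gens r"
  by (auto simp: y_gens_def x_gens_def adj_yg adj_xg) blast+

lemma generate_y_subset_N_neg: "generate (Sp r) (y_gens r) \<subseteq> N_neg r"
  unfolding N_neg_def borel_neg_def y_gens_def[symmetric]
  by (intro generate_subset_unip_radical[where R = "(<)"] disjI1 refl
    y_gens_Sp y_gens_torus y_gens_adj y_gens_unitri)

lemma generate_x_subset_N_pos: "generate (Sp r) (x_gens r) \<subseteq> N_pos r"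
  unfolding N_pos_def borel_pos_def x_gens_def[symmetric]
  by (intro generate_subset_unip_radical[where R = "(>)"] disjI2 refl
    x_gens_Sp x_gens_torus x_gens_adj x_gens_unitri)

lemma N_neg_unitri:
  assumes "u \<in> N_neg r"
  shows "u \<in> carrier (Sp r)" "tri (2 * r) (<) u" "p < 2 * r \<Longrightarrow> u $$ (p, p) = 1"
proof -
  have u: "u \<in> unip_radical r (generate (Sp r) (torus r \<union> y_gens r))"
    using assms by (simp only: N_neg_def borel_neg_def y_gens_def)
  note unip_radical_unitri[where R = "(<)", OF disjI1[OF refl] y_gens_Sp _ u, OF y_gens_unitri(1)]
  then show "u \<in> carrier (Sp r)" "tri (2 * r) (<) u" "p < 2 * r \<Longrightarrow> u $$ (p, p) = 1"
    by simp_all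
qed

lemma N_pos_unitri:
  assumes "u \<in> N_pos r"
  shows "u \<in> carrier (Sp r)" "tri (2 * r) (>) u" "p < 2 * r \<Longrightarrow> u $$ (p, p) = 1"
proof -
  have u: "u \<in> unip_radical r (generate (Sp r) (torus r \<union> x_gens r))"
    using assms by (simp only: N_pos_def borel_pos_def x_gens_def)
  note unip_radical_unitri[where R = "(>)", OF disjI2[OF refl] x_gens_Sp _ u, OF x_gens_unitri(1)]
  then show "u \<in> carrier (Sp r)" "tri (2 * r) (>) u" "p < 2 * r \<Longrightarrow> u $$ (p, p) = 1"
    by simp_all
qed

section \<open>Leading minors and the torus part\<close>

definition lead_minor :: "nat \<Rightarrow> complex mat \<Rightarrow> complex" where
  "lead_minor j A = det (mat j j (\<lambda>pq. A $$ pq))"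

text \<open>Lower triangularity of \<open>a\<close> cuts the inner summation off at j, so the
  leading block of the product is the product of the leading blocks.\<close>

lemma lead_minor_LDU:
  assumes a: "a \<in> N_neg r" and h: "h \<in> torus r" and b: "b \<in> N_pos r" and j: "j \<le> 2 * r"
  shows "lead_minor j (a * h * b) = (\<Prod>p<j. h $$ (p, p))"
proof -
  note ac = Sp_carrier_mat[OF N_neg_unitri(1)[OF a]] and bc = Sp_carrier_mat[OF N_pos_unitri(1)[OF b]]
    and hc = Sp_carrier_mat[OF torus_Sp[OF h]]
  let ?L = "mat j j (\<lambda>pq. a $$ pq)" and ?U = "mat j j (\<lambda>(p, q). h $$ (p, p) * b $$ (p, q))"
  have "mat j j (\<lambda>pq. (a * h * b) $$ pq) = ?L * ?U"
  proof (rule eq_matI)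
    fix p q assume "p < dim_row (?L * ?U)" "q < dim_col (?L * ?U)"
    then have pq: "p < j" "q < j" by auto
    then have pq2: "p < 2 * r" "q < 2 * r" using j by auto
    have "(a * h * b) $$ (p, q) = (\<Sum>s<2*r. a $$ (p, s) * (h $$ (s, s) * b $$ (s, q)))"
      unfolding assoc_mult_mat[OF ac hc bc] index_mult_mat_sum[OF ac mult_carrier_mat[OF hc bc] pq2]
      by (rule sum.cong) (auto simp: diagonal_mult_index[OF hc torus_diagonal[OF h] bc _ pq2(2)])
    also have "\<dots> = (\<Sum>s<j. a $$ (p, s) * (h $$ (s, s) * b $$ (s, q)))"
      using j N_neg_unitri(2)[OF a] pq by (intro sum.mono_neutral_right) (auto simp: tri_def)
    also have "\<dots> = (?L * ?U) $$ (p, q)"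
      using pq by (subst index_mult_mat_sum[of _ j j _ j]) auto
    finally show "mat j j (\<lambda>pq. (a * h * b) $$ pq) $$ (p, q) = (?L * ?U) $$ (p, q)" using pq by simp
  qed auto
  then have "lead_minor j (a * h * b) = det ?L * det ?U"
    unfolding lead_minor_def by (simp add: det_mult[of _ j])
  also have "det ?L = 1"
  proof -
    have "det ?L = prod_list (diag_mat ?L)"
      by (rule det_lower_triangular[of j]) (use N_neg_unitri(2)[OF a] j in \<open>auto simp: tri_def\<close>)
    also have "\<dots> = (\<Prod>p\<in>{0..<j}. 1)"
      unfolding prod_list_diag_prod using N_neg_unitri(3)[OF a] j by (intro prod.cong) auto
    finally show ?thesis by simp
  qed
  also have "det ?U = (\<Prod>p<j. h $$ (p, p))"
  proof -
    have "det ?U = prod_list (diag_mat ?U)"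
      by (rule det_upper_triangular[of _ j]) (use N_pos_unitri(2)[OF b] j in \<open>auto simp: tri_def upper_triangular_def\<close>)
    also have "\<dots> = (\<Prod>p\<in>{0..<j}. h $$ (p, p))"
      unfolding prod_list_diag_prod using N_pos_unitri(3)[OF b] j by (intro prod.cong) auto
    finally show ?thesis by (simp add: atLeast0LessThan)
  qed
  finally show ?thesis by simp
qed

text \<open>Uniqueness behind the definite description: leading minors give the products of the
  first diagonal entries, and quotients of successive products recover each entry.\<close>

lemma torus_part_LDU:
  assumes a: "a \<in> N_neg r" and h: "h \<in> torus r" and b: "b \<in> N_pos r"
  shows "torus_part r (a * h * b) = h"
  unfolding torus_part_def
proof (rule the_equality)
  show "h \<in> torus r \<and> (\<exists>a'\<in>N_neg r. \<exists>b'\<in>N_pos r. a * h * b = a' * h * b')" using assms by blast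
  fix h' assume "h' \<in> torus r \<and> (\<exists>a'\<in>N_neg r. \<exists>b'\<in>N_pos r. a * h * b = a' * h' * b')"
  then obtain a' b' where h': "h' \<in> torus r" and ab: "a' \<in> N_neg r" "b' \<in> N_pos r" and e: "a * h * b = a' * h' * b'"
    by blast
  have pr: "(\<Prod>p<j. h' $$ (p, p)) = (\<Prod>p<j. h $$ (p, p))" if "j \<le> 2 * r" for j
    using lead_minor_LDU[OF assms that] lead_minor_LDU[OF ab(1) h' ab(2) that] e by simp
  have "h' $$ (p, p) = h $$ (p, p)" if "p < 2 * r" for p
  proof -
    have "(\<Prod>p<p. h $$ (p, p)) \<noteq> 0" using torus_nonzero[OF h] that by simp
    then show ?thesis using pr[of p] pr[of "Suc p"] that by simp
  qed
  then show "h' = h"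
    using torus_diagonal[OF h] torus_diagonal[OF h'] Sp_dim[OF torus_Sp[OF h]] Sp_dim[OF torus_Sp[OF h']]
    unfolding diagonal_mat_def by (intro eq_matI) metis+
qed

section \<open>Density of the big cell and generalized minors\<close>

lemma gprod_Nil [simp]: "gprod (Sp r) [] = 1\<^sub>m (2 * r)"
  by (simp add: gprod_def)

lemma gprod_Cons [simp]: "gprod (Sp r) (x # xs) = x * gprod (Sp r) xs"
  by (simp add: gprod_def)

lemma gprod_Sp: "set xs \<subseteq> carrier (Sp r) \<Longrightarrow> gprod (Sp r) xs \<in> carrier (Sp r)"
  by (induction xs) (auto simp: Sp_one intro: Sp_mult)

lemma gprod_torus: "set xs \<subseteq> torus r \<Longrightarrow> gprod (Sp r) xs \<in> torus r"
  by (induction xs) (auto simp: torus_one intro: torus_mult)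

lemma gprod_torus_diag:
  assumes "set xs \<subseteq> torus r" "p < 2 * r"
  shows "gprod (Sp r) xs $$ (p, p) = prod_list (map (\<lambda>h. h $$ (p, p)) xs)"
  using assms(1)
proof (induction xs)
  case (Cons h xs)
  have "(h * gprod (Sp r) xs) $$ (p, p) = h $$ (p, p) * gprod (Sp r) xs $$ (p, p)"
    using Cons.prems assms(2)
    by (intro diagonal_mult_index[of _ "2 * r" _ "2 * r"])
       (auto intro: Sp_carrier_mat torus_Sp torus_diagonal gprod_torus)
  then show ?case using Cons by simp
qed (use assms in simp)

lemma torus_eqI:
  assumes h: "h \<in> torus r" "h' \<in> torus r" and e: "\<And>p. p < r \<Longrightarrow> h $$ (p, p) = h' $$ (p, p)"
  shows "h = h'"
proof -
  have "h $$ (p, p) = h' $$ (p, p)" if "p < 2 * r" for p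
  proof (cases "p < r")
    case False
    define q where "q = 2 * r - Suc p"
    have q: "q < r" "2 * r - Suc q = p" "q < 2 * r" using False that by (auto simp: q_def)
    have "h $$ (p, p) * h $$ (q, q) = 1" "h' $$ (p, p) * h $$ (q, q) = 1"
      using torus_reflect[OF h(1) q(3)] torus_reflect[OF h(2) q(3)] e[OF q(1)] q(2) by simp_all
    then show ?thesis by (metis mult_cancel_right torus_nonzero[OF h(1) q(3)])
  qed (rule e)
  then show ?thesis
    using torus_diagonal[OF h(1)] torus_diagonal[OF h(2)] Sp_dim[OF torus_Sp[OF h(1)]] Sp_dim[OF torus_Sp[OF h(2)]]
    unfolding diagonal_mat_def by (intro eq_matI) metis+
qed

lemma coroot_prod_torus:
  assumes "\<forall>j\<in>{1..r}. c j \<noteq> 0"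
  shows "gprod (Sp r) (map (\<lambda>j. coroot r j (c j)) [1..<Suc r]) \<in> torus r"
  by (rule gprod_torus) (use assms coroot_torus in auto)

lemma coroot_prod_diag:
  assumes c: "\<forall>j\<in>{1..r}. c j \<noteq> 0" and p: "p < r"
  shows "gprod (Sp r) (map (\<lambda>j. coroot r j (c j)) [1..<Suc r]) $$ (p, p) =
    c (Suc p) / (if p = 0 then 1 else c p)"
proof -
  have "gprod (Sp r) (map (\<lambda>j. coroot r j (c j)) [1..<Suc r]) $$ (p, p) =
      prod_list (map (\<lambda>j. coroot r j (c j) $$ (p, p)) [1..<Suc r])"
    using c p coroot_torus by (subst gprod_torus_diag) (auto simp: comp_def)
  also have "\<dots> = (\<Prod>j\<in>{1..<Suc r}. coroot r j (c j) $$ (p, p))"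
    using prod.distinct_set_conv_list[of "[1..<Suc r]" "\<lambda>j. coroot r j (c j) $$ (p, p)"] by (simp del: upt_Suc)
  also have "\<dots> = (\<Prod>j\<in>{1..<Suc r}. (if j = Suc p then c (Suc p) else 1) * (if j = p then inverse (c p) else 1))"
  proof (rule prod.cong[OF refl])
    fix j assume j: "j \<in> {1..<Suc r}"
    then have "Suc p \<in> chips r j \<longleftrightarrow> j = Suc p" "p \<in> chips r j \<longleftrightarrow> j = p"
      using p by (auto simp: chips_def)
    then show "coroot r j (c j) $$ (p, p) = (if j = Suc p then c (Suc p) else 1) * (if j = p then inverse (c p) else 1)"
      using j p by (auto simp: coroot_index)
  qed
  also have "\<dots> = c (Suc p) / (if p = 0 then 1 else c p)"
    using p by (simp add: prod.distrib divide_inverse)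
  finally show ?thesis .
qed

text \<open>The diagonal entries of a product of coroots are the quotients of consecutive parameters
  c, so the product of the first j of them telescopes to c_j. Thus the parameters are determined by
  \<open>h\<close>, and the fundamental weight selects c_d.\<close>

lemma torus_char_fund_weight:
  assumes h: "h \<in> torus r" and d: "d \<in> {1..r}"
  shows "torus_char r (fund_weight d) h = (\<Prod>p<d. h $$ (p, p))"
  unfolding torus_char_def
proof (rule the_equality)
  have fw: "(\<Prod>j=1..r. c j powi fund_weight d j) = c d" for c :: "nat \<Rightarrow> complex"
  proof -
    have "(\<Prod>j=1..r. c j powi fund_weight d j) = (\<Prod>j=1..r. if j = d then c d else 1)"
      using d by (intro prod.cong) (auto simp: fund_weight_def)
    then show ?thesis using d by simp
  qed
  define c where "c j = (\<Prod>p<j. h $$ (p, p))" for j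
  have c: "\<forall>j\<in>{1..r}. c j \<noteq> 0" using torus_nonzero[OF h] by (auto simp: c_def)
  have "h = gprod (Sp r) (map (\<lambda>j. coroot r j (c j)) [1..<Suc r])"
  proof (rule torus_eqI[OF h coroot_prod_torus[OF c]])
    fix p assume p: "p < r"
    have "c p \<noteq> 0" using torus_nonzero[OF h] p by (auto simp: c_def)
    then show "h $$ (p, p) = gprod (Sp r) (map (\<lambda>j. coroot r j (c j)) [1..<Suc r]) $$ (p, p)"
      unfolding coroot_prod_diag[OF c p] by (cases p) (auto simp: c_def)
  qed
  moreover have "(\<Prod>p<d. h $$ (p, p)) = (\<Prod>j=1..r. c j powi fund_weight d j)"
    unfolding fw by (simp add: c_def)
  ultimately show "\<exists>c. (\<forall>j\<in>{1..r}. c j \<noteq> 0) \<and> h = gprod (Sp r) (map (\<lambda>j. coroot r j (c j)) [1..<Suc r]) \<and>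
      (\<Prod>p<d. h $$ (p, p)) = (\<Prod>j=1..r. c j powi fund_weight d j)"
    using c by blast
  fix z assume "\<exists>c. (\<forall>j\<in>{1..r}. c j \<noteq> 0) \<and> h = gprod (Sp r) (map (\<lambda>j. coroot r j (c j)) [1..<Suc r]) \<and>
      z = (\<Prod>j=1..r. c j powi fund_weight d j)"
  then obtain c where c: "\<forall>j\<in>{1..r}. c j \<noteq> 0"
    and hc: "h = gprod (Sp r) (map (\<lambda>j. coroot r j (c j)) [1..<Suc r])" and z: "z = c d"
    unfolding fw by blast
  have "(\<Prod>p<j. h $$ (p, p)) = c j" if "1 \<le> j" "j \<le> r" for j
    using that
  proof (induction j rule: dec_induct)
    case base
    then show ?case using coroot_prod_diag[OF c, of 0] hc by simp
  next
    case (step j)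
    then show ?case using coroot_prod_diag[OF c, of j] hc c by simp
  qed
  then show "z = (\<Prod>p<d. h $$ (p, p))" using d z by simp
qed

section \<open>Polynomial functions of the matrix entries\<close>

lemma poly_funs_sum: "(\<And>s. s \<in> S \<Longrightarrow> G s \<in> poly_funs n) \<Longrightarrow> (\<lambda>x. \<Sum>s\<in>S. G s x) \<in> poly_funs n"
proof (induction S rule: infinite_finite_induct)
  case (insert s S)
  then show ?case using poly_funs.add[of "G s" n "\<lambda>x. \<Sum>s\<in>S. G s x"] by simp
qed (use poly_funs.const[of 0] in auto)

lemma poly_funs_prod: "(\<And>s. s \<in> S \<Longrightarrow> G s \<in> poly_funs n) \<Longrightarrow> (\<lambda>x. \<Prod>s\<in>S. G s x) \<in> poly_funs n"
proof (induction S rule: infinite_finite_induct)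
  case (insert s S)
  then show ?case using poly_funs.mul[of "G s" n "\<lambda>x. \<Prod>s\<in>S. G s x"] by simp
qed (use poly_funs.const[of 1] in auto)

lemma poly_funs_subst:
  assumes "F \<in> poly_funs n" and "\<And>p q. p < n \<Longrightarrow> q < n \<Longrightarrow> (\<lambda>x. M x $$ (p, q)) \<in> poly_funs n"
  shows "(\<lambda>x. F (M x)) \<in> poly_funs n"
  using assms(1) by induction (use assms(2) in \<open>auto intro: poly_funs.intros\<close>)

text \<open>Translations are linear in the entries. The product is spelled out entrywise because
  \<open>x\<close> ranges over all matrices, whereas only entries inside the n by n square are
  coordinate functions.\<close>

lemma poly_funs_mult:
  assumes "A \<in> carrier_mat n n" "B \<in> carrier_mat n n" "F \<in> poly_funs n"
  obtains F' where "F' \<in> poly_funs n" "\<And>x. x \<in> carrier_mat n n \<Longrightarrow> F' x = F (A * x * B)"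
proof
  let ?M = "\<lambda>x. mat n n (\<lambda>(p, q). \<Sum>s<n. (\<Sum>t<n. A $$ (p, t) * x $$ (t, s)) * B $$ (s, q))"
  show "(\<lambda>x. F (?M x)) \<in> poly_funs n"
  proof (rule poly_funs_subst[OF assms(3)])
    fix p q assume pq: "p < n" "q < n"
    have "(\<lambda>x. \<Sum>s<n. (\<Sum>t<n. A $$ (p, t) * x $$ (t, s)) * B $$ (s, q)) \<in> poly_funs n"
      using pq by (intro poly_funs_sum poly_funs.mul poly_funs.const poly_funs.entry) auto
    then show "(\<lambda>x. ?M x $$ (p, q)) \<in> poly_funs n" using pq by simp
  qed
  show "F (?M x) = F (A * x * B)" if x: "x \<in> carrier_mat n n" for x
  proof -
    have "?M x = A * x * B"
      using assms(1,2) x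
      by (intro eq_matI) (auto simp: index_mult_mat_sum[OF mult_carrier_mat[OF assms(1) x] assms(2)]
        index_mult_mat_sum[OF assms(1) x] simp del: assoc_mult_mat)
    then show ?thesis by simp
  qed
qed

lemma lead_minor_poly: "j \<le> n \<Longrightarrow> lead_minor j \<in> poly_funs n"
proof -
  assume j: "j \<le> n"
  have "lead_minor j = (\<lambda>x. \<Sum>p\<in>{p. p permutes {0..<j}}. signof p * (\<Prod>i = 0..<j. x $$ (i, p i)))"
  proof
    fix x :: "complex mat"
    have "p i < j" if "p permutes {0..<j}" "i < j" for p i
      using permutes_in_image[OF that(1), of i] that(2) by simp
    then show "lead_minor j x = (\<Sum>p\<in>{p. p permutes {0..<j}}. signof p * (\<Prod>i = 0..<j. x $$ (i, p i)))"
      unfolding lead_minor_def by (subst det_def'[of _ j]) (auto intro!: sum.cong prod.cong)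
  qed
  moreover have "(\<lambda>x. \<Sum>p\<in>{p. p permutes {0..<j}}. signof p * (\<Prod>i = 0..<j. x $$ (i, p i))) \<in> poly_funs n"
  proof (intro poly_funs_sum poly_funs.mul poly_funs.const poly_funs_prod poly_funs.entry)
    fix p i assume "p \<in> {p. p permutes {0..<j}}" "i \<in> {0..<j}"
    then have "i < j" "p i < j" using permutes_in_image[of p "{0..<j}" i] by auto
    then show "i < n" "p i < n" using j by auto
  qed
  ultimately show ?thesis by simp
qed

text \<open>Restriction to a curve with polynomial entries; vanishing can then be transferred from
  infinitely many parameters to all of them.\<close>

lemma poly_funs_univariate:
  assumes "F \<in> poly_funs n" and "\<And>p q. p < n \<Longrightarrow> q < n \<Longrightarrow> \<exists>f. \<forall>b. M b $$ (p, q) = poly f b"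
  shows "\<exists>f. \<forall>b. F (M b) = poly f b"
  using assms(1)
proof induction
  case (const c)
  then show ?case by (intro exI[of _ "[:c:]"]) simp
next
  case (add F F')
  then show ?case by (metis poly_add)
next
  case (mul F F')
  then show ?case by (metis poly_mult)
qed (rule assms(2))

section \<open>The big cell and its density\<close>

abbreviation x_group :: "nat \<Rightarrow> complex mat set" where
  "x_group r \<equiv> generate (Sp r) (x_gens r)"

abbreviation y_group :: "nat \<Rightarrow> complex mat set" where
  "y_group r \<equiv> generate (Sp r) (y_gens r)"

abbreviation xty_group :: "nat \<Rightarrow> complex mat set" where
  "xty_group r \<equiv> generate (Sp r) (torus r \<union> x_gens r \<union> y_gens r)"

lemmas x_group_Sp = generate_Sp_carrier[OF x_gens_Sp] and y_group_Sp = generate_Sp_carrier[OF y_gens_Sp]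

lemma xty_gens_Sp: "torus r \<union> x_gens r \<union> y_gens r \<subseteq> carrier (Sp r)"
  using torus_Sp x_gens_Sp y_gens_Sp by blast

lemmas xty_group_Sp = generate_Sp_carrier[OF xty_gens_Sp]

text \<open>Moving \<open>y\<^sub>i(c)\<close> to the left past an element of \<open>N\<close> works unless \<open>c\<close> hits one of finitely many
  poles: at each factor \<open>x\<^sub>i(a)\<close> the parameter is changed by the injective map
  \<open>c \<mapsto> c / (1 + a c)\<close>.\<close>

lemma x_group_yg:
  assumes i: "i \<in> {1..r}" and "b \<in> x_group r"
  shows "\<exists>E \<phi>. finite E \<and> inj_on \<phi> (- E) \<and>
    (\<forall>c\<in>- E. \<exists>h\<in>torus r. \<exists>b'\<in>x_group r. b * yg r i c = yg r i (\<phi> c) * (h * b'))"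
proof -
  have triv: "\<exists>E \<phi>. finite E \<and> inj_on \<phi> (- E) \<and>
    (\<forall>c\<in>- E. \<exists>h\<in>torus r. \<exists>b'\<in>x_group r. b * yg r i c = yg r i (\<phi> c) * (h * b'))"
    if "b' \<in> x_group r" "\<And>c. b * yg r i c = yg r i c * (1\<^sub>m (2 * r) * b')" for b b'
  proof (rule exI[of _ "{}"], rule exI[of _ "\<lambda>c. c"], intro conjI ballI)
    fix c
    show "\<exists>h\<in>torus r. \<exists>b'\<in>x_group r. b * yg r i c = yg r i c * (h * b')"
      using that torus_one by blast
  qed simp_all
  have gen: "\<exists>E \<phi>. finite E \<and> inj_on \<phi> (- E) \<and>
    (\<forall>c\<in>- E. \<exists>h\<in>torus r. \<exists>b'\<in>x_group r. xg r j a * yg r i c = yg r i (\<phi> c) * (h * b'))"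
    if j: "j \<in> {1..r}" for j a
  proof -
    have bg: "xg r j a \<in> x_group r" for a using j by (auto simp: x_gens_def intro: generate.incl)
    show ?thesis
    proof (cases "i = j")
      case False
      have "xg r j a * yg r i c = yg r i c * (1\<^sub>m (2 * r) * xg r j a)" for c
        using xg_yg_commute[OF j i] False xg_Sp[OF j] by (simp add: Sp_left_one)
      then show ?thesis by (rule triv[OF bg])
    next
      case True
      let ?E = "{c. 1 + a * c = 0}"
      have "?E \<subseteq> {- 1 / a}"
      proof
        fix c assume "c \<in> ?E"
        then have ac: "a * c = - 1" "a \<noteq> 0" by (auto simp: add_eq_0_iff)
        have "c = a * c / a" using ac(2) by simp
        then show "c \<in> {- 1 / a}" unfolding ac(1) by simp
      qed
      then have "finite ?E" by (rule finite_subset) simp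
      moreover have "inj_on (\<lambda>c. c / (1 + a * c)) (- ?E)"
        by (auto simp: inj_on_def field_simps)
      moreover have "\<exists>h\<in>torus r. \<exists>b'\<in>x_group r. xg r j a * yg r i c = yg r i (c / (1 + a * c)) * (h * b')"
        if "c \<in> - ?E" for c
        using xg_yg_exchange[OF j refl, of a c] that True bg coroot_torus[OF j, of "1 + a * c"] by blast
      ultimately show ?thesis by blast
    qed
  qed
  show ?thesis
    using assms(2)
  proof induction
    case one
    have "1\<^sub>m (2 * r) * yg r i c = yg r i c * (1\<^sub>m (2 * r) * 1\<^sub>m (2 * r))" for c
      using yg_Sp[OF i, of c] by (simp add: Sp_left_one Sp_right_one)
    then show ?case using triv[OF generate.one, of "1\<^sub>m (2 * r)"] by simp
  next
    case (incl b)
    then show ?case using gen by (auto simp: x_gens_def)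
  next
    case (inv b)
    then obtain j a where j: "j \<in> {1..r}" and b: "b = xg r j a" by (auto simp: x_gens_def)
    have "inv\<^bsub>Sp r\<^esub> b = xg r j (- a)" using inv_Sp[OF xg_Sp[OF j]] adj_xg[OF j] b by simp
    then show ?case using gen[OF j, of "- a"] by simp
  next
    case (eng b1 b2)
    then obtain E1 \<phi>1 E2 \<phi>2 where 1: "finite E1" "inj_on \<phi>1 (- E1)"
        "\<forall>c\<in>- E1. \<exists>h\<in>torus r. \<exists>b'\<in>x_group r. b1 * yg r i c = yg r i (\<phi>1 c) * (h * b')"
      and 2: "finite E2" "inj_on \<phi>2 (- E2)"
        "\<forall>c\<in>- E2. \<exists>h\<in>torus r. \<exists>b'\<in>x_group r. b2 * yg r i c = yg r i (\<phi>2 c) * (h * b')"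
      by blast
    \<comment> \<open>The composite is undefined where the first map is, or where the first map hits
      a pole of the second. Injectivity is carried through the induction so that this preimage of a
      finite set is finite.\<close>
    let ?E = "E2 \<union> (\<phi>2 -` E1 \<inter> - E2)"
    have "finite (\<phi>2 -` E1 \<inter> - E2)"
      using finite_vimage_IntI[OF 1(1) 2(2)] .
    then have E: "finite ?E" using 2(1) by simp
    have inj: "inj_on (\<phi>1 \<circ> \<phi>2) (- ?E)"
      using 1(2) 2(2) by (auto simp: inj_on_def)
    have ex: "\<exists>h\<in>torus r. \<exists>b'\<in>x_group r. b1 * b2 * yg r i c = yg r i ((\<phi>1 \<circ> \<phi>2) c) * (h * b')"
      if c: "c \<in> - ?E" for c
    proof -
      obtain h2 b2' where h2: "h2 \<in> torus r" "b2' \<in> x_group r" "b2 * yg r i c = yg r i (\<phi>2 c) * (h2 * b2')"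
        using bspec[OF 2(3), of c] c by blast
      obtain h1 b1' where h1: "h1 \<in> torus r" "b1' \<in> x_group r" "b1 * yg r i (\<phi>2 c) = yg r i (\<phi>1 (\<phi>2 c)) * (h1 * b1')"
        using bspec[OF 1(3), of "\<phi>2 c"] c by blast
      note S = torus_Sp[OF h1(1)] torus_Sp[OF h2(1)] x_group_Sp[OF h1(2)] x_group_Sp[OF h2(2)]
        x_group_Sp[OF eng(1)] x_group_Sp[OF eng(2)] yg_Sp[OF i] torus_Sp[OF torus_adj[OF h2(1)]]
      have "b1 * b2 * yg r i c = (b1 * yg r i (\<phi>2 c)) * (h2 * b2')"
        using S h2(3) by (simp add: Sp_assoc[where r = r] Sp_closed del: assoc_mult_mat)
      \<comment> \<open>The torus element \<open>h2\<close> is moved to the left past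
        \<open>b1'\<close>, which is replaced by a conjugate and stays in the group.\<close>
      also have "\<dots> = yg r i (\<phi>1 (\<phi>2 c)) * ((h1 * h2) * ((adj r h2 * b1' * adj r (adj r h2)) * b2'))"
        unfolding h1(3) adj_adj[OF Sp_carrier_mat[OF S(2)]]
        using S by (simp add: Sp_assoc[where r = r] Sp_closed mult_adj_cancel del: assoc_mult_mat)
      finally show ?thesis
        using torus_mult[OF h1(1) h2(1)] generate.eng[OF torus_conj_generate[OF x_gens_Sp x_gens_torus x_gens_adj torus_adj[OF h2(1)] h1(2)] h2(2)]
        by auto
    qed
    show ?case
      unfolding mult_Sp by (rule exI[of _ ?E], rule exI[of _ "\<phi>1 \<circ> \<phi>2"], intro conjI ballI E inj ex)
  qed
qed

text \<open>Built from the groups generated by the \<open>x\<close> and \<open>y\<close> elements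
  rather than from the radicals: membership then permits induction over generators, and the inner
  bounds place the set inside \<open>G0\<close>.\<close>

definition big_cell :: "nat \<Rightarrow> complex mat set" where
  "big_cell r = {a * h * b |a h b. a \<in> y_group r \<and> h \<in> torus r \<and> b \<in> x_group r}"

lemma big_cell_Sp: "g \<in> big_cell r \<Longrightarrow> g \<in> carrier (Sp r)"
  by (auto simp: big_cell_def intro!: Sp_mult intro: y_group_Sp x_group_Sp torus_Sp)

lemma big_cell_I: "a \<in> y_group r \<Longrightarrow> h \<in> torus r \<Longrightarrow> b \<in> x_group r \<Longrightarrow> a * h * b \<in> big_cell r"
  by (auto simp: big_cell_def)

lemma big_cell_mult_x:
  assumes "g \<in> big_cell r" "b' \<in> x_group r"
  shows "g * b' \<in> big_cell r"
proof -
  obtain a h b where g: "g = a * h * b" "a \<in> y_group r" "h \<in> torus r" "b \<in> x_group r"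
    using assms by (auto simp: big_cell_def)
  have "a * h * b * b' = a * h * (b * b')"
    using g assms by (intro Sp_assoc Sp_mult) (auto intro: y_group_Sp x_group_Sp torus_Sp)
  then show ?thesis using g generate.eng[OF g(4) assms(2)] by (auto intro: big_cell_I)
qed

lemma big_cell_mult_torus:
  assumes "g \<in> big_cell r" "t \<in> torus r"
  shows "g * t \<in> big_cell r"
proof -
  obtain a h b where g: "g = a * h * b" "a \<in> y_group r" "h \<in> torus r" "b \<in> x_group r"
    using assms by (auto simp: big_cell_def)
  note S = y_group_Sp[OF g(2)] torus_Sp[OF g(3)] x_group_Sp[OF g(4)] torus_Sp[OF assms(2)]
  have "a * h * b * t = a * (h * t) * (adj r t * b * adj r (adj r t))"
    unfolding adj_adj[OF Sp_carrier_mat[OF S(4)]]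
    using S by (simp add: Sp_assoc[where r = r] Sp_closed mult_adj_cancel del: assoc_mult_mat)
  then show ?thesis
    using g assms torus_conj_generate[OF x_gens_Sp x_gens_torus x_gens_adj torus_adj[OF assms(2)] g(4)]
    by (auto intro: big_cell_I torus_mult)
qed

text \<open>The element \<open>yg r i c\<close> is pushed through the upper unitriangular factor and
  the torus until the lower factor absorbs it; only the finitely many poles of
  \<open>x_group_yg\<close> have to be avoided.\<close>

lemma big_cell_mult_y:
  assumes "g \<in> big_cell r" and i: "i \<in> {1..r}"
  shows "finite {c. g * yg r i c \<notin> big_cell r}"
proof -
  obtain a h b where g: "g = a * h * b" "a \<in> y_group r" "h \<in> torus r" "b \<in> x_group r"
    using assms by (auto simp: big_cell_def)
  obtain E \<phi> where E: "finite E"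
    "\<forall>c\<in>- E. \<exists>h\<in>torus r. \<exists>b'\<in>x_group r. b * yg r i c = yg r i (\<phi> c) * (h * b')"
    using x_group_yg[OF i g(4)] by blast
  have "g * yg r i c \<in> big_cell r" if c: "c \<notin> E" for c
  proof -
    obtain h' b' where h': "h' \<in> torus r" "b' \<in> x_group r" "b * yg r i c = yg r i (\<phi> c) * (h' * b')"
      using bspec[OF E(2), of c] c by blast
    have y: "yg r i (\<phi> c) \<in> y_group r" using i by (auto simp: y_gens_def intro: generate.incl)
    note S = y_group_Sp[OF g(2)] torus_Sp[OF g(3)] x_group_Sp[OF g(4)] torus_Sp[OF h'(1)]
      x_group_Sp[OF h'(2)] y_group_Sp[OF y] yg_Sp[OF i, of c]
    have "g * yg r i c = a * h * (b * yg r i c)"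
      unfolding g(1) using S by (simp add: Sp_assoc[where r = r] Sp_closed del: assoc_mult_mat)
    also have "\<dots> = (a * (h * yg r i (\<phi> c) * adj r h)) * (h * h') * b'"
      unfolding h'(3) using S by (simp add: Sp_assoc[where r = r] Sp_closed adj_mult_cancel del: assoc_mult_mat)
    finally show ?thesis
      using generate.eng[OF g(2) torus_conj_generate[OF y_gens_Sp y_gens_torus y_gens_adj g(3) y]]
        torus_mult[OF g(3) h'(1)] h'(2) by (auto intro: big_cell_I)
  qed
  then have "{c. g * yg r i c \<notin> big_cell r} \<subseteq> E" by auto
  then show ?thesis using E(1) by (rule finite_subset)
qed

lemma one_big_cell: "1\<^sub>m (2 * r) \<in> big_cell r"
  using big_cell_I[OF generate.one torus_one generate.one] by (simp add: Sp_left_one Sp_one)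

text \<open>The Zariski closure of the big cell is stable under right multiplication by the generators.\<close>

lemma big_cell_dense:
  assumes "F \<in> poly_funs (2 * r)" "\<And>g. g \<in> big_cell r \<Longrightarrow> F g = 0" "g \<in> xty_group r"
  shows "F g = 0"
proof -
  \<comment> \<open>The Zariski closure of the big cell within the symplectic group.\<close>
  define cl where "cl = {z \<in> carrier (Sp r). \<forall>F\<in>poly_funs (2 * r). (\<forall>g\<in>big_cell r. F g = 0) \<longrightarrow> F z = 0}"
  have step: "z * g \<in> cl" if z: "z \<in> cl" and g: "g \<in> carrier (Sp r)"
    and v: "\<And>F z. F \<in> poly_funs (2 * r) \<Longrightarrow> \<forall>g\<in>big_cell r. F g = 0 \<Longrightarrow> z \<in> big_cell r \<Longrightarrow> F (z * g) = 0" for z g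
  proof -
    have zc: "z \<in> carrier (Sp r)" using z by (simp add: cl_def)
    have "F (z * g) = 0" if F: "F \<in> poly_funs (2 * r)" "\<forall>g\<in>big_cell r. F g = 0" for F
    proof -
      obtain F' where F': "F' \<in> poly_funs (2 * r)"
        "\<And>x. x \<in> carrier_mat (2 * r) (2 * r) \<Longrightarrow> F' x = F (1\<^sub>m (2 * r) * x * g)"
        using poly_funs_mult[OF one_carrier_mat Sp_carrier_mat[OF g] F(1)] by blast
      have "F' x = F (x * g)" if "x \<in> carrier (Sp r)" for x
        using F'(2)[OF Sp_carrier_mat[OF that]] Sp_left_one[OF that] by simp
      then have "\<forall>x\<in>big_cell r. F' x = 0" "F' z = F (z * g)"
        using v[OF F] big_cell_Sp zc by auto
      then show ?thesis using z F'(1) by (auto simp: cl_def)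
    qed
    then show ?thesis using Sp_mult[OF zc g] by (simp add: cl_def)
  qed
  have step_in: "z * g \<in> cl" if "z \<in> cl" "g \<in> carrier (Sp r)" "\<And>z. z \<in> big_cell r \<Longrightarrow> z * g \<in> big_cell r" for z g
    using step[OF that(1,2)] that(3) by blast
  have torus: "z * g \<in> cl" if "z \<in> cl" "g \<in> torus r" for z g
    using that torus_Sp big_cell_mult_torus by (intro step_in) auto
  have x: "z * xg r i t \<in> cl" if "z \<in> cl" "i \<in> {1..r}" for z i t
  proof (rule step_in[OF that(1) xg_Sp[OF that(2)]])
    have "xg r i t \<in> x_group r" using that(2) by (auto simp: x_gens_def intro: generate.incl)
    then show "z * xg r i t \<in> big_cell r" if "z \<in> big_cell r" for z using big_cell_mult_x that by blast
  qed
  have y: "z * yg r i t \<in> cl" if zi: "z \<in> cl" "i \<in> {1..r}" for z i t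
  proof (rule step[OF zi(1) yg_Sp[OF zi(2)]])
    fix F z assume F: "F \<in> poly_funs (2 * r)" "\<forall>g\<in>big_cell r. F g = 0" and z: "z \<in> big_cell r"
    have "\<exists>f. \<forall>b. (z * yg r i b) $$ (p, q) = poly f b" if pq: "p < 2 * r" "q < 2 * r" for p q
    proof (intro exI allI)
      fix b
      have "(z * yg r i b) $$ (p, q) = (\<Sum>s<2*r. z $$ (p, s) * yg r i b $$ (s, q))"
        by (rule index_mult_mat_sum[OF Sp_carrier_mat[OF big_cell_Sp[OF z]] yg_carrier pq])
      also have "\<dots> = poly (\<Sum>s<2*r. smult (z $$ (p, s))
          (if s = q then 1 else if s = Suc q \<and> s \<in> chips r i then [:0, 1:] else 0)) b"
        using pq zi(2) by (auto simp: poly_sum yg_index intro!: sum.cong)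
      finally show "(z * yg r i b) $$ (p, q) = poly (\<Sum>s<2*r. smult (z $$ (p, s))
          (if s = q then 1 else if s = Suc q \<and> s \<in> chips r i then [:0, 1:] else 0)) b" .
    qed
    then obtain f where f: "\<And>b. F (z * yg r i b) = poly f b"
      using poly_funs_univariate[OF F(1), of "\<lambda>b. z * yg r i b"] by blast
    \<comment> \<open>For all but finitely many c the product lies in the big cell, so the
      polynomial f has infinitely many roots and vanishes also at the excluded parameters.\<close>
    have "- {c. z * yg r i c \<notin> big_cell r} \<subseteq> {c. poly f c = 0}" using F(2) f by auto
    moreover have "infinite (- {c. z * yg r i c \<notin> big_cell r})"
      using big_cell_mult_y[OF z zi(2)] infinite_UNIV_char_0 finite_compl by metis
    ultimately have "f = 0" using poly_roots_finite finite_subset by blast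
    then show "F (z * yg r i t) = 0" by (simp add: f)
  qed
  have "z * g \<in> cl" if "z \<in> cl" for z
    using assms(3) that
  proof (induction arbitrary: z)
    case one
    then show ?case by (simp add: cl_def Sp_right_one)
  next
    case (incl g)
    then show ?case using torus x y by (auto simp: x_gens_def y_gens_def)
  next
    case (inv g)
    then show ?case
      using torus[OF _ torus_adj] x y by (auto simp: x_gens_def y_gens_def inv_Sp torus_Sp xg_Sp yg_Sp adj_xg adj_yg)
  next
    case (eng g1 g2)
    have "z * (g1 * g2) = z * g1 * g2"
      using eng(1,2,5) by (intro Sp_assoc[symmetric]) (auto simp: cl_def intro: xty_group_Sp)
    then show ?case using eng by simp
  qed
  moreover have "1\<^sub>m (2 * r) \<in> cl" using one_big_cell Sp_one by (simp add: cl_def)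
  ultimately have "1\<^sub>m (2 * r) * g \<in> cl" by blast
  then show ?thesis using assms xty_group_Sp[OF assms(3)] by (simp add: cl_def Sp_left_one)
qed

lemma big_cell_G0: "g \<in> big_cell r \<Longrightarrow> g \<in> G0 r"
  using generate_y_subset_N_neg generate_x_subset_N_pos unfolding big_cell_def G0_def by blast

lemma G0_torus_char:
  assumes "g \<in> G0 r" "d \<in> {1..r}"
  shows "torus_char r (fund_weight d) (torus_part r g) = lead_minor d g"
proof -
  obtain a h b where g: "g = a * h * b" and ahb: "a \<in> N_neg r" "h \<in> torus r" "b \<in> N_pos r"
    using assms by (auto simp: G0_def)
  show ?thesis
    unfolding g torus_part_LDU[OF ahb] torus_char_fund_weight[OF ahb(2) assms(2)]
    by (rule lead_minor_LDU[OF ahb, symmetric]) (use assms in auto)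
qed

section \<open>Chosen representatives and the values of generalized minors\<close>

lemma weyl_word_Nil: "weyl_word r [] = \<one>\<^bsub>weyl r\<^esub>"
  by (simp add: weyl_word_def gprod_def)

lemma weyl_rep_one: "weyl_rep r \<one>\<^bsub>weyl r\<^esub> = 1\<^sub>m (2 * r)"
proof -
  have "reduced_expr r \<one>\<^bsub>weyl r\<^esub> js \<longleftrightarrow> js = []" for js
  proof
    assume "reduced_expr r \<one>\<^bsub>weyl r\<^esub> js"
    then have "length js \<le> length ([] :: nat list)"
      unfolding reduced_expr_def using weyl_word_Nil[of r] by (metis empty_subsetI list.set(1))
    then show "js = []" by simp
  next
    assume "js = []"
    then show "reduced_expr r \<one>\<^bsub>weyl r\<^esub> js" by (simp add: reduced_expr_def weyl_word_Nil)
  qed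
  then have "(SOME js. reduced_expr r \<one>\<^bsub>weyl r\<^esub> js) = []" by simp
  then show ?thesis by (simp add: weyl_rep_def)
qed

text \<open>The representative is made from an unspecified reduced word. What is known about it is
  that it spells the same element and is no longer than \<open>js\<close>; that this fixes the
  product is the content of \<open>s_bar_word_unique\<close>.\<close>

lemma weyl_rep_word:
  assumes "set js \<subseteq> {1..r}"
  obtains js' where "set js' \<subseteq> {1..r}" "weyl_word r js' = weyl_word r js" "length js' \<le> length js"
    "weyl_rep r (weyl_word r js) = gprod (Sp r) (map (s_bar r) js')"
proof -
  define P where "P js' \<longleftrightarrow> set js' \<subseteq> {1..r} \<and> weyl_word r js' = weyl_word r js" for js'
  have "P js" using assms by (simp add: P_def)
  then have "reduced_expr r (weyl_word r js) (ARG_MIN length js'. P js')"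
    using arg_min_nat_lemma[of P js length] unfolding reduced_expr_def P_def by blast
  then have "reduced_expr r (weyl_word r js) (SOME js'. reduced_expr r (weyl_word r js) js')"
    by (rule someI)
  then show ?thesis
    using assms by (intro that[of "SOME js'. reduced_expr r (weyl_word r js) js'"])
      (auto simp: reduced_expr_def weyl_rep_def)
qed

lemma xty_group_xg: "i \<in> {1..r} \<Longrightarrow> xg r i t \<in> xty_group r"
  and xty_group_yg: "i \<in> {1..r} \<Longrightarrow> yg r i t \<in> xty_group r"
  by (rule generate.incl, auto simp: x_gens_def y_gens_def)+

lemma xty_group_mult: "g \<in> xty_group r \<Longrightarrow> h \<in> xty_group r \<Longrightarrow> g * h \<in> xty_group r"
  using generate.eng[of g "Sp r" _ h] by simp

lemma xty_group_adj: "g \<in> xty_group r \<Longrightarrow> adj r g \<in> xty_group r"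
  using group.generate_m_inv_closed[OF Sp_group xty_gens_Sp, of g] by (simp add: inv_Sp xty_group_Sp)

lemma xty_group_gprod: "set xs \<subseteq> xty_group r \<Longrightarrow> gprod (Sp r) xs \<in> xty_group r"
proof (induction xs)
  case Nil
  then show ?case using generate.one[of "Sp r"] by simp
next
  case (Cons x xs)
  then show ?case using xty_group_mult by simp
qed

lemma xty_group_s_bar: "i \<in> {1..r} \<Longrightarrow> s_bar r i \<in> xty_group r"
  unfolding s_bar_def by (intro xty_group_mult xty_group_xg xty_group_yg)

lemma xty_group_xneg: "i \<in> {1..r} \<Longrightarrow> t \<noteq> 0 \<Longrightarrow> xneg r i t \<in> xty_group r"
  unfolding xneg_def
  by (intro xty_group_mult xty_group_yg generate.incl) (auto intro: coroot_torus)

text \<open>The witness that gives the choice in \<open>gen_minor\<close> a meaning: on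
  \<open>G0\<close> the value of the character is a leading minor, and leading minors are
  polynomials in the entries.\<close>

lemma is_gen_minor_lead_minor:
  assumes d: "d \<in> {1..r}" and u: "weyl_rep r w \<in> carrier (Sp r)"
  shows "is_gen_minor r w \<one>\<^bsub>weyl r\<^esub> d (\<lambda>x. lead_minor d (adj r (weyl_rep r w) * x))"
  unfolding is_gen_minor_def
proof (intro conjI ballI)
  obtain F where F: "F \<in> poly_funs (2 * r)"
    "\<And>x. x \<in> carrier_mat (2 * r) (2 * r) \<Longrightarrow>
      F x = lead_minor d (adj r (weyl_rep r w) * x * 1\<^sub>m (2 * r))"
    using poly_funs_mult[OF adj_carrier one_carrier_mat lead_minor_poly[of d "2 * r"], of "weyl_rep r w"] d
    by auto
  then have "F x = lead_minor d (adj r (weyl_rep r w) * x)" if "x \<in> carrier (Sp r)" for x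
    using that Sp_right_one[of "adj r (weyl_rep r w) * x" r] Sp_carrier_mat[OF that] u
    by (simp add: Sp_mult adj_Sp del: assoc_mult_mat)
  then show "regular_on_Sp r (\<lambda>x. lead_minor d (adj r (weyl_rep r w) * x))"
    unfolding regular_on_Sp_def using F(1) by (intro bexI[of _ F]) auto
  fix x assume x: "x \<in> carrier (Sp r)"
  have "inv\<^bsub>Sp r\<^esub> (weyl_rep r w) * x * weyl_rep r \<one>\<^bsub>weyl r\<^esub> = adj r (weyl_rep r w) * x"
    using x u by (simp add: weyl_rep_one inv_Sp Sp_right_one Sp_mult adj_Sp del: assoc_mult_mat)
  then show "let x' = inv\<^bsub>Sp r\<^esub> (weyl_rep r w) * x * weyl_rep r \<one>\<^bsub>weyl r\<^esub> in x' \<in> G0 r \<longrightarrow>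
      lead_minor d (adj r (weyl_rep r w) * x) = torus_char r (fund_weight d) (torus_part r x')"
    using G0_torus_char[OF _ d] by (simp add: Let_def)
qed

text \<open>The defining property fixes the chosen function on the big cell translated by the
  representative. Since it is a polynomial on the symplectic group, density extends the agreement to
  the group generated by the torus and the \<open>x\<close> and \<open>y\<close> elements, which
  contains the points of interest.\<close>

lemma gen_minor_eq_lead_minor:
  assumes d: "d \<in> {1..r}" and u: "weyl_rep r w \<in> xty_group r" and x: "x \<in> xty_group r"
  shows "gen_minor r w \<one>\<^bsub>weyl r\<^esub> d x = lead_minor d (adj r (weyl_rep r w) * x)"
proof -
  let ?u = "weyl_rep r w" and ?F = "gen_minor r w \<one>\<^bsub>weyl r\<^esub> d"
  have uc: "?u \<in> carrier (Sp r)" by (rule xty_group_Sp[OF u])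
  have "is_gen_minor r w \<one>\<^bsub>weyl r\<^esub> d ?F"
    unfolding gen_minor_def using is_gen_minor_lead_minor[OF d uc] by (metis someI)
  then obtain P where P: "P \<in> poly_funs (2 * r)" "\<And>x. x \<in> carrier (Sp r) \<Longrightarrow> ?F x = P x"
    and F: "\<And>x. x \<in> carrier (Sp r) \<Longrightarrow> inv\<^bsub>Sp r\<^esub> ?u * x * weyl_rep r \<one>\<^bsub>weyl r\<^esub> \<in> G0 r \<Longrightarrow>
      ?F x = torus_char r (fund_weight d) (torus_part r (inv\<^bsub>Sp r\<^esub> ?u * x * weyl_rep r \<one>\<^bsub>weyl r\<^esub>))"
    unfolding is_gen_minor_def regular_on_Sp_def Let_def by blast
  obtain P' where P': "P' \<in> poly_funs (2 * r)"
    "\<And>x. x \<in> carrier_mat (2 * r) (2 * r) \<Longrightarrow> P' x = P (?u * x * 1\<^sub>m (2 * r))"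
    using poly_funs_mult[OF Sp_carrier_mat[OF uc] one_carrier_mat P(1)] by blast
  have P'F: "P' g = ?F (?u * g)" if "g \<in> carrier (Sp r)" for g
    using P'(2)[OF Sp_carrier_mat[OF that]] P(2) that uc
    by (simp add: Sp_right_one Sp_mult del: assoc_mult_mat)
  have "P' g - lead_minor d g = 0" if g: "g \<in> big_cell r" for g
  proof -
    have gc: "g \<in> carrier (Sp r)" by (rule big_cell_Sp[OF g])
    have "inv\<^bsub>Sp r\<^esub> ?u * (?u * g) * weyl_rep r \<one>\<^bsub>weyl r\<^esub> = g"
      using gc uc by (simp add: weyl_rep_one inv_Sp adj_mult_cancel Sp_right_one del: assoc_mult_mat)
    then show ?thesis
      using F[of "?u * g"] P'F[OF gc] big_cell_G0[OF g] G0_torus_char[OF _ d, of g] Sp_mult[OF uc gc] by simp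
  qed
  moreover have "(\<lambda>g. P' g - lead_minor d g) \<in> poly_funs (2 * r)"
  proof -
    have "(\<lambda>g. P' g + (\<lambda>_. - 1) g * lead_minor d g) \<in> poly_funs (2 * r)"
      using d by (intro poly_funs.add P' poly_funs.mul poly_funs.const lead_minor_poly) auto
    then show ?thesis by simp
  qed
  moreover have g: "adj r ?u * x \<in> xty_group r" by (intro xty_group_mult xty_group_adj u x)
  ultimately have "P' (adj r ?u * x) - lead_minor d (adj r ?u * x) = 0"
    using big_cell_dense by blast
  then show ?thesis
    using P'F[OF xty_group_Sp[OF g]] mult_adj_cancel[OF uc xty_group_Sp[OF x]] by simp
qed

lemma gprod_append:
  assumes "set xs \<subseteq> carrier (Sp r)" "set ys \<subseteq> carrier (Sp r)"
  shows "gprod (Sp r) (xs @ ys) = gprod (Sp r) xs * gprod (Sp r) ys"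
  using assms(1)
proof (induction xs)
  case Nil
  then show ?case using gprod_Sp[OF assms(2)] by (simp add: Sp_left_one)
next
  case (Cons x xs)
  then show ?case using Sp_assoc[of x r "gprod (Sp r) xs" "gprod (Sp r) ys"] gprod_Sp assms(2) by simp
qed

section \<open>Signs of the Weyl group representatives\<close>

text \<open>The simple reflection as a permutation of positions: two commuting adjacent
  transpositions for i < r, a single one across the middle for i = r.\<close>

definition swp :: "nat \<Rightarrow> nat \<Rightarrow> nat \<Rightarrow> nat" where
  "swp r i q = (if Suc q \<in> chips r i then Suc q else if q \<in> chips r i then q - 1 else q)"

definition sgp :: "nat \<Rightarrow> nat \<Rightarrow> nat \<Rightarrow> complex" where
  "sgp r i q = (if q \<in> chips r i then - 1 else 1)"

lemma swp_lt: "i \<in> {1..r} \<Longrightarrow> q < 2 * r \<Longrightarrow> swp r i q < 2 * r"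
  using Suc_chips_bounds(1)[of i r q] by (auto simp: swp_def)

lemma swp_swp: "i \<in> {1..r} \<Longrightarrow> swp r i (swp r i q) = q"
  using chips_bounds[of i r q] chips_bounds(3)[of i r "Suc q"] by (cases q) (auto simp: swp_def)

lemma swp_reflect:
  assumes "i \<in> {1..r}" "q < 2 * r"
  shows "swp r i (2 * r - Suc q) = 2 * r - Suc (swp r i q)"
proof -
  have "q \<in> chips r i \<longrightarrow> q > 0 \<and> Suc q \<notin> chips r i" "Suc q \<in> chips r i \<longrightarrow> Suc q < 2 * r"
    using chips_bounds[OF assms(1), of q] Suc_chips_bounds(1)[OF assms(1), of q] by auto
  then show ?thesis
    unfolding swp_def chips_refl_Suc[OF assms] using assms by auto
qed

lemma s_bar_Sp: "i \<in> {1..r} \<Longrightarrow> s_bar r i \<in> carrier (Sp r)"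
  unfolding s_bar_def by (intro Sp_mult xg_Sp yg_Sp)

lemma s_bar_index:
  assumes i: "i \<in> {1..r}" and pq: "p < 2 * r" "q < 2 * r"
  shows "s_bar r i $$ (p, q) = (if p = swp r i q then sgp r i q else 0)"
proof -
  have yx: "(yg r i 1 * xg r i (- 1)) $$ (p, q) = xg r i (- 1) $$ (p, q) +
      (if p \<in> chips r i then 1 * xg r i (- 1) $$ (p - 1, q) else 0)" if "p < 2 * r" for p
    by (rule yg_mult_index[OF i xg_carrier that pq(2)])
  have "s_bar r i = xg r i (- 1) * (yg r i 1 * xg r i (- 1))"
    unfolding s_bar_def by (rule assoc_mult_mat[OF xg_carrier yg_carrier xg_carrier])
  then have "s_bar r i $$ (p, q) = (yg r i 1 * xg r i (- 1)) $$ (p, q) +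
      (if Suc p \<in> chips r i then - 1 * (yg r i 1 * xg r i (- 1)) $$ (Suc p, q) else 0)"
    using xg_mult_index[OF i mult_carrier_mat[OF yg_carrier xg_carrier] pq] by simp
  also have "\<dots> = (if p = swp r i q then sgp r i q else 0)"
  proof -
    have z: "Suc 0 \<in> chips r i \<Longrightarrow> Suc q \<notin> chips r i \<Longrightarrow> 0 < q"
      "q \<in> chips r i \<Longrightarrow> Suc 0 \<notin> chips r i \<Longrightarrow> Suc 0 < q"
      using chips_bounds(1)[OF i, of q] by (cases q; cases "q - 1"; auto)+
    show ?thesis
    using z pq chips_bounds[OF i, of p] Suc_chips_bounds[OF i, of p] chips_bounds(1)[OF i, of q]
      chips_bounds(3)[OF i, of "Suc p"] chips_bounds(3)[OF i, of q]
    by (cases p; cases "p \<in> chips r i"; cases "Suc p \<in> chips r i")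
       (auto simp: yx xg_index[OF i] swp_def sgp_def)
  qed
  finally show ?thesis .
qed

definition signed_perm :: "nat \<Rightarrow> complex mat \<Rightarrow> (nat \<Rightarrow> nat) \<Rightarrow> (nat \<Rightarrow> complex) \<Rightarrow> bool" where
  "signed_perm n A \<pi> \<epsilon> \<longleftrightarrow> A \<in> carrier_mat n n \<and>
     (\<forall>p<n. \<forall>q<n. A $$ (p, q) = (if p = \<pi> q then \<epsilon> q else 0))"

lemma signed_perm_mult_s_bar:
  assumes i: "i \<in> {1..r}" and A: "signed_perm (2 * r) A \<pi> \<epsilon>"
  shows "signed_perm (2 * r) (A * s_bar r i) (\<pi> \<circ> swp r i) (\<lambda>q. sgp r i q * \<epsilon> (swp r i q))"
  unfolding signed_perm_def
proof (intro conjI allI impI)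
  have Ac: "A \<in> carrier_mat (2 * r) (2 * r)" using A by (simp add: signed_perm_def)
  note sc = Sp_carrier_mat[OF s_bar_Sp[OF i]]
  show "A * s_bar r i \<in> carrier_mat (2 * r) (2 * r)" using Ac sc by simp
  fix p q assume pq: "p < 2 * r" "q < 2 * r"
  have "(A * s_bar r i) $$ (p, q) = (\<Sum>s<2*r. A $$ (p, s) * s_bar r i $$ (s, q))"
    by (rule index_mult_mat_sum[OF Ac sc pq])
  also have "\<dots> = (\<Sum>s<2*r. if s = swp r i q then A $$ (p, swp r i q) * sgp r i q else 0)"
    by (rule sum.cong) (auto simp: s_bar_index[OF i _ pq(2)])
  also have "\<dots> = A $$ (p, swp r i q) * sgp r i q" using swp_lt[OF i pq(2)] by simp
  finally show "(A * s_bar r i) $$ (p, q) = (if p = (\<pi> \<circ> swp r i) q then sgp r i q * \<epsilon> (swp r i q) else 0)"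
    using A pq swp_lt[OF i pq(2)] by (auto simp: signed_perm_def)
qed

text \<open>The argument of the next two functions is a reversed word.\<close>

fun wperm :: "nat \<Rightarrow> nat list \<Rightarrow> nat \<Rightarrow> nat" where
  "wperm r [] = id"
| "wperm r (i # is) = wperm r is \<circ> swp r i"

fun wsign :: "nat \<Rightarrow> nat list \<Rightarrow> nat \<Rightarrow> complex" where
  "wsign r [] q = 1"
| "wsign r (i # is) q = sgp r i q * wsign r is (swp r i q)"

lemma s_bar_word_Sp: "set is \<subseteq> {1..r} \<Longrightarrow> gprod (Sp r) (map (s_bar r) is) \<in> carrier (Sp r)"
  by (rule gprod_Sp) (use s_bar_Sp in auto)

lemma signed_perm_word:
  "set is \<subseteq> {1..r} \<Longrightarrow> signed_perm (2 * r) (gprod (Sp r) (map (s_bar r) (rev is))) (wperm r is) (wsign r is)"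
proof (induction "is")
  case (Cons i "is")
  have "gprod (Sp r) (map (s_bar r) (rev is) @ [s_bar r i]) = gprod (Sp r) (map (s_bar r) (rev is)) * s_bar r i"
    using Cons.prems s_bar_Sp by (subst gprod_append) (auto simp: Sp_right_one)
  then show ?case using signed_perm_mult_s_bar[of i r] Cons by (simp add: comp_def)
qed (auto simp: signed_perm_def)

section \<open>Permutations of positions, inversions and length\<close>

lemma swp_inj: "i \<in> {1..r} \<Longrightarrow> inj (swp r i)"
  by (rule inj_on_inverseI[of _ "swp r i"]) (rule swp_swp)

lemma wperm_lt: "set is \<subseteq> {1..r} \<Longrightarrow> q < 2 * r \<Longrightarrow> wperm r is q < 2 * r"
  by (induction "is" arbitrary: q) (auto simp: swp_lt)

lemma wperm_inj: "set is \<subseteq> {1..r} \<Longrightarrow> inj (wperm r is)"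
  by (induction "is") (simp_all add: inj_compose swp_inj)

lemma wperm_reflect: "set is \<subseteq> {1..r} \<Longrightarrow> q < 2 * r \<Longrightarrow> wperm r is (2 * r - Suc q) = 2 * r - Suc (wperm r is q)"
  by (induction "is" arbitrary: q) (auto simp: swp_reflect swp_lt)

text \<open>Counted separately for each position, because the parity at q is the sign that a reduced
  product of the \<open>s_bar\<close> puts into column q.\<close>

definition inversions :: "(nat \<Rightarrow> nat) \<Rightarrow> nat \<Rightarrow> nat" where
  "inversions \<pi> q = card {p. p < q \<and> \<pi> q < \<pi> p}"

text \<open>Twice the length of a signed permutation: every positive root that is made negative is counted
  twice, as two inversions in the symmetric group, or as one inversion and one sign change.\<close>

definition length2 :: "nat \<Rightarrow> (nat \<Rightarrow> nat) \<Rightarrow> nat" where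
  "length2 r \<pi> = (\<Sum>q<2*r. inversions \<pi> q) + card {p. p < r \<and> r \<le> \<pi> p}"

abbreviation adj_swap :: "nat \<Rightarrow> nat \<Rightarrow> nat" where
  "adj_swap c \<equiv> transpose c (Suc c)"

text \<open>Exchanging an ascent makes the two positions trade their counts. In addition the smaller
  value, now on the right, acquires the larger one as a new inversion.\<close>

lemma inversions_adj_swap:
  shows "q \<noteq> c \<Longrightarrow> q \<noteq> Suc c \<Longrightarrow> inversions (\<pi> \<circ> adj_swap c) q = inversions \<pi> q"
    and "\<pi> c < \<pi> (Suc c) \<Longrightarrow> inversions (\<pi> \<circ> adj_swap c) c = inversions \<pi> (Suc c)"
    and "\<pi> c < \<pi> (Suc c) \<Longrightarrow> inversions (\<pi> \<circ> adj_swap c) (Suc c) = Suc (inversions \<pi> c)"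
proof -
  let ?t = "adj_swap c"
  show "inversions (\<pi> \<circ> ?t) q = inversions \<pi> q" if q: "q \<noteq> c" "q \<noteq> Suc c"
  proof -
    have lt: "?t p < q \<longleftrightarrow> p < q" for p using q by (auto simp: transpose_def)
    have "{p. p < q \<and> \<pi> q < \<pi> (?t p)} = ?t ` {p. p < q \<and> \<pi> q < \<pi> p}"
    proof (intro Set.set_eqI iffI)
      fix p assume "p \<in> {p. p < q \<and> \<pi> q < \<pi> (?t p)}"
      then show "p \<in> ?t ` {p. p < q \<and> \<pi> q < \<pi> p}"
        using lt[of p] by (intro image_eqI[of _ _ "?t p"]) auto
    next
      fix p assume "p \<in> ?t ` {p. p < q \<and> \<pi> q < \<pi> p}"
      then obtain x where "p = ?t x" "x < q" "\<pi> q < \<pi> x" by blast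
      then show "p \<in> {p. p < q \<and> \<pi> q < \<pi> (?t p)}" using lt[of x] by simp
    qed
    then show ?thesis using q by (simp add: inversions_def card_image)
  qed
  assume a: "\<pi> c < \<pi> (Suc c)"
  have "{p. p < c \<and> \<pi> (Suc c) < \<pi> (?t p)} = {p. p < Suc c \<and> \<pi> (Suc c) < \<pi> p}"
    using a by (auto simp: transpose_def less_Suc_eq)
  then show "inversions (\<pi> \<circ> ?t) c = inversions \<pi> (Suc c)" by (simp add: inversions_def)
  have "{p. p < Suc c \<and> \<pi> c < \<pi> (?t p)} = insert c {p. p < c \<and> \<pi> c < \<pi> p}"
    using a by (auto simp: transpose_def less_Suc_eq)
  then show "inversions (\<pi> \<circ> ?t) (Suc c) = Suc (inversions \<pi> c)" by (simp add: inversions_def)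
qed

lemma sum_inversions_adj_swap:
  assumes "\<pi> c < \<pi> (Suc c)" "Suc c < n"
  shows "(\<Sum>q<n. inversions (\<pi> \<circ> adj_swap c) q) = Suc (\<Sum>q<n. inversions \<pi> q)"
proof -
  have S: "(\<Sum>q<n. f q) = f c + f (Suc c) + (\<Sum>q\<in>{..<n} - {c, Suc c}. f q)" for f :: "nat \<Rightarrow> nat"
    using assms(2) by (subst sum.subset_diff[of "{c, Suc c}"]) auto
  have "(\<Sum>q\<in>{..<n} - {c, Suc c}. inversions (\<pi> \<circ> adj_swap c) q) = (\<Sum>q\<in>{..<n} - {c, Suc c}. inversions \<pi> q)"
    by (rule sum.cong) (auto simp: inversions_adj_swap(1))
  then show ?thesis
    unfolding S[of "inversions (\<pi> \<circ> adj_swap c)"] S[of "inversions \<pi>"]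
    by (simp add: inversions_adj_swap(2,3)[OF assms(1)])
qed

lemma swp_eq:
  assumes "i \<in> {1..r}"
  shows "i < r \<Longrightarrow> swp r i = adj_swap (i - 1) \<circ> adj_swap (2 * r - Suc i)"
    and "i = r \<Longrightarrow> swp r i = adj_swap (r - 1)"
proof -
  show "swp r i = adj_swap (i - 1) \<circ> adj_swap (2 * r - Suc i)" if "i < r"
  proof -
    define c e where ce: "c = i - 1" "e = 2 * r - Suc i"
    then have chips: "x \<in> chips r i \<longleftrightarrow> x = Suc c \<or> x = Suc e" for x
      using assms that by (auto simp: chips_def)
    have "Suc c < e" using assms that unfolding ce by simp
    then show ?thesis unfolding ce[symmetric] by (auto simp: swp_def chips transpose_def fun_eq_iff)
  qed
  show "swp r i = adj_swap (r - 1)" if "i = r"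
    using assms that by (auto simp: swp_def chips_def transpose_def fun_eq_iff)
qed

text \<open>The hyperoctahedral group, embedded as the permutations of the 2 * r positions that
  commute with the reflection q \<mapsto> 2 * r - 1 - q.\<close>

definition symmetric_perm :: "nat \<Rightarrow> (nat \<Rightarrow> nat) \<Rightarrow> bool" where
  "symmetric_perm r \<pi> \<longleftrightarrow> inj \<pi> \<and> (\<forall>q<2*r. \<pi> q < 2 * r \<and> \<pi> (2 * r - Suc q) = 2 * r - Suc (\<pi> q))"

lemma symmetric_perm_word: "set is \<subseteq> {1..r} \<Longrightarrow> symmetric_perm r (wperm r is)"
  by (simp add: symmetric_perm_def wperm_inj wperm_lt wperm_reflect)

lemma symmetric_perm_swp: "symmetric_perm r \<pi> \<Longrightarrow> i \<in> {1..r} \<Longrightarrow> symmetric_perm r (\<pi> \<circ> swp r i)"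
  unfolding symmetric_perm_def
  by (simp add: swp_lt swp_reflect inj_compose swp_inj)

text \<open>On the positions exchanged by a simple reflection that lengthens the permutation, the numbers of
  inversions change exactly as the signs of the representative do.\<close>

lemma length2_ascent:
  assumes \<pi>: "symmetric_perm r \<pi>" and i: "i \<in> {1..r}" and a: "\<pi> (i - 1) < \<pi> i"
  shows "length2 r (\<pi> \<circ> swp r i) = length2 r \<pi> + 2"
    and "q < 2 * r \<Longrightarrow> inversions (\<pi> \<circ> swp r i) q = inversions \<pi> (swp r i q) + (if q \<in> chips r i then 1 else 0)"
proof -
  have lt: "\<pi> q < 2 * r" "\<pi> (2 * r - Suc q) = 2 * r - Suc (\<pi> q)" if "q < 2 * r" for q
    using \<pi> that by (auto simp: symmetric_perm_def)
  have ii: "Suc (i - 1) = i" "i - 1 < 2 * r" "i < 2 * r" using i by auto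
  have 1: "length2 r (\<pi> \<circ> swp r i) = length2 r \<pi> + 2 \<and>
    (\<forall>q<2*r. inversions (\<pi> \<circ> swp r i) q = inversions \<pi> (swp r i q) + (if q \<in> chips r i then 1 else 0))"
  proof (cases "i < r")
    case True
    let ?c = "i - 1" and ?e = "2 * r - Suc i"
    let ?\<pi>' = "\<pi> \<circ> adj_swap ?c"
    have e: "Suc ?e = 2 * r - i" "?e = 2 * r - Suc i" "Suc ?e < 2 * r" using True i by auto
    have ne: "?e \<noteq> ?c" "?e \<noteq> Suc ?c" "Suc ?e \<noteq> ?c" "Suc ?e \<noteq> Suc ?c" using True i by auto
    \<comment> \<open>The reflection reverses the order both of positions and of values, so the
      ascent at i - 1, i has a mirror image at ?e, ?e + 1.\<close>
    have "\<pi> ?e = 2 * r - Suc (\<pi> i)" "\<pi> (Suc ?e) = 2 * r - Suc (\<pi> ?c)"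
      using lt(2)[of i] lt(2)[of "i - 1"] ii e by simp_all
    then have "\<pi> ?e < \<pi> (Suc ?e)" using a lt(1)[of i] ii by linarith
    then have a': "?\<pi>' ?e < ?\<pi>' (Suc ?e)" using ne by (simp add: transpose_def)
    have a0: "\<pi> ?c < \<pi> (Suc ?c)" using a ii by simp
    have sw: "\<pi> \<circ> swp r i = ?\<pi>' \<circ> adj_swap ?e" by (simp add: swp_eq(1)[OF i True] comp_assoc)
    have "(\<Sum>q<2*r. inversions (\<pi> \<circ> swp r i) q) = Suc (Suc (\<Sum>q<2*r. inversions \<pi> q))"
      unfolding sw sum_inversions_adj_swap[of ?\<pi>', OF a' e(3)] sum_inversions_adj_swap[of \<pi>, OF a0, of "2 * r"]
      using ii sum_inversions_adj_swap[of \<pi>, OF a0, of "2 * r"] by simp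
    \<comment> \<open>For i < r neither transposition crosses the middle, so the number of sign
      changes is preserved and both new units are inversions.\<close>
    moreover have "card {p. p < r \<and> r \<le> (\<pi> \<circ> swp r i) p} = card {p. p < r \<and> r \<le> \<pi> p}"
    proof -
      have swr: "swp r i p < r \<longleftrightarrow> p < r" for p
        unfolding swp_def chips_def using True i by auto
      have "{p. p < r \<and> r \<le> (\<pi> \<circ> swp r i) p} = swp r i ` {p. p < r \<and> r \<le> \<pi> p}"
      proof (intro Set.set_eqI iffI)
        fix p assume "p \<in> {p. p < r \<and> r \<le> (\<pi> \<circ> swp r i) p}"
        then show "p \<in> swp r i ` {p. p < r \<and> r \<le> \<pi> p}"
          using swr[of p] swp_swp[OF i, of p] by (intro image_eqI[of _ _ "swp r i p"]) auto
      next
        fix p assume "p \<in> swp r i ` {p. p < r \<and> r \<le> \<pi> p}"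
        then obtain x where "p = swp r i x" "x < r" "r \<le> \<pi> x" by blast
        then show "p \<in> {p. p < r \<and> r \<le> (\<pi> \<circ> swp r i) p}" using swr[of x] swp_swp[OF i, of x] by simp
      qed
      then show ?thesis by (simp only: card_image[OF inj_on_subset[OF swp_inj[OF i] subset_UNIV]])
    qed
    moreover have "inversions (\<pi> \<circ> swp r i) q = inversions \<pi> (swp r i q) + (if q \<in> chips r i then 1 else 0)" for q
    proof -
      have chips: "x \<in> chips r i \<longleftrightarrow> x = Suc ?c \<or> x = Suc ?e" for x
        using e(1) ii(1) by (simp add: chips_def)
      have I1: "inversions ?\<pi>' q = (if q = ?c then inversions \<pi> (Suc ?c) else if q = Suc ?c then
          Suc (inversions \<pi> ?c) else inversions \<pi> q)" for q
        using inversions_adj_swap(1)[of q ?c \<pi>] inversions_adj_swap(2,3)[of \<pi> ?c] a0 by auto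
      have "inversions (?\<pi>' \<circ> adj_swap ?e) q = (if q = ?e then inversions ?\<pi>' (Suc ?e) else if q = Suc ?e then
          Suc (inversions ?\<pi>' ?e) else inversions ?\<pi>' q)"
        using inversions_adj_swap(1)[of q ?e ?\<pi>'] inversions_adj_swap(2,3)[of ?\<pi>' ?e] a' by auto
      then show ?thesis
        unfolding sw I1 swp_def chips using ne by auto
    qed
    ultimately show ?thesis by (simp add: length2_def)
  next
    case False
    then have ir: "i = r" using i by simp
    have sw: "\<pi> \<circ> swp r i = \<pi> \<circ> adj_swap (r - 1)" unfolding swp_eq(2)[OF i ir] ..
    have a0: "\<pi> (r - 1) < \<pi> (Suc (r - 1))" using a ii ir by simp
    have chips: "x \<in> chips r i \<longleftrightarrow> x = Suc (r - 1)" for x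
      using ir i by (simp add: chips_def)
    have r1: "Suc (r - 1) = r" using i by simp
    have r2: "r - 1 < 2 * r" using i by auto
    \<comment> \<open>Positions r - 1 and r mirror each other, so an ascent between them means that
      the image of r - 1 is plain. The swap makes it barred; this sign change is the second unit of
      \<open>length2\<close>.\<close>
    have "\<pi> r = 2 * r - Suc (\<pi> (r - 1))" using lt(2)[OF r2] r1 by (simp add: mult_2)
    then have half: "\<pi> (r - 1) < r" "r \<le> \<pi> r" using a ir lt(1)[of "r - 1"] i by auto
    have "{p. p < r \<and> r \<le> (\<pi> \<circ> adj_swap (r - 1)) p} = insert (r - 1) {p. p < r \<and> r \<le> \<pi> p}"
      using half r1 by (auto simp: transpose_def)
    then have "card {p. p < r \<and> r \<le> (\<pi> \<circ> adj_swap (r - 1)) p} = Suc (card {p. p < r \<and> r \<le> \<pi> p})"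
      using half by simp
    moreover have "(\<Sum>q<2*r. inversions (\<pi> \<circ> adj_swap (r - 1)) q) = Suc (\<Sum>q<2*r. inversions \<pi> q)"
      by (rule sum_inversions_adj_swap[OF a0]) (use i in auto)
    moreover have "inversions (\<pi> \<circ> adj_swap (r - 1)) q =
        inversions \<pi> (swp r i q) + (if q \<in> chips r i then 1 else 0)" for q
      unfolding swp_def chips using inversions_adj_swap(1)[of q "r - 1" \<pi>] inversions_adj_swap(2,3)[of \<pi> "r - 1"] a0 by auto
    ultimately show ?thesis unfolding length2_def sw by (simp only: r1) simp
  qed
  then show "length2 r (\<pi> \<circ> swp r i) = length2 r \<pi> + 2"
    "q < 2 * r \<Longrightarrow> inversions (\<pi> \<circ> swp r i) q = inversions \<pi> (swp r i q) + (if q \<in> chips r i then 1 else 0)"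
    by auto
qed

text \<open>After the swap the descent is an ascent, and swapping again restores the
  permutation.\<close>

lemma length2_descent:
  assumes \<pi>: "symmetric_perm r \<pi>" and i: "i \<in> {1..r}" and a: "\<not> \<pi> (i - 1) < \<pi> i"
  shows "length2 r (\<pi> \<circ> swp r i) + 2 = length2 r \<pi>"
proof -
  have sw: "swp r i (i - 1) = i" "swp r i i = i - 1"
    using i chips_bounds(3)[OF i, of i] by (auto simp: swp_def chips_def)
  have "\<pi> (i - 1) \<noteq> \<pi> i" using \<pi> i by (auto simp: symmetric_perm_def dest: injD)
  then have "(\<pi> \<circ> swp r i) (i - 1) < (\<pi> \<circ> swp r i) i" using a sw by simp
  moreover have "\<pi> \<circ> swp r i \<circ> swp r i = \<pi>" using swp_swp[OF i] by (auto simp: fun_eq_iff)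
  ultimately show ?thesis using length2_ascent(1)[OF symmetric_perm_swp[OF \<pi> i] i] by simp
qed

text \<open>Every letter changes \<open>length2\<close> by exactly 2, upwards at an ascent and
  downwards at a descent. Equality therefore forces all letters to be ascents, and at an ascent
  signs and inversions change together.\<close>

lemma wsign_reduced:
  assumes "set is \<subseteq> {1..r}"
  shows "length2 r (wperm r is) \<le> 2 * length is"
    and "length2 r (wperm r is) = 2 * length is \<Longrightarrow> q < 2 * r \<Longrightarrow> wsign r is q = (- 1) ^ inversions (wperm r is) q"
proof -
  have "length2 r (wperm r is) \<le> 2 * length is \<and> (length2 r (wperm r is) = 2 * length is \<longrightarrow>
    (\<forall>q<2*r. wsign r is q = (- 1) ^ inversions (wperm r is) q))"
    using assms
  proof (induction "is")
    case Nil
    have "inversions id q = 0" "inversions (\<lambda>a. a) q = 0" for q by (auto simp: inversions_def)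
    then show ?case by (auto simp: length2_def)
  next
    case (Cons i "is")
    then have i: "i \<in> {1..r}" and "is": "set is \<subseteq> {1..r}" by auto
    note \<pi> = symmetric_perm_word[OF "is"]
    note IH = Cons.IH[OF "is"]
    show ?case
    proof (cases "wperm r is (i - 1) < wperm r is i")
      case True
      note asc = length2_ascent[OF \<pi> i True]
      have "wsign r (i # is) q = (- 1) ^ inversions (wperm r (i # is)) q"
        if "length2 r (wperm r is) = 2 * length is" "q < 2 * r" for q
        using IH that swp_lt[OF i that(2)] asc(2)[OF that(2)] by (simp add: sgp_def)
      then show ?thesis using asc(1) IH by (simp add: comp_def)
    next
      case False
      then show ?thesis using length2_descent[OF \<pi> i False] IH by (simp add: comp_def)
    qed
  qed
  then show "length2 r (wperm r is) \<le> 2 * length is"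
    "length2 r (wperm r is) = 2 * length is \<Longrightarrow> q < 2 * r \<Longrightarrow> wsign r is q = (- 1) ^ inversions (wperm r is) q"
    by auto
qed

section \<open>Torus cosets and independence of the reduced word\<close>

lemma s_bar_conj_torus:
  assumes i: "i \<in> {1..r}" and h: "h \<in> torus r"
  shows "s_bar r i * h * adj r (s_bar r i) \<in> torus r"
proof -
  note S = s_bar_Sp[OF i] and T = torus_Sp[OF h]
  note sc = Sp_carrier_mat[OF S] and hc = Sp_carrier_mat[OF T] and hd = torus_diagonal[OF h]
  define D where "D = mat (2 * r) (2 * r) (\<lambda>(p, q). if p = q then h $$ (swp r i p, swp r i p) else 0)"
  have Dc: "D \<in> carrier_mat (2 * r) (2 * r)" and Dd: "diagonal_mat D" by (auto simp: D_def diagonal_mat_def)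
  have "s_bar r i * h = D * s_bar r i"
  proof (rule eq_matI)
    fix p q assume "p < dim_row (D * s_bar r i)" "q < dim_col (D * s_bar r i)"
    then have pq: "p < 2 * r" "q < 2 * r" using Dc sc by auto
    show "(s_bar r i * h) $$ (p, q) = (D * s_bar r i) $$ (p, q)"
      unfolding mult_diagonal_index[OF hc hd sc pq] diagonal_mult_index[OF Dc Dd sc pq] s_bar_index[OF i pq]
      using pq swp_swp[OF i, of q] by (simp add: D_def)
  qed (use Dc sc hc in auto)
  then have "s_bar r i * h * adj r (s_bar r i) = D * (s_bar r i * adj r (s_bar r i))"
    using assoc_mult_mat[OF Dc sc adj_carrier] by simp
  also have "\<dots> = D" unfolding mult_adj_self[OF S] by (rule right_mult_one_mat[OF Dc])
  finally have e: "s_bar r i * h * adj r (s_bar r i) = D" .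
  have "s_bar r i * h * adj r (s_bar r i) \<in> carrier (Sp r)" by (intro Sp_mult adj_Sp S T)
  then show ?thesis using Dd unfolding torus_def e by simp
qed

text \<open>The torus is normalized by each \<open>s_bar\<close>, so torus factors between the
  letters can be collected on the left.\<close>

lemma weyl_word_coset:
  "set js \<subseteq> {1..r} \<Longrightarrow> weyl_word r js = torus r #>\<^bsub>Sp r\<^esub> gprod (Sp r) (map (s_bar r) js)"
proof (induction js)
  case Nil
  have "h * 1\<^sub>m (2 * r) = h" if "h \<in> torus r" for h using Sp_right_one[OF torus_Sp[OF that]] .
  then show ?case by (auto simp: weyl_word_def gprod_def weyl_def r_coset_def)
next
  case (Cons j js)
  let ?W = "gprod (Sp r) (map (s_bar r) js)"
  have j: "j \<in> {1..r}" and js: "set js \<subseteq> {1..r}" using Cons.prems by auto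
  note S = s_bar_Sp[OF j] and W = s_bar_word_Sp[OF js]
  have "weyl_word r (j # js) = simple_refl r j \<otimes>\<^bsub>weyl r\<^esub> weyl_word r js"
    by (simp add: weyl_word_def gprod_def)
  also have "\<dots> = {(h * s_bar r j) * (h' * ?W) |h h'. h \<in> torus r \<and> h' \<in> torus r}"
    unfolding Cons.IH[OF js] simple_refl_def weyl_def by (auto simp: set_mult_def r_coset_def)
  also have "\<dots> = torus r #>\<^bsub>Sp r\<^esub> (s_bar r j * ?W)"
  proof (intro equalityI subsetI)
    fix x assume "x \<in> {(h * s_bar r j) * (h' * ?W) |h h'. h \<in> torus r \<and> h' \<in> torus r}"
    then obtain h h' where h: "h \<in> torus r" "h' \<in> torus r" and x: "x = (h * s_bar r j) * (h' * ?W)" by blast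
    have "x = (h * (s_bar r j * h' * adj r (s_bar r j))) * (s_bar r j * ?W)"
      unfolding x using S W torus_Sp[OF h(1)] torus_Sp[OF h(2)]
      by (simp add: Sp_assoc[where r = r] Sp_closed adj_mult_cancel del: assoc_mult_mat)
    then show "x \<in> torus r #>\<^bsub>Sp r\<^esub> (s_bar r j * ?W)"
      using torus_mult[OF h(1) s_bar_conj_torus[OF j h(2)]] by (auto simp: r_coset_def)
  next
    fix x assume "x \<in> torus r #>\<^bsub>Sp r\<^esub> (s_bar r j * ?W)"
    then obtain h where h: "h \<in> torus r" and x: "x = h * (s_bar r j * ?W)" by (auto simp: r_coset_def)
    have "x = (h * s_bar r j) * (1\<^sub>m (2 * r) * ?W)"
      unfolding x Sp_left_one[OF W] using Sp_assoc[OF torus_Sp[OF h] S W] by simp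
    then show "x \<in> {(h * s_bar r j) * (h' * ?W) |h h'. h \<in> torus r \<and> h' \<in> torus r}"
      using h torus_one by blast
  qed
  finally show ?case by simp
qed

text \<open>The signs of the representative given by a reduced word are determined by the permutation.\<close>

lemma s_bar_word_unique:
  assumes js: "set js \<subseteq> {1..r}" and js': "set js' \<subseteq> {1..r}"
    and eq: "weyl_word r js' = weyl_word r js" and len: "length js' \<le> length js"
    and red: "length2 r (wperm r (rev js)) = 2 * length js"
  shows "gprod (Sp r) (map (s_bar r) js') = gprod (Sp r) (map (s_bar r) js)"
proof -
  let ?W = "gprod (Sp r) (map (s_bar r) js)" and ?W' = "gprod (Sp r) (map (s_bar r) js')"
  let ?\<pi> = "wperm r (rev js)" and ?\<pi>' = "wperm r (rev js')"
  have sp: "signed_perm (2 * r) ?W ?\<pi> (wsign r (rev js))" "signed_perm (2 * r) ?W' ?\<pi>' (wsign r (rev js'))"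
    using signed_perm_word[of "rev js" r] signed_perm_word[of "rev js'" r] js js' by simp_all
  note W = s_bar_word_Sp[OF js] and W' = s_bar_word_Sp[OF js']
  have "?W' = 1\<^sub>m (2 * r) * ?W'" by (simp add: Sp_left_one[OF W'])
  then have "?W' \<in> torus r #>\<^bsub>Sp r\<^esub> ?W'" using torus_one by (auto simp: r_coset_def)
  then have "?W' \<in> torus r #>\<^bsub>Sp r\<^esub> ?W"
    using eq weyl_word_coset[OF js] weyl_word_coset[OF js'] by simp
  then obtain h where h: "h \<in> torus r" and hW: "?W' = h * ?W" by (auto simp: r_coset_def)
  \<comment> \<open>Multiplication by an invertible diagonal matrix preserves the pattern of nonzero
    entries, and this pattern is the permutation.\<close>
  have \<pi>: "?\<pi>' q = ?\<pi> q" if q: "q < 2 * r" for q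
  proof -
    have lt: "?\<pi> q < 2 * r" by (rule wperm_lt) (use js q in auto)
    have "?W' $$ (?\<pi> q, q) = h $$ (?\<pi> q, ?\<pi> q) * ?W $$ (?\<pi> q, q)"
      unfolding hW by (rule diagonal_mult_index[OF Sp_carrier_mat[OF torus_Sp[OF h]] torus_diagonal[OF h]
        Sp_carrier_mat[OF W] lt q])
    moreover have "?W $$ (?\<pi> q, q) \<noteq> 0"
    proof -
      have "wsign r is q \<noteq> 0" for "is" q by (induction "is" arbitrary: q) (auto simp: sgp_def)
      then show ?thesis using sp(1) lt q by (simp add: signed_perm_def)
    qed
    ultimately have "?W' $$ (?\<pi> q, q) \<noteq> 0" using torus_nonzero[OF h lt] by simp
    then show ?thesis using sp(2) lt q by (auto simp: signed_perm_def split: if_splits)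
  qed
  have inv: "inversions ?\<pi>' q = inversions ?\<pi> q" if "q < 2 * r" for q
    unfolding inversions_def by (rule arg_cong[of _ _ card]) (use \<pi> that in auto)
  have "length2 r ?\<pi>' = length2 r ?\<pi>"
  proof -
    have "{p. p < r \<and> r \<le> ?\<pi>' p} = {p. p < r \<and> r \<le> ?\<pi> p}" using \<pi> by auto
    then show ?thesis using inv by (simp add: length2_def)
  qed
  \<comment> \<open>The chain 2 * length js = length2 \<le> 2 * length js' \<le> 2 * length js
    collapses, so \<open>js'\<close> satisfies the sign rule for reduced words as well.\<close>
  then have red': "length2 r ?\<pi>' = 2 * length (rev js')"
    using wsign_reduced(1)[of "rev js'" r] js' red len by simp
  have "wsign r (rev js') q = wsign r (rev js) q" if "q < 2 * r" for q
    using wsign_reduced(2)[of "rev js'" r, OF _ red' that] wsign_reduced(2)[of "rev js" r q] js js' red inv[OF that] that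
    by simp
  then show ?thesis
    using sp \<pi> by (intro eq_matI) (auto simp: signed_perm_def)
qed

section \<open>The word as a power of a Coxeter element\<close>

lemma upt_block:
  assumes "e \<le> r"
  shows "map (Pair (Suc l)) [1..<Suc e] = map (\<lambda>j. (Suc (j div r), Suc (j mod r))) [l * r..<l * r + e]"
proof (rule nth_equalityI)
  fix i assume "i < length (map (Pair (Suc l)) [1..<Suc e])"
  then have i: "i < e" by (simp del: upt_Suc)
  then have "(l * r + i) div r = l" "(l * r + i) mod r = i" using assms by auto
  then show "map (Pair (Suc l)) [1..<Suc e] ! i = map (\<lambda>j. (Suc (j div r), Suc (j mod r))) [l * r..<l * r + e] ! i"
    using i by (simp del: upt_Suc)
qed simp

text \<open>Quotient and remainder describe cycle and letter at once; in this form every prefix of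
  the word is again a \<open>coxeter_word\<close>.\<close>

lemma cycle_letters_eq:
  assumes "1 \<le> m" "d \<le> r"
  shows "cycle_letters r m d = map (\<lambda>j. (Suc (j div r), Suc (j mod r))) [0..<(m - 1) * r + d]"
proof -
  have full: "concat (map (\<lambda>l. map (Pair l) [1..<Suc r]) [1..<Suc a]) =
      map (\<lambda>j. (Suc (j div r), Suc (j mod r))) [0..<a * r]" for a
  proof (induction a)
    case (Suc a)
    have "[0..<Suc a * r] = [0..<a * r] @ [a * r..<a * r + r]"
      using upt_add_eq_append[of 0 "a * r" r] by (simp add: add.commute)
    then show ?case using Suc upt_block[of r r a] by simp
  qed simp
  obtain a where a: "m = Suc a" using assms(1) by (cases m) auto
  have "[0..<a * r + d] = [0..<a * r] @ [a * r..<a * r + d]"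
    using upt_add_eq_append[of 0 "a * r" d] by simp
  then show ?thesis using full[of a] upt_block[OF assms(2), of a] by (simp add: cycle_letters_def a)
qed

lemma word_eq:
  assumes "1 \<le> m" "d \<le> r"
  shows "word r m d = map (\<lambda>j. Suc (j mod r)) [0..<(m - 1) * r + d]"
  by (simp add: word_def cycle_letters_eq[OF assms])

abbreviation coxeter_word :: "nat \<Rightarrow> nat \<Rightarrow> nat list" where
  "coxeter_word r k \<equiv> map (\<lambda>j. Suc (j mod r)) [0..<k]"

lemma coxeter_word_letters: "0 < r \<Longrightarrow> set (coxeter_word r k) \<subseteq> {1..r}"
  by (auto simp: Suc_le_eq)

text \<open>The image of the plain position \<open>q\<close> under the \<open>a\<close>-th power of the Coxeter element is
  \<open>cox_pos r (a + q)\<close>.\<close>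

definition cox_pos :: "nat \<Rightarrow> nat \<Rightarrow> nat" where
  "cox_pos r s = (if s < r then s else 3 * r - Suc s)"

text \<open>Length and permutation need a joint induction, because the permutation shows that the
  next letter is an ascent. Within a cycle the image of position 0 is carried to the right:
  positions it has passed already show the next power of the Coxeter element, those ahead of it the
  current power. The bound r * r is the length of the longest element.\<close>

lemma wperm_coxeter_word:
  assumes "0 < r" "k \<le> r * r"
  shows "length2 r (wperm r (rev (coxeter_word r k))) = 2 * k"
    and "q < r \<Longrightarrow> wperm r (rev (coxeter_word r k)) q =
      (if q < k mod r then cox_pos r (k div r + Suc q) else if q = k mod r then cox_pos r (k div r)
       else cox_pos r (k div r + q))"
proof -
  have "length2 r (wperm r (rev (coxeter_word r k))) = 2 * k \<and>
    (\<forall>q<r. wperm r (rev (coxeter_word r k)) q =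
      (if q < k mod r then cox_pos r (k div r + Suc q) else if q = k mod r then cox_pos r (k div r)
       else cox_pos r (k div r + q)))"
    using assms(2)
  proof (induction k)
    case 0
    have "inversions id q = 0" "inversions (\<lambda>a. a) q = 0" for q by (auto simp: inversions_def)
    then show ?case by (auto simp: length2_def cox_pos_def)
  next
    case (Suc k)
    define j where "j = k mod r"
    define a where "a = k div r"
    let ?P = "wperm r (rev (coxeter_word r k))"
    have j: "j < r" using assms(1) by (simp add: j_def)
    have a: "a < r" using Suc.prems assms(1) by (simp add: a_def less_mult_imp_div_less)
    have i: "Suc j \<in> {1..r}" using j by simp
    have sym: "symmetric_perm r ?P"
      by (rule symmetric_perm_word) (use coxeter_word_letters[OF assms(1)] in auto)
    have P: "?P q = (if q < j then cox_pos r (a + Suc q) else if q = j then a else cox_pos r (a + q))" if "q < r" for q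
      using Suc that a by (simp add: j_def a_def cox_pos_def)
    \<comment> \<open>Letter r swaps across the middle. The value it brings in from position r is
      the mirror image of the value a being carried.\<close>
    have Pr: "?P r = 2 * r - Suc a" if "Suc j = r"
    proof -
      have "\<forall>q<2*r. ?P (2 * r - Suc q) = 2 * r - Suc (?P q)" using sym unfolding symmetric_perm_def by blast
      moreover have "2 * r - Suc (r - 1) = r" "r - 1 < 2 * r" using assms(1) by auto
      ultimately have "?P r = 2 * r - Suc (?P (r - 1))" by metis
      then show ?thesis using P[of "r - 1"] that by auto
    qed
    have asc: "?P (Suc j - 1) < ?P (Suc j)"
    proof (cases "Suc j = r")
      case True
      have "?P (Suc j) = 2 * r - Suc a" using Pr[OF True] by (simp only: True)
      moreover have "?P (Suc j - 1) = a" using P[OF j] by simp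
      moreover have "a < 2 * r - Suc a" using a by simp
      ultimately show ?thesis by (simp only:)
    next
      case False
      then have "Suc j < r" using j by simp
      then show ?thesis using P[of j] P[of "Suc j"] a by (auto simp: cox_pos_def)
    qed
    have W: "wperm r (rev (coxeter_word r (Suc k))) = ?P \<circ> swp r (Suc j)"
      by (simp add: j_def)
    have sw: "swp r (Suc j) q = (if q = j then Suc j else if q = Suc j then j else q)" if "q < r" for q
      using that j by (auto simp: swp_def chips_def)
    have "length2 r (wperm r (rev (coxeter_word r (Suc k)))) = 2 * Suc k"
      unfolding W length2_ascent(1)[OF sym i asc] using Suc by simp
    moreover have "wperm r (rev (coxeter_word r (Suc k))) q =
      (if q < Suc k mod r then cox_pos r (Suc k div r + Suc q) else if q = Suc k mod r then cox_pos r (Suc k div r)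
       else cox_pos r (Suc k div r + q))" if q: "q < r" for q
    proof (cases "Suc j = r")
      case True
      then have "Suc k mod r = 0" "Suc k div r = Suc a"
        by (simp_all add: mod_Suc div_Suc j_def a_def)
      then show ?thesis unfolding W comp_def sw[OF q] using P Pr[OF True] q True a by (auto simp: cox_pos_def)
    next
      case False
      then have "Suc k mod r = Suc j" "Suc k div r = a"
        by (simp_all add: mod_Suc div_Suc j_def a_def)
      then show ?thesis unfolding W comp_def sw[OF q] using P q False j a by (auto simp: cox_pos_def)
    qed
    ultimately show ?case by blast
  qed
  then show "length2 r (wperm r (rev (coxeter_word r k))) = 2 * k"
    "q < r \<Longrightarrow> wperm r (rev (coxeter_word r k)) q =
      (if q < k mod r then cox_pos r (k div r + Suc q) else if q = k mod r then cox_pos r (k div r)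
       else cox_pos r (k div r + q))"
    by blast+
qed

lemma wperm_coxeter_word_prefix:
  assumes "a < r" "1 \<le> d" "d \<le> r" "q < d"
  shows "wperm r (rev (coxeter_word r (a * r + d))) q = cox_pos r (Suc a + q)"
proof -
  have "a * r + d \<le> a * r + r" using assms by simp
  also have "\<dots> \<le> r * r" using mult_le_mono1[of "Suc a" r r] assms(1) by simp
  finally have k: "a * r + d \<le> r * r" .
  have r: "0 < r" using assms by simp
  note P = wperm_coxeter_word(2)[OF r k, of q]
  show ?thesis
  proof (cases "d = r")
    case True
    then have "(a * r + d) mod r = 0" "(a * r + d) div r = Suc a" using r by simp_all
    then show ?thesis using P assms True by auto
  next
    case False
    then have "(a * r + d) mod r = d" "(a * r + d) div r = a" using assms by simp_all
    then show ?thesis using P assms by simp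
  qed
qed

text \<open>The images increase while they are plain, from r - Suc a on they are barred and
  decrease. So position q is inverted with exactly the earlier positions that have barred
  images.\<close>

lemma inversions_coxeter_word_prefix:
  assumes "a < r" "1 \<le> d" "d \<le> r" "q < d"
  shows "inversions (wperm r (rev (coxeter_word r (a * r + d)))) q = q - (r - Suc a)"
proof -
  have "{p. p < q \<and> cox_pos r (Suc a + q) < cox_pos r (Suc a + p)} = {r - Suc a..<q}"
    using assms by (auto simp: cox_pos_def)
  moreover have "{p. p < q \<and> wperm r (rev (coxeter_word r (a * r + d))) q < wperm r (rev (coxeter_word r (a * r + d))) p} =
      {p. p < q \<and> cox_pos r (Suc a + q) < cox_pos r (Suc a + p)}"
    using wperm_coxeter_word_prefix[OF assms(1-3)] assms(4) by auto
  ultimately show ?thesis by (simp add: inversions_def)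
qed

text \<open>The inverse of a signed permutation matrix is its transpose, so multiplication by it
  selects rows and attaches signs.\<close>

lemma adj_signed_perm_mult:
  assumes A: "signed_perm (2 * r) A \<pi> \<epsilon>" "A \<in> carrier (Sp r)"
    and \<pi>: "inj \<pi>" "\<And>q. q < 2 * r \<Longrightarrow> \<pi> q < 2 * r" and \<epsilon>: "\<And>q. q < 2 * r \<Longrightarrow> \<epsilon> q * \<epsilon> q = 1"
    and x: "x \<in> carrier_mat (2 * r) n" and pq: "p < 2 * r" "q < n"
  shows "(adj r A * x) $$ (p, q) = \<epsilon> p * x $$ (\<pi> p, q)"
proof -
  have Ac: "A \<in> carrier_mat (2 * r) (2 * r)" and Ai: "A $$ (s, q) = (if s = \<pi> q then \<epsilon> q else 0)"
    if "s < 2 * r" "q < 2 * r" for s q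
    using A that by (auto simp: signed_perm_def)
  have Ac: "A \<in> carrier_mat (2 * r) (2 * r)" using A by (simp add: signed_perm_def)
  let ?T = "transpose_mat A"
  have Tc: "?T \<in> carrier_mat (2 * r) (2 * r)" using Ac by simp
  have T: "(?T * y) $$ (p, q) = \<epsilon> p * y $$ (\<pi> p, q)"
    if y: "y \<in> carrier_mat (2 * r) k" "p < 2 * r" "q < k" for y k p q
  proof -
    have "(?T * y) $$ (p, q) = (\<Sum>s<2*r. ?T $$ (p, s) * y $$ (s, q))"
      by (rule index_mult_mat_sum[OF Tc y(1) y(2,3)])
    also have "\<dots> = (\<Sum>s<2*r. if s = \<pi> p then \<epsilon> p * y $$ (\<pi> p, q) else 0)"
      by (rule sum.cong) (use Ac Ai y(2) in auto)
    finally show ?thesis using \<pi>(2)[OF y(2)] by simp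
  qed
  have "?T * A = 1\<^sub>m (2 * r)"
  proof (rule eq_matI)
    fix p q assume "p < dim_row (1\<^sub>m (2 * r) :: complex mat)" "q < dim_col (1\<^sub>m (2 * r) :: complex mat)"
    then have pq: "p < 2 * r" "q < 2 * r" by auto
    show "(?T * A) $$ (p, q) = 1\<^sub>m (2 * r) $$ (p, q)"
      unfolding T[OF Ac pq] using pq Ai[OF \<pi>(2)[OF pq(1)] pq(2)] \<epsilon>[OF pq(1)] \<pi>(1) by (auto dest: injD)
  qed (use Ac in auto)
  then have "?T = ?T * (A * adj r A)" "?T * (A * adj r A) = adj r A"
    using assoc_mult_mat[OF Tc Ac adj_carrier[of r A]] mult_adj_self[OF A(2)] Tc left_mult_one_mat[OF adj_carrier[of r A]]
    by (simp_all del: assoc_mult_mat)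
  then have "adj r A = ?T" by simp
  then show ?thesis using T[OF x pq] by simp
qed

section \<open>Rows of the matrix and lattice paths\<close>

definition cycle_mat :: "nat \<Rightarrow> (nat \<Rightarrow> complex) \<Rightarrow> complex mat" where
  "cycle_mat r y = gprod (Sp r) (map (\<lambda>i. xneg r i (y i)) [1..<Suc r])"

text \<open>The invariant describes the rows after the factors \<open>x\<^sub>-\<^sub>r, \<dots>, x\<^sub>-\<^sub>j\<close> have been applied; \<open>H\<close> is
  the unnormalized barred row.\<close>

lemma cycle_mat_rows_aux:
  assumes A: "A \<in> carrier_mat (2 * r) n" and c: "c < n" and y: "\<And>i. i \<in> {1..r} \<Longrightarrow> y i \<noteq> 0" and r: "0 < r"
  defines "H \<equiv> \<lambda>k. A $$ (r - 1, c) + (\<Sum>k'=k..r. y k' * A $$ (2 * r - k', c))"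
  assumes j: "1 \<le> j" "j \<le> Suc r" and p: "p < 2 * r"
  shows "(gprod (Sp r) (map (\<lambda>i. xneg r i (y i)) [j..<Suc r]) * A) $$ (p, c) =
    (if p < r then
       if Suc p < j then A $$ (p, c) else if Suc p = j then A $$ (p, c) / y j
       else y p / y (Suc p) * A $$ (p, c) + A $$ (p - 1, c)
     else if 2 * r - p < j then A $$ (p, c) else if 2 * r - p = j then H j
     else H (2 * r - p) / y (2 * r - p - 1))"
  using j(2,1) p
proof (induction j arbitrary: p rule: inc_induct)
  case base
  then show ?case using A by (auto simp: left_mult_one_mat[OF A])
next
  case (step j)
  let ?G = "\<lambda>j. gprod (Sp r) (map (\<lambda>i. xneg r i (y i)) [j..<Suc r])"
  have jr: "j \<in> {1..r}" using step by auto
  have G: "?G (Suc j) \<in> carrier (Sp r)"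
    by (rule gprod_Sp) (use step.hyps y in \<open>auto intro!: xneg_Sp\<close>)
  have "?G j = xneg r j (y j) * ?G (Suc j)"
    using upt_conv_Cons[of j "Suc r"] step.hyps by simp
  then have "?G j * A = xneg r j (y j) * (?G (Suc j) * A)"
    using assoc_mult_mat[OF xneg_carrier Sp_carrier_mat[OF G] A] by simp
  then have E: "(?G j * A) $$ (p, c) = (if p \<in> chips r j then y j * (?G (Suc j) * A) $$ (p, c) + (?G (Suc j) * A) $$ (p - 1, c)
     else if Suc p \<in> chips r j then (?G (Suc j) * A) $$ (p, c) / y j else (?G (Suc j) * A) $$ (p, c))"
    using xneg_mult_index[OF jr mult_carrier_mat[OF Sp_carrier_mat[OF G] A] step.prems(2) c y[OF jr]] by simp
  note IH = step.IH[OF le_SucI[OF step.prems(1)]]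
  have Hj: "H j = y j * A $$ (2 * r - j, c) + H (Suc j)"
    using jr by (simp add: H_def sum.atLeast_Suc_atMost)
  have Hr: "H (Suc r) = A $$ (r - 1, c)" by (simp add: H_def)
  have y0: "y j \<noteq> 0" by (rule y[OF jr])
  show ?case
  proof (cases "p < r")
    case True
    have "p \<in> chips r j \<longleftrightarrow> p = j" "Suc p \<in> chips r j \<longleftrightarrow> Suc p = j"
      using True jr by (auto simp: chips_def)
    then show ?thesis
      unfolding E using IH[of p] IH[of "p - 1"] True step.prems jr by auto
  next
    case False
    define k where "k = 2 * r - p"
    have k: "p = 2 * r - k" "1 \<le> k" "k \<le> r" using False step.prems by (auto simp: k_def)
    have ch: "p \<in> chips r j \<longleftrightarrow> k = j" "Suc p \<in> chips r j \<longleftrightarrow> k = Suc j"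
      using k jr by (auto simp: chips_def)
    have IHp: "(?G (Suc j) * A) $$ (p, c) =
      (if k < Suc j then A $$ (p, c) else if k = Suc j then H (Suc j) else H k / y (k - 1))"
      using IH[of p] False step.prems unfolding k_def by simp
    show ?thesis
    proof (cases "k = j")
      case True
      \<comment> \<open>The row that is added is the neighbouring barred row, which has already
        collected \<open>H (Suc j)\<close>. For letter r it is instead the plain row r - 1, not yet
        altered, and \<open>H (Suc r)\<close> has this value.\<close>
      have "(?G (Suc j) * A) $$ (p - 1, c) = H (Suc j)"
      proof (cases "j = r")
        case True2: True
        then have "p - 1 = r - 1" "r - 1 < r" using k True r by auto
        then show ?thesis using IH[of "r - 1"] True2 Hr r by simp
      next
        case False2: False
        then have "p - 1 = 2 * r - Suc j" "\<not> p - 1 < r" "2 * r - (p - 1) = Suc j" "p - 1 < 2 * r"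
          using k True jr by auto
        then show ?thesis using IH[of "p - 1"] by simp
      qed
      then show ?thesis unfolding E ch using True IHp False k Hj by (simp add: k_def[symmetric])
    next
      case ne: False
      then show ?thesis unfolding E ch IHp using False k jr
        by (auto simp: k_def[symmetric])
    qed
  qed
qed

lemma Yconv_nonzero:
  "(\<And>i. i \<in> {1..r} \<Longrightarrow> Y l i \<noteq> 0) \<Longrightarrow> k \<le> Suc r \<Longrightarrow> Yconv r Y l k \<noteq> 0"
  by (auto simp: Yconv_def)

text \<open>A barred row receives contributions from all barred rows before it. Expressing it
  through the already transformed row p - 1 replaces this long sum by a two-term recursion, and
  multiplying by a parameter clears the division in \<open>H\<close>. \<open>Yconv\<close> absorbs
  the boundary cases.\<close>

lemma cycle_mat_rows:
  assumes A: "A \<in> carrier_mat (2 * r) n" and c: "c < n" and Y: "\<And>i. i \<in> {1..r} \<Longrightarrow> Y l i \<noteq> 0" and r: "0 < r"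
  shows "p < r \<Longrightarrow> (cycle_mat r (Y l) * A) $$ (p, c) =
      Yconv r Y l p / Yconv r Y l (Suc p) * A $$ (p, c) + (if p = 0 then 0 else A $$ (p - 1, c))"
    and "Yconv r Y l (r - 1) * (cycle_mat r (Y l) * A) $$ (r, c) = A $$ (r - 1, c) + Yconv r Y l r * A $$ (r, c)"
    and "r < p \<Longrightarrow> p < 2 * r \<Longrightarrow> Yconv r Y l (2 * r - Suc p) * (cycle_mat r (Y l) * A) $$ (p, c) =
      Yconv r Y l (2 * r - p) * (A $$ (p, c) + (cycle_mat r (Y l) * A) $$ (p - 1, c))"
proof -
  define H where "H k = A $$ (r - 1, c) + (\<Sum>k'=k..r. Y l k' * A $$ (2 * r - k', c))" for k
  note aux = cycle_mat_rows_aux[where y = "Y l" and j = 1, OF A c Y r, folded H_def cycle_mat_def]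
  show "(cycle_mat r (Y l) * A) $$ (p, c) =
      Yconv r Y l p / Yconv r Y l (Suc p) * A $$ (p, c) + (if p = 0 then 0 else A $$ (p - 1, c))" if "p < r"
    using aux[where p = p] that by (auto simp: Yconv_def)
  have bar: "Yconv r Y l (2 * r - Suc p) * (cycle_mat r (Y l) * A) $$ (p, c) = H (2 * r - p)"
    if "r \<le> p" "p < 2 * r" for p
  proof (cases "2 * r - Suc p = 0")
    case True
    then have "2 * r - p = 1" using that by simp
    then show ?thesis using aux[where p = p] that True by (simp add: Yconv_def)
  next
    case False
    then have "2 * r - Suc p \<in> {1..r}" "2 * r - p \<noteq> 1" "\<not> 2 * r - p < 1" using that by auto
    then show ?thesis using aux[where p = p] that False Y[of "2 * r - Suc p"] by (simp add: Yconv_def)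
  qed
  have Hs: "H k = Y l k * A $$ (2 * r - k, c) + H (Suc k)" if "k \<le> r" for k
    using that by (simp add: H_def sum.atLeast_Suc_atMost)
  show "Yconv r Y l (r - 1) * (cycle_mat r (Y l) * A) $$ (r, c) = A $$ (r - 1, c) + Yconv r Y l r * A $$ (r, c)"
  proof -
    have "2 * r - Suc r = r - 1" "2 * r - r = r" by auto
    then have "Yconv r Y l (r - 1) * (cycle_mat r (Y l) * A) $$ (r, c) = H r" using bar[of r] r by simp
    moreover have "H r = A $$ (r - 1, c) + Yconv r Y l r * A $$ (r, c)"
      using r by (simp add: H_def Yconv_def)
    ultimately show ?thesis by simp
  qed
  assume p: "r < p" "p < 2 * r"
  define k where "k = 2 * r - p"
  have k: "1 \<le> k" "k < r" "2 * r - k = p" "2 * r - (p - 1) = Suc k" "2 * r - Suc (p - 1) = k"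
    using p by (auto simp: k_def)
  have "Yconv r Y l k * (cycle_mat r (Y l) * A) $$ (p - 1, c) = H (Suc k)"
    using bar[of "p - 1"] k p by simp
  moreover have "Yconv r Y l (2 * r - Suc p) * (cycle_mat r (Y l) * A) $$ (p, c) = Y l k * A $$ (p, c) + H (Suc k)"
    using bar[of p] Hs[of k] p k by (simp add: k_def)
  moreover have "Yconv r Y l k = Y l k" using k by (simp add: Yconv_def)
  ultimately show "Yconv r Y l (2 * r - Suc p) * (cycle_mat r (Y l) * A) $$ (p, c) =
      Yconv r Y l (2 * r - p) * (A $$ (p, c) + (cycle_mat r (Y l) * A) $$ (p - 1, c))"
    by (simp add: distrib_left k_def)
qed

text \<open>The product of the cycles m - t + 1, ..., m. Cycles are counted from the right because
  the rightmost factor is the first step of a path.\<close>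

fun tail_mat :: "nat \<Rightarrow> nat \<Rightarrow> (nat \<Rightarrow> nat \<Rightarrow> complex) \<Rightarrow> nat \<Rightarrow> complex mat" where
  "tail_mat r m Y 0 = 1\<^sub>m (2 * r)"
| "tail_mat r m Y (Suc t) = cycle_mat r (Y (m - t)) * tail_mat r m Y t"

lemma cycle_mat_Sp: "(\<And>i. i \<in> {1..r} \<Longrightarrow> y i \<noteq> 0) \<Longrightarrow> cycle_mat r y \<in> carrier (Sp r)"
  unfolding cycle_mat_def by (rule gprod_Sp) (auto intro!: xneg_Sp)

lemma tail_mat_Sp:
  assumes "\<And>l i. l \<in> {1..m} \<Longrightarrow> i \<in> {1..r} \<Longrightarrow> Y l i \<noteq> 0"
  shows "t \<le> m \<Longrightarrow> tail_mat r m Y t \<in> carrier (Sp r)"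
  by (induction t) (auto intro!: Sp_mult cycle_mat_Sp simp: Sp_one assms)

text \<open>The weight of a stay at position \<open>\<kappa>\<close> in step \<open>\<tau>\<close>. The steps follow the barred half of the network
  diagonally: the chip between \<open>\<kappa>\<close> and \<open>\<kappa> + 1\<close> used in step \<open>\<tau>\<close> belongs to cycle \<open>m - \<tau>\<close> for plain
  positions, but to cycle \<open>m - \<tau> + (\<kappa> - r + 1)\<close> for barred ones. Then a path moves by at most one position
  per step.\<close>

definition stay_weight :: "nat \<Rightarrow> nat \<Rightarrow> (nat \<Rightarrow> nat \<Rightarrow> complex) \<Rightarrow> nat \<Rightarrow> nat \<Rightarrow> complex" where
  "stay_weight r m Y \<tau> \<kappa> =
     (if \<kappa> < r then Cbar r Y (m - \<tau>) (Suc \<kappa>) else C r Y (m - (\<tau> + r - \<kappa>)) (2 * r - \<kappa> - 1))"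

text \<open>Without delay the row recursion of a cycle is the path recursion itself, with Suc
  \<kappa> encoding position \<kappa>.\<close>

lemma paths_plain:
  assumes Y: "\<And>l i. l \<in> {1..m} \<Longrightarrow> i \<in> {1..r} \<Longrightarrow> Y l i \<noteq> 0"
  shows "t \<le> m \<Longrightarrow> \<kappa> < r \<Longrightarrow> c < 2 * r \<Longrightarrow>
    paths (stay_weight r m Y) t (Suc \<kappa>) c = tail_mat r m Y t $$ (\<kappa>, c)"
proof (induction t arbitrary: \<kappa>)
  case (Suc t)
  have T: "tail_mat r m Y t \<in> carrier_mat (2 * r) (2 * r)"
    using tail_mat_Sp[of m r Y t] Y Suc.prems by (auto intro: Sp_carrier_mat)
  have IH: "paths (stay_weight r m Y) t \<kappa> c = (if \<kappa> = 0 then 0 else tail_mat r m Y t $$ (\<kappa> - 1, c))"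
    using Suc.IH[of "\<kappa> - 1"] Suc.prems by (cases \<kappa>) (auto simp: paths_eq_0)
  have "m - t \<in> {1..m}" using Suc.prems by auto
  then have rows: "tail_mat r m Y (Suc t) $$ (\<kappa>, c) = Yconv r Y (m - t) \<kappa> / Yconv r Y (m - t) (Suc \<kappa>) *
      tail_mat r m Y t $$ (\<kappa>, c) + (if \<kappa> = 0 then 0 else tail_mat r m Y t $$ (\<kappa> - 1, c))"
    using cycle_mat_rows(1)[OF T Suc.prems(3), of Y "m - t" \<kappa>] Y Suc.prems by simp
  have sw: "stay_weight r m Y t \<kappa> = Yconv r Y (m - t) \<kappa> / Yconv r Y (m - t) (Suc \<kappa>)"
    using Suc.prems by (simp add: stay_weight_def Cbar_def)
  have "paths (stay_weight r m Y) (Suc t) (Suc \<kappa>) c =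
      stay_weight r m Y t \<kappa> * paths (stay_weight r m Y) t (Suc \<kappa>) c + paths (stay_weight r m Y) t \<kappa> c"
    by simp
  then show ?case unfolding rows IH sw using Suc.IH[of \<kappa>] Suc.prems by simp
qed simp

text \<open>Position \<kappa> is visited \<kappa> - r steps late, so t cycles correspond to t +
  (\<kappa> - r) steps. The prefactor is the normalization of the barred row in the cycle applied
  last. Columns c < r ensure that every path starts in the plain half.\<close>

lemma paths_barred:
  assumes Y: "\<And>l i. l \<in> {1..m} \<Longrightarrow> i \<in> {1..r} \<Longrightarrow> Y l i \<noteq> 0" and c: "c < r"
    and \<kappa>: "r \<le> \<kappa>" "\<kappa> < 2 * r" and t: "t \<le> m"
  shows "paths (stay_weight r m Y) (t + (\<kappa> - r)) (Suc \<kappa>) c =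
    Yconv r Y (m + 1 - t) (2 * r - Suc \<kappa>) * tail_mat r m Y t $$ (\<kappa>, c)"
proof -
  let ?W = "stay_weight r m Y" and ?T = "tail_mat r m Y"
  have r: "0 < r" using c by simp
  have T: "?T t \<in> carrier_mat (2 * r) (2 * r)" if "t \<le> m" for t
    using tail_mat_Sp[of m r Y t] Y that by (auto intro: Sp_carrier_mat)
  \<comment> \<open>A path from c < r needs more than \<kappa> - r steps to reach the barred
    position \<kappa>; this starts the induction over the cycles.\<close>
  have zero: "paths ?W (\<kappa> - r) (Suc \<kappa>) c = 0" "?T 0 $$ (\<kappa>, c) = 0" if "r \<le> \<kappa>" "\<kappa> < 2 * r" for \<kappa>
    using c that by (auto intro: paths_eq_0)
  have stay: "?W (t + (\<kappa> - r)) \<kappa> * paths ?W (t + (\<kappa> - r)) (Suc \<kappa>) c = Yconv r Y (m - t) (2 * r - \<kappa>) * ?T t $$ (\<kappa>, c)"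
    if \<kappa>: "r \<le> \<kappa>" "\<kappa> < 2 * r" and t: "Suc t \<le> m"
      and e: "paths ?W (t + (\<kappa> - r)) (Suc \<kappa>) c = Yconv r Y (m + 1 - t) (2 * r - Suc \<kappa>) * ?T t $$ (\<kappa>, c)" for \<kappa> t
  \<comment> \<open>For t = 0 the weight divides by a parameter of cycle m + 1, about which nothing
    is known, but the path sum is 0. Otherwise a stay trades the normalization of cycle m + 1 - t
    for that of cycle m - t.\<close>
  proof (cases "t = 0")
    case True
    then show ?thesis using zero[OF \<kappa>] by simp
  next
    case False
    have "Yconv r Y (m + 1 - t) (2 * r - Suc \<kappa>) \<noteq> 0"
    proof (rule Yconv_nonzero)
      fix i assume "i \<in> {1..r}"
      moreover have "m + 1 - t \<in> {1..m}" using False t by auto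
      ultimately show "Y (m + 1 - t) i \<noteq> 0" by (intro Y)
    qed (use \<kappa> in simp)
    moreover have "?W (t + (\<kappa> - r)) \<kappa> = Yconv r Y (m - t) (2 * r - \<kappa>) / Yconv r Y (m + 1 - t) (2 * r - Suc \<kappa>)"
      using \<kappa> t by (simp add: stay_weight_def C_def Suc_diff_le Suc_diff_Suc)
    ultimately show ?thesis by (simp add: e)
  qed
  have Ym: "Y (m - t) i \<noteq> 0" if "Suc t \<le> m" "i \<in> {1..r}" for t i using Y[of "m - t" i] that by auto
  show ?thesis
    using \<kappa> t
  proof (induction \<kappa> arbitrary: t rule: dec_induct)
    case base
    show ?case using base(2)
    proof (induction t)
      case 0
      then show ?case using zero[of r] r by simp
    next
      case (Suc t)
      have "paths ?W (Suc t + (r - r)) (Suc r) c = ?W (t + (r - r)) r * paths ?W (t + (r - r)) (Suc r) c + paths ?W t r c"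
        by simp
      also have "paths ?W t r c = ?T t $$ (r - 1, c)"
        using paths_plain[of m r Y t "r - 1" c] Y Suc.prems r c by simp
      also have "?W (t + (r - r)) r * paths ?W (t + (r - r)) (Suc r) c = Yconv r Y (m - t) (2 * r - r) * ?T t $$ (r, c)"
        by (rule stay) (use Suc r in auto)
      also have "\<dots> + ?T t $$ (r - 1, c) = Yconv r Y (m - t) (r - 1) * ?T (Suc t) $$ (r, c)"
        using cycle_mat_rows(2)[OF T[of t], of c Y "m - t"] Ym[of t] Suc.prems c r by simp
      finally show ?case using r by (simp add: Suc_diff_le)
    qed
  next
    case (step \<kappa>)
    show ?case using step.prems(2)
    proof (induction t)
      case 0
      then show ?case using zero[of "Suc \<kappa>"] step by simp
    next
      case (Suc t)
      have "paths ?W (Suc t + (Suc \<kappa> - r)) (Suc (Suc \<kappa>)) c =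
          ?W (t + (Suc \<kappa> - r)) (Suc \<kappa>) * paths ?W (t + (Suc \<kappa> - r)) (Suc (Suc \<kappa>)) c +
          paths ?W (t + (Suc \<kappa> - r)) (Suc \<kappa>) c"
        by simp
      \<comment> \<open>The delay at work: the move comes from position \<kappa> after Suc t cycles,
        not t, just as the barred recursion refers to the transformed neighbouring row.\<close>
      also have "t + (Suc \<kappa> - r) = Suc t + (\<kappa> - r)" using step.hyps by simp
      also have "paths ?W (Suc t + (\<kappa> - r)) (Suc \<kappa>) c =
          Yconv r Y (m + 1 - Suc t) (2 * r - Suc \<kappa>) * ?T (Suc t) $$ (\<kappa>, c)"
        by (rule step.IH) (use step.prems Suc.prems in auto)
      also have "?W (Suc t + (\<kappa> - r)) (Suc \<kappa>) * paths ?W (Suc t + (\<kappa> - r)) (Suc (Suc \<kappa>)) c =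
          Yconv r Y (m - t) (2 * r - Suc \<kappa>) * ?T t $$ (Suc \<kappa>, c)"
        using stay[of "Suc \<kappa>" t] step.hyps step.prems Suc \<open>t + (Suc \<kappa> - r) = Suc t + (\<kappa> - r)\<close> by simp
      also have "\<dots> + Yconv r Y (m + 1 - Suc t) (2 * r - Suc \<kappa>) * ?T (Suc t) $$ (\<kappa>, c) =
          Yconv r Y (m - t) (2 * r - Suc (Suc \<kappa>)) * ?T (Suc t) $$ (Suc \<kappa>, c)"
        using cycle_mat_rows(3)[OF T[of t], of c Y "m - t" "Suc \<kappa>"] Ym[of t] Suc.prems step.hyps step.prems c r
        by (simp add: distrib_left)
      finally show ?case by simp
    qed
  qed
qed

text \<open>A factor with letter i > d fixes the basis vector c, because neither c nor c + 1 is one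
  of its chips.\<close>

lemma gprod_unit_cols:
  assumes "set is \<subseteq> {Suc d..r}" "\<And>i. i \<in> {1..r} \<Longrightarrow> y i \<noteq> 0" and p: "p < 2 * r" and c: "c < d" "d \<le> r"
  shows "gprod (Sp r) (map (\<lambda>i. xneg r i (y i)) is) $$ (p, c) = (if p = c then 1 else 0)"
  using assms(1) p
proof (induction "is" arbitrary: p)
  case Nil
  then show ?case using c by simp
next
  case (Cons i "is")
  let ?G = "gprod (Sp r) (map (\<lambda>i. xneg r i (y i)) is)"
  have i: "i \<in> {1..r}" "d < i" using Cons.prems by auto
  have G: "?G \<in> carrier_mat (2 * r) (2 * r)"
    by (rule Sp_carrier_mat[OF gprod_Sp]) (use Cons.prems assms(2) in \<open>auto intro!: xneg_Sp\<close>)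
  have ch: "c \<notin> chips r i" "Suc c \<notin> chips r i" using i c by (auto simp: chips_def)
  have IH: "?G $$ (p, c) = (if p = c then 1 else 0)" if "p < 2 * r" for p using Cons that by simp
  show ?case
    using xneg_mult_index[OF i(1) G Cons.prems(2), of c "y i"] assms(2)[OF i(1)] c ch Cons.prems
      chips_bounds(1)[OF i(1), of p] IH[of p] IH[of "p - 1"]
    by (cases p) auto
qed

lemma tail_mat_gprod:
  assumes Y: "\<And>l i. l \<in> {1..m} \<Longrightarrow> i \<in> {1..r} \<Longrightarrow> Y l i \<noteq> 0" and t: "t \<le> m"
  shows "tail_mat r m Y t = gprod (Sp r) (map (\<lambda>(l, i). xneg r i (Y l i))
    (concat (map (\<lambda>l. map (Pair l) [1..<Suc r]) [Suc m - t..<Suc m])))"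
  using t
proof (induction t)
  case (Suc t)
  define f where "f = (\<lambda>(l, i). xneg r i (Y l i))"
  have "[Suc m - Suc t..<Suc m] = (m - t) # [Suc m - t..<Suc m]"
    using upt_conv_Cons[of "m - t" "Suc m"] Suc.prems by (simp add: Suc_diff_le)
  then have "gprod (Sp r) (map f (concat (map (\<lambda>l. map (Pair l) [1..<Suc r]) [Suc m - Suc t..<Suc m]))) =
    gprod (Sp r) (map f (map (Pair (m - t)) [1..<Suc r]) @
      map f (concat (map (\<lambda>l. map (Pair l) [1..<Suc r]) [Suc m - t..<Suc m])))"
    by (simp del: upt_Suc)
  also have "\<dots> = gprod (Sp r) (map f (map (Pair (m - t)) [1..<Suc r])) *
    gprod (Sp r) (map f (concat (map (\<lambda>l. map (Pair l) [1..<Suc r]) [Suc m - t..<Suc m])))"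
    by (rule gprod_append) (use Suc.prems Y in \<open>auto simp: f_def intro!: xneg_Sp\<close>)
  also have "map f (map (Pair (m - t)) [1..<Suc r]) = map (\<lambda>i. xneg r i (Y (m - t) i)) [1..<Suc r]"
    by (simp add: f_def comp_def del: upt_Suc)
  finally show ?case using Suc by (simp add: f_def cycle_mat_def del: upt_Suc)
qed simp

text \<open>The missing letters \<open>d + 1, \<dots>, r\<close> of the last cycle do not change the first \<open>d\<close> columns, so the last
  cycle may be completed with parameters \<open>1\<close>.\<close>

lemma xL_columns:
  fixes Y :: "nat \<Rightarrow> nat \<Rightarrow> complex"
  assumes m: "1 \<le> m" and d: "d \<le> r" and Y: "\<forall>(l, i)\<in>set (cycle_letters r m d). Y l i \<noteq> 0"
  defines "Y' \<equiv> \<lambda>l i. if l = m \<and> d < i then 1 else Y l i"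
  shows "\<And>l i. l \<in> {1..m} \<Longrightarrow> i \<in> {1..r} \<Longrightarrow> Y' l i \<noteq> 0"
    and "p < 2 * r \<Longrightarrow> c < d \<Longrightarrow> xL r m d Y $$ (p, c) = tail_mat r m Y' m $$ (p, c)"
    and "xL r m d Y \<in> xty_group r"
proof -
  have set: "(l, i) \<in> set (cycle_letters r m d) \<longleftrightarrow> (l \<in> {1..<m} \<and> i \<in> {1..r}) \<or> (l = m \<and> i \<in> {1..d})" for l i
    by (auto simp: cycle_letters_def image_iff simp del: upt_Suc)
  show Y'0: "Y' l i \<noteq> 0" if "l \<in> {1..m}" "i \<in> {1..r}" for l i
    using Y set[of l i] that by (auto simp: Y'_def)
  show "xL r m d Y \<in> xty_group r"
    unfolding xL_def by (rule xty_group_gprod) (use Y set d in \<open>auto intro!: xty_group_xneg\<close>)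
  define f where "f = (\<lambda>(l, i). xneg r i (Y' l i))"
  have "xL r m d Y = gprod (Sp r) (map f (cycle_letters r m d))"
    unfolding xL_def
    by (rule arg_cong[of _ _ "gprod (Sp r)"], rule map_cong) (use set in \<open>auto simp: f_def Y'_def\<close>)
  moreover have "concat (map (\<lambda>l. map (Pair l) [1..<Suc r]) [Suc m - m..<Suc m]) =
      cycle_letters r m d @ map (Pair m) [Suc d..<Suc r]"
  proof -
    have "[1..<Suc r] = [1..<Suc d] @ [Suc d..<Suc r]"
      using upt_add_eq_append[of 1 "Suc d" "r - d"] d by simp
    moreover have "[Suc m - m..<Suc m] = [1..<m] @ [m]" using m by simp
    ultimately show ?thesis unfolding cycle_letters_def by simp
  qed
  ultimately have "tail_mat r m Y' m = gprod (Sp r) (map f (cycle_letters r m d) @ map f (map (Pair m) [Suc d..<Suc r]))"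
    using tail_mat_gprod[of m r Y' m] Y'0 by (simp add: f_def del: upt_Suc)
  also have "\<dots> = gprod (Sp r) (map f (cycle_letters r m d)) * gprod (Sp r) (map f (map (Pair m) [Suc d..<Suc r]))"
    by (rule gprod_append) (use Y'0 set d m in \<open>auto simp: f_def intro!: xneg_Sp\<close>)
  also have "map f (map (Pair m) [Suc d..<Suc r]) = map (\<lambda>i. xneg r i (Y' m i)) [Suc d..<Suc r]"
    by (simp add: f_def comp_def del: upt_Suc)
  finally have e: "tail_mat r m Y' m = xL r m d Y * gprod (Sp r) (map (\<lambda>i. xneg r i (Y' m i)) [Suc d..<Suc r])"
    using \<open>xL r m d Y = _\<close> by simp
  let ?G = "gprod (Sp r) (map (\<lambda>i. xneg r i (Y' m i)) [Suc d..<Suc r])"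
  assume pc: "p < 2 * r" "c < d"
  have xc: "xL r m d Y \<in> carrier_mat (2 * r) (2 * r)"
    by (rule Sp_carrier_mat[OF xty_group_Sp[OF \<open>xL r m d Y \<in> xty_group r\<close>]])
  have Gc: "?G \<in> carrier_mat (2 * r) (2 * r)"
    by (rule Sp_carrier_mat[OF gprod_Sp]) (use Y'0 m d in \<open>auto intro!: xneg_Sp\<close>)
  have c2: "c < 2 * r" using pc d by simp
  have "tail_mat r m Y' m $$ (p, c) = (\<Sum>s<2*r. xL r m d Y $$ (p, s) * ?G $$ (s, c))"
    unfolding e by (rule index_mult_mat_sum[OF xc Gc pc(1) c2])
  also have "\<dots> = (\<Sum>s<2*r. if s = c then xL r m d Y $$ (p, c) else 0)"
  proof (rule sum.cong[OF refl])
    fix s assume s: "s \<in> {..<2*r}"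
    have "?G $$ (s, c) = (if s = c then 1 else 0)"
      by (rule gprod_unit_cols[of _ d]) (use Y'0 m d pc s in auto)
    then show "xL r m d Y $$ (p, s) * ?G $$ (s, c) = (if s = c then xL r m d Y $$ (p, c) else 0)" by simp
  qed
  finally show "xL r m d Y $$ (p, c) = tail_mat r m Y' m $$ (p, c)" using c2 by simp
qed

text \<open>Since the recurrence refers to the neighbouring row of \<open>f\<close> and not of
  \<open>g\<close>, one unit lower bidiagonal matrix carries out all row operations
  simultaneously.\<close>

lemma det_row_chain:
  fixes f :: "nat \<Rightarrow> nat \<Rightarrow> 'a::idom"
  assumes "\<And>i c. i < d \<Longrightarrow> c < d \<Longrightarrow> f i c = \<alpha> i * g i c + (if i = 0 then 0 else \<beta> i * f (i - 1) c)"
  shows "det (mat d d (\<lambda>(i, c). f i c)) = (\<Prod>i<d. \<alpha> i) * det (mat d d (\<lambda>(i, c). g i c))"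
proof -
  let ?F = "mat d d (\<lambda>(i, c). f i c)" and ?G = "mat d d (\<lambda>(i, c). g i c)"
  let ?L = "mat d d (\<lambda>(i, k). if k = i then 1 else if i = Suc k then - \<beta> i else 0)"
  let ?D = "mat d d (\<lambda>(i, k). if k = i then \<alpha> i else 0)"
  have "?L * ?F = ?D * ?G"
  proof (rule eq_matI)
    fix i c assume "i < dim_row (?D * ?G)" "c < dim_col (?D * ?G)"
    then have ic: "i < d" "c < d" by auto
    have "(?L * ?F) $$ (i, c) = (\<Sum>k<d. ?L $$ (i, k) * ?F $$ (k, c))"
      using ic by (intro index_mult_mat_sum) auto
    also have "\<dots> = (\<Sum>k<d. (if k = i then f i c else 0) +
        (if k = i - 1 then if i = 0 then 0 else - \<beta> i * f (i - 1) c else 0))"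
      by (rule sum.cong) (use ic in auto)
    also have "\<dots> = \<alpha> i * g i c" using ic assms[OF ic] by (simp add: sum.distrib less_imp_diff_less)
    also have "\<dots> = (\<Sum>k<d. if k = i then \<alpha> i * g i c else 0)" using ic by simp
    also have "\<dots> = (\<Sum>k<d. ?D $$ (i, k) * ?G $$ (k, c))"
      by (rule sum.cong) (use ic in auto)
    also have "\<dots> = (?D * ?G) $$ (i, c)"
      using ic by (intro index_mult_mat_sum[symmetric]) auto
    finally show "(?L * ?F) $$ (i, c) = (?D * ?G) $$ (i, c)" .
  qed auto
  then have "det ?L * det ?F = det ?D * det ?G"
    using det_mult[of ?L d ?F] det_mult[of ?D d ?G] by simp
  moreover have "det ?L = 1"
    by (subst det_lower_triangular[of d]) (auto simp: prod_list_diag_prod intro!: prod.neutral)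
  moreover have "det ?D = (\<Prod>i<d. \<alpha> i)"
    by (subst det_lower_triangular[of d]) (auto simp: prod_list_diag_prod atLeast0LessThan intro!: prod.cong)
  ultimately show ?thesis by simp
qed

text \<open>Reversing d - a rows has the sign of (d - a)(d - a - 1) / 2 transpositions, which is
  also the sum of the exponents i - a. Expansion along the last row reduces d by one.\<close>

lemma det_signed_reversal:
  assumes "a \<le> d"
  shows "det (mat d d (\<lambda>(i, k). if i < a then if k = i then 1 else 0
    else if i + k + 1 = a + d then (- 1) ^ (i - a) else (0::'a::comm_ring_1))) = 1"
  using assms
proof (induction d rule: dec_induct)
  case base
  have "mat a a (\<lambda>(i, k). if i < a then if k = i then 1 else 0
      else if i + k + 1 = a + a then (- 1) ^ (i - a) else (0::'a)) = 1\<^sub>m a"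
    by (rule eq_matI) auto
  then show ?case by (simp only: det_one)
next
  case (step d)
  let ?S = "\<lambda>d. mat d d (\<lambda>(i, k). if i < a then if k = i then 1 else 0
    else if i + k + 1 = a + d then (- 1) ^ (i - a) else (0::'a))"
  have "mat_delete (?S (Suc d)) d a = ?S d"
    using step.hyps by (intro eq_matI) (auto simp: mat_delete_def)
  then have cof: "cofactor (?S (Suc d)) d a = (- 1) ^ (d + a)"
    using step.IH by (simp add: cofactor_def)
  have "det (?S (Suc d)) = (\<Sum>k<Suc d. ?S (Suc d) $$ (d, k) * cofactor (?S (Suc d)) d k)"
    by (rule laplace_expansion_row) auto
  also have "\<dots> = (\<Sum>k<Suc d. if k = a then (- 1) ^ (d - a) * cofactor (?S (Suc d)) d a else 0)"
    using step.hyps by (intro sum.cong) auto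
  also have "\<dots> = (- 1) ^ (d - a) * cofactor (?S (Suc d)) d a"
    using step.hyps by (subst sum.delta) simp_all
  also have "\<dots> = (- 1) ^ (d - a) * (- 1) ^ (d + a)" by (simp only: cof)
  also have "\<dots> = 1" using step.hyps by (simp flip: power_add)
  finally show ?case .
qed

text \<open>Removes the signs of the representative: reversing the barred rows puts them in
  increasing order at exactly the cost of these signs.\<close>

lemma det_reverse_rows:
  fixes g :: "nat \<Rightarrow> nat \<Rightarrow> 'a::comm_ring_1"
  assumes "a \<le> d"
  shows "det (mat d d (\<lambda>(i, c). (- 1) ^ (i - a) * g i c)) =
    det (mat d d (\<lambda>(i, c). g (if i < a then i else a + d - Suc i) c))"
proof -
  let ?S = "mat d d (\<lambda>(i, k). if i < a then if k = i then 1 else 0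
    else if i + k + 1 = a + d then (- 1) ^ (i - a) else (0::'a))"
  let ?G = "mat d d (\<lambda>(i, c). g (if i < a then i else a + d - Suc i) c)"
  have "mat d d (\<lambda>(i, c). (- 1) ^ (i - a) * g i c) = ?S * ?G"
  proof (rule eq_matI)
    fix i c assume "i < dim_row (?S * ?G)" "c < dim_col (?S * ?G)"
    then have ic: "i < d" "c < d" by auto
    define k0 where "k0 = (if i < a then i else a + d - Suc i)"
    have k0: "k0 < d" using ic assms by (auto simp: k0_def)
    have S: "?S $$ (i, k) * ?G $$ (k, c) = (if k = k0 then (- 1) ^ (i - a) * g i c else 0)" if "k < d" for k
      using ic that assms by (auto simp: k0_def)
    have "(?S * ?G) $$ (i, c) = (\<Sum>k<d. ?S $$ (i, k) * ?G $$ (k, c))"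
      using ic by (intro index_mult_mat_sum) auto
    also have "\<dots> = (\<Sum>k<d. if k = k0 then (- 1) ^ (i - a) * g i c else 0)"
      by (rule sum.cong[OF refl]) (rule S, simp)
    finally have "(?S * ?G) $$ (i, c) = (- 1) ^ (i - a) * g i c" using k0 by simp
    then show "mat d d (\<lambda>(i, c). (- 1) ^ (i - a) * g i c) $$ (i, c) = (?S * ?G) $$ (i, c)" using ic by simp
  qed auto
  then have "det (mat d d (\<lambda>(i, c). (- 1) ^ (i - a) * g i c)) = det ?S * det ?G"
    by (simp add: det_mult[of _ d])
  then show ?thesis using det_signed_reversal[OF assms, where 'a = 'a] by simp
qed

text \<open>Row operations with the rows of the cycles \<open>1, 2, \<dots>\<close> replace the barred rows, which all belong to
  cycle \<open>1\<close>, by rows that are visited at the same step.\<close>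

lemma det_barred_rows:
  assumes Y: "\<And>l i. l \<in> {1..m} \<Longrightarrow> i \<in> {1..r} \<Longrightarrow> Y l i \<noteq> 0" and m': "1 \<le> m'" "m' \<le> m" "m \<le> r" and d: "d \<le> r"
  defines "a \<equiv> r - m'" and "T \<equiv> tail_mat r m Y"
  shows "det (mat d d (\<lambda>(i, c). T m $$ (if i < a then m' + i else 2 * r - d + i, c))) =
    det (mat d d (\<lambda>(i, c). if i < a then T m $$ (m' + i, c)
      else Yconv r Y (i - a + 1) (d - Suc i) * T (m - (i - a)) $$ (2 * r - d + i, c)))"
proof -
  \<comment> \<open>Stage e of the elimination: cycles 1, ..., e have been stripped, but row a + j
    loses only its first j of them. The next stage strips cycle e + 1 from the rows beyond a +
    e.\<close>
  define row where "row e i c = (if i < a then T m $$ (m' + i, c) else T (m - min (i - a) e) $$ (2 * r - d + i, c))" for e i c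
  have am: "a < r" "a + m' = r" using m' by (auto simp: a_def)
  have T: "T t \<in> carrier_mat (2 * r) (2 * r)" if "t \<le> m" for t
    unfolding T_def using tail_mat_Sp[of m r Y t] Y that by (auto intro: Sp_carrier_mat)
  have step: "det (mat d d (\<lambda>(i, c). row e i c)) =
      Yconv r Y (e + 1) (d - a - Suc e) * det (mat d d (\<lambda>(i, c). row (Suc e) i c))" if e: "e < d - a" for e
  proof -
    define \<alpha> where "\<alpha> i = (if i < a + Suc e then 1 else Yconv r Y (e + 1) (d - i) / Yconv r Y (e + 1) (d - Suc i))" for i
    define \<beta> where "\<beta> i = (if i < a + Suc e then 0 else Yconv r Y (e + 1) (d - i) / Yconv r Y (e + 1) (d - Suc i))" for i
    have em: "e < m" "m - e = Suc (m - Suc e)" "m - (m - Suc e) = Suc e" using e am d m' by auto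
    have Ye: "Y (Suc e) i \<noteq> 0" if "i \<in> {1..r}" for i using Y[of "Suc e" i] em that by auto
    have Ync: "Yconv r Y (Suc e) k \<noteq> 0" if "k \<le> Suc r" for k by (rule Yconv_nonzero) (use Ye that in auto)
    have "row e i c = \<alpha> i * row (Suc e) i c + (if i = 0 then 0 else \<beta> i * row e (i - 1) c)" if ic: "i < d" "c < d" for i c
    proof (cases "i < a + Suc e")
      case True
      then have "row e i c = row (Suc e) i c" by (auto simp: row_def min_def)
      then show ?thesis using True by (simp add: \<alpha>_def \<beta>_def)
    next
      case False
      define p where "p = 2 * r - d + i"
      have p: "r < p" "p < 2 * r" "2 * r - p = d - i" "2 * r - Suc p = d - Suc i" "p - 1 = 2 * r - d + (i - 1)"
        using False ic d am by (auto simp: p_def)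
      have rows: "row e i c = T (Suc (m - Suc e)) $$ (p, c)" "row (Suc e) i c = T (m - Suc e) $$ (p, c)"
        "row e (i - 1) c = T (Suc (m - Suc e)) $$ (p - 1, c)"
      proof -
        have "\<not> i < a" "\<not> i - 1 < a" and mins: "min (i - a) e = e" "min (i - a) (Suc e) = Suc e" "min (i - 1 - a) e = e"
          using False by auto
        then show "row e i c = T (Suc (m - Suc e)) $$ (p, c)" "row (Suc e) i c = T (m - Suc e) $$ (p, c)"
          "row e (i - 1) c = T (Suc (m - Suc e)) $$ (p - 1, c)"
          unfolding row_def mins p(5) em(2)[symmetric] by (simp_all add: p_def)
      qed
      have T1: "T (Suc (m - Suc e)) = cycle_mat r (Y (Suc e)) * T (m - Suc e)"
        unfolding T_def by (simp add: em(3))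
      have A: "T (m - Suc e) \<in> carrier_mat (2 * r) (2 * r)" by (rule T) simp
      have c: "c < 2 * r" "0 < r" using ic d by simp_all
      have "Yconv r Y (Suc e) (d - Suc i) * T (Suc (m - Suc e)) $$ (p, c) =
          Yconv r Y (Suc e) (d - i) * (T (m - Suc e) $$ (p, c) + T (Suc (m - Suc e)) $$ (p - 1, c))"
        using cycle_mat_rows(3)[where Y = Y and l = "Suc e", OF A c(1) Ye c(2) p(1,2)] unfolding p(3,4) T1 .
      then show ?thesis
        using False Ync[of "d - Suc i"] d unfolding rows \<alpha>_def \<beta>_def by (simp add: field_simps)
    qed
    then have "det (mat d d (\<lambda>(i, c). row e i c)) = (\<Prod>i<d. \<alpha> i) * det (mat d d (\<lambda>(i, c). row (Suc e) i c))"
      by (rule det_row_chain)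
    also have "(\<Prod>i<d. \<alpha> i) = Yconv r Y (e + 1) (d - a - Suc e)"
    proof -
      \<comment> \<open>The factors telescope; at full length the denominator has index 0 and equals
        1 by convention.\<close>
      have "(\<Prod>i<a + Suc e + n. \<alpha> i) = Yconv r Y (e + 1) (d - a - Suc e) / Yconv r Y (e + 1) (d - a - Suc e - n)"
        if "a + Suc e + n \<le> d" for n
        using that
      proof (induction n)
        case 0
        have "(\<Prod>i<a + Suc e. \<alpha> i) = 1" by (rule prod.neutral) (simp add: \<alpha>_def)
        then show ?case using Ync[of "d - a - Suc e"] d by simp
      next
        case (Suc n)
        have "\<alpha> (a + Suc e + n) = Yconv r Y (e + 1) (d - a - Suc e - n) / Yconv r Y (e + 1) (d - a - Suc e - Suc n)"
          by (simp add: \<alpha>_def diff_diff_add add_ac)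
        then show ?case using Suc Ync[of "d - a - Suc e - n"] d by simp
      qed
      from this[of "d - a - Suc e"] show ?thesis using e by (simp add: Yconv_def)
    qed
    finally show ?thesis .
  qed
  have "det (mat d d (\<lambda>(i, c). row 0 i c)) =
      (\<Prod>j<e. Yconv r Y (j + 1) (d - a - Suc j)) * det (mat d d (\<lambda>(i, c). row e i c))" if "e \<le> d - a" for e
    using that
  proof (induction e)
    case (Suc e)
    then show ?case using step[of e] by (simp add: mult_ac)
  qed simp
  then have "det (mat d d (\<lambda>(i, c). row 0 i c)) =
      (\<Prod>j<d - a. Yconv r Y (j + 1) (d - a - Suc j)) * det (mat d d (\<lambda>(i, c). row (d - a) i c))" by simp
  moreover have "(\<lambda>(i, c). row 0 i c) = (\<lambda>(i, c). T m $$ (if i < a then m' + i else 2 * r - d + i, c))"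
    by (auto simp: row_def fun_eq_iff)
  \<comment> \<open>The factor collected at stage j is handed back to row a + j, where it is the
    normalization required by \<open>paths_barred\<close>.\<close>
  moreover have "det (mat d d (\<lambda>(i, c). if i < a then T m $$ (m' + i, c)
      else Yconv r Y (i - a + 1) (d - Suc i) * T (m - (i - a)) $$ (2 * r - d + i, c))) =
    (\<Prod>i<d. if i < a then 1 else Yconv r Y (i - a + 1) (d - Suc i)) * det (mat d d (\<lambda>(i, c). row (d - a) i c))"
    by (rule det_row_chain[where \<beta> = "\<lambda>_. 0"]) (auto simp: row_def min_def)
  moreover have "(\<Prod>i<d. if i < a then 1 else Yconv r Y (i - a + 1) (d - Suc i)) =
      (\<Prod>j<d - a. Yconv r Y (j + 1) (d - a - Suc j))"
  proof -
    have "(\<Prod>i<d. if i < a then 1 else Yconv r Y (i - a + 1) (d - Suc i)) =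
        (\<Prod>i\<in>{a..<d}. if i < a then 1 else Yconv r Y (i - a + 1) (d - Suc i))"
      by (rule prod.mono_neutral_right) auto
    also have "\<dots> = (\<Prod>j<d - a. Yconv r Y (j + 1) (d - a - Suc j))"
      by (rule prod.reindex_bij_witness[where i = "\<lambda>j. j + a" and j = "\<lambda>i. i - a"]) auto
    finally show ?thesis .
  qed
  ultimately show ?thesis by simp
qed

section \<open>Tableaux and families of monomials\<close>

lemma elt_le_iff: "p < 2 * r \<Longrightarrow> q < 2 * r \<Longrightarrow> elt r p \<le> elt r q \<longleftrightarrow> p \<le> q"
  by (auto simp: elt_def)

lemma elt_less_iff: "p < 2 * r \<Longrightarrow> q < 2 * r \<Longrightarrow> elt r p < elt r q \<longleftrightarrow> p < q"
  using elt_le_iff[of p r q] elt_le_iff[of q r p] by (simp add: less_le_not_le)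

definition pos :: "nat \<Rightarrow> jelt \<Rightarrow> nat" where
  "pos r j = (case j of Plain l \<Rightarrow> l - 1 | Bar l \<Rightarrow> 2 * r - l)"

lemma elt_J: "p < 2 * r \<Longrightarrow> elt r p \<in> J r"
  by (auto simp: elt_def J_def intro!: imageI)

lemma elt_pos: "j \<in> J r \<Longrightarrow> elt r (pos r j) = j" and pos_lt: "j \<in> J r \<Longrightarrow> pos r j < 2 * r"
  by (auto simp: elt_def J_def pos_def)

lemma pos_elt: "p < 2 * r \<Longrightarrow> pos r (elt r p) = p"
  by (auto simp: elt_def pos_def)

lemma elt_le_Plain: "0 < l \<Longrightarrow> l \<le> r \<Longrightarrow> p < 2 * r \<Longrightarrow> elt r p \<le> Plain l \<longleftrightarrow> p < l"
  by (auto simp: elt_def)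

text \<open>The number \<open>\<delta>\<close> only separates the plain from the barred factors.\<close>

lemma prod_delta:
  assumes J: "\<And>s. s \<in> {1..M} \<Longrightarrow> \<kappa> s i \<in> J r" and mono: "\<And>s. s \<in> {1..<M} \<Longrightarrow> \<kappa> s i \<le> \<kappa> (s + 1) i"
  shows "delta r M \<kappa> i \<le> M" and "s \<in> {1..M} \<Longrightarrow> s \<le> delta r M \<kappa> i \<longleftrightarrow> \<kappa> s i \<le> Plain r"
proof -
  define P where "P \<delta> \<longleftrightarrow> \<delta> \<le> M \<and> (\<forall>s\<in>{1..\<delta>}. \<kappa> s i \<le> Plain r) \<and> (\<forall>s\<in>{\<delta> + 1..M}. Bar r \<le> \<kappa> s i)" for \<delta>
  have bar: "Bar r \<le> j \<longleftrightarrow> \<not> j \<le> Plain r" if "j \<in> J r" for j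
    using that by (auto simp: J_def)
  have up: "\<kappa> s i \<le> \<kappa> t i" if "1 \<le> s" "s \<le> t" "t \<le> M" for s t
    using that(2,3,1)
  proof (induction t rule: dec_induct)
    case (step t)
    then have "\<kappa> s i \<le> \<kappa> t i" "t \<in> {1..<M}" by auto
    then show ?case using order_trans[OF _ mono[of t]] by simp
  qed simp
  define \<delta> where "\<delta> = Max (insert 0 {s \<in> {1..M}. \<kappa> s i \<le> Plain r})"
  have fin: "finite (insert 0 {s \<in> {1..M}. \<kappa> s i \<le> Plain r})" by simp
  have \<delta>in: "\<delta> \<in> insert 0 {s \<in> {1..M}. \<kappa> s i \<le> Plain r}" unfolding \<delta>_def by (rule Max_in[OF fin]) simp
  have \<delta>ge: "s \<le> \<delta>" if "s \<in> {1..M}" "\<kappa> s i \<le> Plain r" for s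
    unfolding \<delta>_def by (rule Max_ge[OF fin]) (use that in auto)
  have P: "P \<delta>"
    unfolding P_def
  proof (intro conjI ballI)
    show "\<delta> \<le> M" using \<delta>in by auto
    show "\<kappa> s i \<le> Plain r" if "s \<in> {1..\<delta>}" for s
      using \<delta>in up[of s \<delta>] that order_trans by auto
    show "Bar r \<le> \<kappa> s i" if "s \<in> {\<delta> + 1..M}" for s
      using \<delta>ge[of s] that bar[OF J[of s]] by auto
  qed
  have uniq: "x = \<delta>" if "P x" for x
  proof (rule ccontr)
    assume "x \<noteq> \<delta>"
    then consider "x < \<delta>" | "\<delta> < x" by linarith
    then show False
    proof cases
      case 1
      then have "\<kappa> (x + 1) i \<le> Plain r" "Bar r \<le> \<kappa> (x + 1) i" "x + 1 \<in> {1..M}" using P that by (auto simp: P_def)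
      then show False using bar[OF J] by blast
    next
      case 2
      then have "\<kappa> (\<delta> + 1) i \<le> Plain r" "Bar r \<le> \<kappa> (\<delta> + 1) i" "\<delta> + 1 \<in> {1..M}" using P that by (auto simp: P_def)
      then show False using bar[OF J] by blast
    qed
  qed
  have "delta r M \<kappa> i = (THE x. P x)" by (simp only: delta_def P_def)
  also have "\<dots> = \<delta>" by (rule the_equality[where P = P, OF P uniq])
  finally have \<delta>: "delta r M \<kappa> i = \<delta>" .
  show "delta r M \<kappa> i \<le> M" using P unfolding \<delta> P_def by blast
  assume s: "s \<in> {1..M}"
  have "\<kappa> s i \<le> Plain r" if "s \<le> \<delta>" using P s that unfolding P_def by simp
  then show "s \<le> delta r M \<kappa> i \<longleftrightarrow> \<kappa> s i \<le> Plain r" unfolding \<delta> using \<delta>ge[OF s] by blast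
qed

text \<open>Decides the kind of a factor by the entry itself instead of by \<delta>, which matches
  the local weight of a tableau box.\<close>

lemma monomial_eq_prod:
  assumes J: "\<And>s i. s \<in> {1..m - m'} \<Longrightarrow> i \<in> {1..d} \<Longrightarrow> \<kappa> s i \<in> J r"
    and mono: "\<And>s i. s \<in> {1..<m - m'} \<Longrightarrow> i \<in> {1..d} \<Longrightarrow> \<kappa> s i \<le> \<kappa> (s + 1) i"
  shows "monomial r m m' d Y \<kappa> = (\<Prod>i=1..d. \<Prod>s=1..m - m'.
    if \<kappa> s i \<le> Plain r then Cbar r Y (m - (absJ (\<kappa> s i) + s - i - 1)) (absJ (\<kappa> s i))
    else C r Y (m - (s + r - i)) (absJ (\<kappa> s i) - 1))"
  unfolding monomial_def Let_def
proof (rule prod.cong[OF refl])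
  fix i assume i: "i \<in> {1..d}"
  let ?M = "m - m'" and ?\<delta> = "delta r (m - m') \<kappa> i"
  let ?w = "\<lambda>s. if \<kappa> s i \<le> Plain r then Cbar r Y (m - (absJ (\<kappa> s i) + s - i - 1)) (absJ (\<kappa> s i))
    else C r Y (m - (s + r - i)) (absJ (\<kappa> s i) - 1)"
  note \<delta> = prod_delta[of ?M \<kappa> i r, OF J[OF _ i] mono[OF _ i]]
  have "(\<Prod>s=1..?\<delta>. Cbar r Y (m - ell r ?M \<kappa> s i) (absJ (\<kappa> s i))) = (\<Prod>s=1..?\<delta>. ?w s)"
  proof (rule prod.cong[OF refl])
    fix s assume "s \<in> {1..?\<delta>}"
    then show "Cbar r Y (m - ell r ?M \<kappa> s i) (absJ (\<kappa> s i)) = ?w s"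
      using \<delta>(1) \<delta>(2)[of s] by (simp add: ell_def)
  qed
  moreover have "(\<Prod>s=?\<delta> + 1..?M. C r Y (m - ell r ?M \<kappa> s i) (absJ (\<kappa> s i) - 1)) = (\<Prod>s=?\<delta> + 1..?M. ?w s)"
  proof (rule prod.cong[OF refl])
    fix s assume "s \<in> {?\<delta> + 1..?M}"
    then show "C r Y (m - ell r ?M \<kappa> s i) (absJ (\<kappa> s i) - 1) = ?w s"
      using \<delta>(2)[of s] by (simp add: ell_def)
  qed
  moreover have "(\<Prod>s=1..?M. ?w s) = (\<Prod>s=1..?\<delta>. ?w s) * (\<Prod>s=?\<delta> + 1..?M. ?w s)"
  proof -
    have e: "?\<delta> + (?M - ?\<delta>) = ?M" using \<delta>(1) by simp
    have "1 \<le> ?\<delta> + 1" by simp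
    from prod.ub_add_nat[OF this, of ?w "?M - ?\<delta>"] show ?thesis unfolding e .
  qed
  ultimately show "(\<Prod>s=1..?\<delta>. Cbar r Y (m - ell r ?M \<kappa> s i) (absJ (\<kappa> s i))) *
      (\<Prod>s=?\<delta> + 1..?M. C r Y (m - ell r ?M \<kappa> s i) (absJ (\<kappa> s i) - 1)) = (\<Prod>s=1..?M. ?w s)"
    by simp
qed

lemma tab_weight_eq_prod:
  "tab_weight W d (\<lambda>_. M) \<kappa> = (\<Prod>i=1..d. \<Prod>s=1..M. W (\<kappa> (i - 1, s - 1) + (s - 1) - (i - 1)) (\<kappa> (i - 1, s - 1)))"
proof -
  have "tab_weight W d (\<lambda>_. M) \<kappa> = (\<Prod>i<d. \<Prod>s<M. W (\<kappa> (i, s) + s - i) (\<kappa> (i, s)))"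
    unfolding tab_weight_def tab_shape_def by (subst prod.Sigma) auto
  also have "\<dots> = (\<Prod>i=1..d. \<Prod>s<M. W (\<kappa> (i - 1, s) + s - (i - 1)) (\<kappa> (i - 1, s)))"
    by (rule prod.reindex_bij_witness[where i = "\<lambda>i. i - 1" and j = Suc]) auto
  also have "\<dots> = (\<Prod>i=1..d. \<Prod>s=1..M. W (\<kappa> (i - 1, s - 1) + (s - 1) - (i - 1)) (\<kappa> (i - 1, s - 1)))"
    by (intro prod.cong[OF refl] prod.reindex_bij_witness[where i = "\<lambda>s. s - 1" and j = Suc]) auto
  finally show ?thesis .
qed

text \<open>The expressions subtracted from m are the stay step for plain entries and that step
  corrected by the delay for barred ones. The auxiliary parameters 1 stay invisible: cycle m is met
  by a plain entry only at step 0, where the letters are at most i \<le> d, and by a barred one only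
  if s = 1 and i = d = r, where no letter was added.\<close>

lemma stay_weight_completed:
  fixes Y :: "nat \<Rightarrow> nat \<Rightarrow> complex"
  assumes i: "i \<in> {1..d}" and d: "d \<le> r" and s: "s \<in> {1..m - m'}" and m': "1 \<le> m'"
    and \<kappa>: "i - 1 \<le> \<kappa>" "\<kappa> < 2 * r"
  defines "Y' \<equiv> \<lambda>l i. if l = m \<and> d < i then 1 else Y l i"
  shows "stay_weight r m Y' (\<kappa> + (s - 1) - (i - 1)) \<kappa> =
    (if elt r \<kappa> \<le> Plain r then Cbar r Y (m - (absJ (elt r \<kappa>) + s - i - 1)) (absJ (elt r \<kappa>))
     else C r Y (m - (s + r - i)) (absJ (elt r \<kappa>) - 1))"
proof (cases "\<kappa> < r")
  case True
  have \<tau>: "Suc \<kappa> + s - i - 1 = \<kappa> + (s - 1) - (i - 1)" using i s \<kappa> by auto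
  have "Yconv r Y' (m - (\<kappa> + (s - 1) - (i - 1))) k = Yconv r Y (m - (\<kappa> + (s - 1) - (i - 1))) k" if "k \<le> Suc \<kappa>" for k
    using that i s \<kappa> m' by (auto simp: Yconv_def Y'_def)
  then show ?thesis using True \<tau> by (simp add: stay_weight_def elt_def Cbar_def)
next
  case False
  have l: "\<kappa> + (s - 1) - (i - 1) + r - \<kappa> = s + r - i" using i s \<kappa> d by auto
  have "Yconv r Y' (m - (s + r - i)) k = Yconv r Y (m - (s + r - i)) k" for k
    using i s d m' by (auto simp: Yconv_def Y'_def)
  moreover have "Yconv r Y' (m - (s + r - i) + 1) k = Yconv r Y (m - (s + r - i) + 1) k" if "k \<le> r" for k
    using that i s d m' by (cases "d = r") (auto simp: Yconv_def Y'_def)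
  ultimately show ?thesis using False \<kappa> l by (simp add: stay_weight_def elt_def C_def)
qed

text \<open>For i < a the flag is the bound by Plain (m' + i) in zero-based form. The flag of the
  remaining rows is what the common bound 2 * r, that is the largest element bar 1, leaves to row i
  of a strictly increasing column of height d.\<close>

lemma sum_tableaux_families:
  fixes Y :: "nat \<Rightarrow> nat \<Rightarrow> complex"
  assumes m': "1 \<le> m'" "m' \<le> m" "m \<le> r" and d: "1 \<le> d" "d \<le> r"
  defines "a \<equiv> r - m'" and "Y' \<equiv> \<lambda>l i. if l = m \<and> d < i then 1 else Y l i"
  defines "b \<equiv> \<lambda>i. if i < a then m' + i + 1 else 2 * r - d + i + 1"
  shows "(\<Sum>\<kappa>\<in>tableaux d (\<lambda>_. m - m') b. tab_weight (stay_weight r m Y') d (\<lambda>_. m - m') \<kappa>) =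
    (\<Sum>\<kappa>\<in>families r m m' d. monomial r m m' d Y \<kappa>)"
proof (rule sum.reindex_bij_witness[where
      j = "\<lambda>\<kappa>. \<lambda>s\<in>{1..m - m'}. \<lambda>i\<in>{1..d}. elt r (\<kappa> (i - 1, s - 1))" and
      i = "\<lambda>\<kappa>'. \<lambda>(i, s)\<in>tab_shape d (\<lambda>_. m - m'). pos r (\<kappa>' (Suc s) (Suc i))"])
  let ?M = "m - m'"
  let ?to = "\<lambda>\<kappa>. \<lambda>s\<in>{1..?M}. \<lambda>i\<in>{1..d}. elt r (\<kappa> (i - 1, s - 1))"
  let ?from = "\<lambda>\<kappa>'. \<lambda>(i, s)\<in>tab_shape d (\<lambda>_. ?M). pos r (\<kappa>' (Suc s) (Suc i))"
  have b2r: "b i \<le> 2 * r" if "i < d" for i using that m' d by (auto simp: b_def a_def)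
  {
    fix \<kappa> assume k: "\<kappa> \<in> tableaux d (\<lambda>_. ?M) b"
    have lt: "\<kappa> (i, s) < b i" "\<kappa> (i, s) < 2 * r" if "i < d" "s < ?M" for i s
      using tableaux_bound[OF k that] b2r[OF that(1)] by auto
    have ge: "i \<le> \<kappa> (i, s)" if "i < d" "s < ?M" for i s
      by (rule tableaux_lower[OF k]) (use that in auto)
    have row: "\<kappa> (i, s) \<le> \<kappa> (i, Suc s)" if "i < d" "Suc s < ?M" for i s
      using k that unfolding tableaux_iff by blast
    have col: "\<kappa> (i, s) < \<kappa> (Suc i, s)" if "Suc i < d" "s < ?M" for i s
      using k that unfolding tableaux_iff by blast
    have to: "?to \<kappa> s i = elt r (\<kappa> (i - 1, s - 1))" if "s \<in> {1..?M}" "i \<in> {1..d}" for s i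
      using that by simp
    have J: "?to \<kappa> s i \<in> J r" if "s \<in> {1..?M}" "i \<in> {1..d}" for s i
      unfolding to[OF that] by (rule elt_J) (use lt(2)[of "i - 1" "s - 1"] that in auto)
    have mono: "?to \<kappa> s i \<le> ?to \<kappa> (s + 1) i" if "s \<in> {1..<?M}" "i \<in> {1..d}" for s i
    proof -
      have s: "s \<in> {1..?M}" "s + 1 \<in> {1..?M}" using that by auto
      have "\<kappa> (i - 1, s - 1) \<le> \<kappa> (i - 1, s)" using row[of "i - 1" "s - 1"] that by auto
      then show ?thesis
        unfolding to[OF s(1) that(2)] to[OF s(2) that(2)]
        using lt(2)[of "i - 1" "s - 1"] lt(2)[of "i - 1" s] that by (auto simp: elt_le_iff)
    qed
    show "?from (?to \<kappa>) = \<kappa>"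
    proof
      fix x show "?from (?to \<kappa>) x = \<kappa> x"
      proof (cases "x \<in> tab_shape d (\<lambda>_. ?M)")
        case True
        then show ?thesis using lt(2) by (cases x) (auto simp: pos_elt)
      next
        case False
        have "\<kappa> \<in> extensional (tab_shape d (\<lambda>_. ?M))" using k unfolding tableaux_iff by blast
        from extensional_arb[OF this False] show ?thesis by (subst restrict_apply) (simp only: False if_False)
      qed
    qed
    show "?to \<kappa> \<in> families r m m' d"
      unfolding families_def
    proof (intro CollectI conjI ballI impI)
      show "?to \<kappa> \<in> {1..?M} \<rightarrow>\<^sub>E ({1..d} \<rightarrow>\<^sub>E J r)"
        using lt(2) by (auto intro!: elt_J)
      show "?to \<kappa> s i < ?to \<kappa> s (i + 1)" if s: "s \<in> {1..?M}" and i: "i \<in> {1..<d}" for s i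
      proof -
        have i2: "i \<in> {1..d}" "i + 1 \<in> {1..d}" using i by auto
        have "\<kappa> (i - 1, s - 1) < \<kappa> (i, s - 1)" using col[of "i - 1" "s - 1"] i s by auto
        then show ?thesis
          unfolding to[OF s i2(1)] to[OF s i2(2)]
          using lt(2)[of "i - 1" "s - 1"] lt(2)[of i "s - 1"] s i by (auto simp: elt_less_iff)
      qed
      show "?to \<kappa> s i \<le> ?to \<kappa> (s + 1) i" if "i \<in> {1..d}" "s \<in> {1..<?M}" for i s using mono that by blast
      show "?to \<kappa> s i \<le> Plain (m' + i)" if i: "i \<in> {1..d}" "i \<le> r - m'" and s: "s \<in> {1..?M}" for i s
      proof -
        have ii: "i - 1 < d" "s - 1 < ?M" "i - 1 < r - m'" using i s by auto
        have "\<kappa> (i - 1, s - 1) < m' + i"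
          using lt(1)[OF ii(1,2)] ii(3) i(1) by (simp add: b_def a_def)
        then show ?thesis
          unfolding to[OF s i(1)] using elt_le_Plain[of "m' + i" r] lt(2)[OF ii(1,2)] i m' by simp
      qed
    qed
    show "monomial r m m' d Y (?to \<kappa>) = tab_weight (stay_weight r m Y') d (\<lambda>_. ?M) \<kappa>"
    proof -
      define K where "K = ?to \<kappa>"
      have K: "K s i = elt r (\<kappa> (i - 1, s - 1))" if "s \<in> {1..?M}" "i \<in> {1..d}" for s i
        unfolding K_def by (rule to[OF that])
      have w: "(if K s i \<le> Plain r then Cbar r Y (m - (absJ (K s i) + s - i - 1)) (absJ (K s i))
          else C r Y (m - (s + r - i)) (absJ (K s i) - 1)) =
        stay_weight r m Y' (\<kappa> (i - 1, s - 1) + (s - 1) - (i - 1)) (\<kappa> (i - 1, s - 1))"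
        if i: "i \<in> {1..d}" and s: "s \<in> {1..?M}" for i s
      proof -
        have ii: "i - 1 < d" "s - 1 < ?M" using i s by auto
        show ?thesis
          unfolding K[OF s i] Y'_def
          by (rule stay_weight_completed[OF i d(2) s m'(1) ge[OF ii] lt(2)[OF ii], symmetric])
      qed
      have "monomial r m m' d Y K = (\<Prod>i=1..d. \<Prod>s=1..?M.
        if K s i \<le> Plain r then Cbar r Y (m - (absJ (K s i) + s - i - 1)) (absJ (K s i))
        else C r Y (m - (s + r - i)) (absJ (K s i) - 1))"
        by (rule monomial_eq_prod) (use J mono in \<open>simp_all only: K_def\<close>)
      also have "\<dots> = tab_weight (stay_weight r m Y') d (\<lambda>_. ?M) \<kappa>"
        unfolding tab_weight_eq_prod by (intro prod.cong refl) (rule w)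
      finally show ?thesis unfolding K_def .
    qed
  }
  fix \<kappa>' assume k: "\<kappa>' \<in> families r m m' d"
  then have ext: "\<kappa>' \<in> {1..?M} \<rightarrow>\<^sub>E ({1..d} \<rightarrow>\<^sub>E J r)" by (simp add: families_def)
  have J: "\<kappa>' s i \<in> J r" if "s \<in> {1..?M}" "i \<in> {1..d}" for s i
    by (rule PiE_mem[OF PiE_mem[OF ext that(1)] that(2)])
  show "?to (?from \<kappa>') = \<kappa>'"
  proof
    fix s show "?to (?from \<kappa>') s = \<kappa>' s"
    proof (cases "s \<in> {1..?M}")
      case True
      have e: "\<kappa>' s \<in> {1..d} \<rightarrow>\<^sub>E J r" using ext True by (rule PiE_mem)
      show ?thesis
      proof
        fix i show "?to (?from \<kappa>') s i = \<kappa>' s i"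
        proof (cases "i \<in> {1..d}")
          case i: True
          have "?to (?from \<kappa>') s i = elt r (?from \<kappa>' (i - 1, s - 1))" using True i by simp
          also have "?from \<kappa>' (i - 1, s - 1) = pos r (\<kappa>' s i)" using True i by (auto simp: tab_shape_def)
          also have "elt r (pos r (\<kappa>' s i)) = \<kappa>' s i" by (rule elt_pos[OF J[OF True i]])
          finally show ?thesis .
        next
          case False
          show ?thesis
            unfolding PiE_arb[OF e False] restrict_apply[of _ "{1..?M}"] if_P[OF True] restrict_apply[of _ "{1..d}"] if_not_P[OF False]
            by (rule refl)
        qed
      qed
    next
      case False
      show ?thesis unfolding PiE_arb[OF ext False] restrict_apply[of _ "{1..?M}"] if_not_P[OF False] by (rule refl)
    qed
  qed
  define f where "f = ?from \<kappa>'"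
  have f: "f (i, s) = pos r (\<kappa>' (Suc s) (Suc i))" if "i < d" "s < ?M" for i s
    using that by (simp add: f_def)
  have ef: "elt r (f (i, s)) = \<kappa>' (Suc s) (Suc i)" "f (i, s) < 2 * r" if "i < d" "s < ?M" for i s
    using f[OF that] J[of "Suc s" "Suc i"] that elt_pos pos_lt by auto
  have col: "f (i, s) < f (Suc i, s)" if "Suc i < d" "s < ?M" for i s
  proof -
    have "\<kappa>' (Suc s) (Suc i) < \<kappa>' (Suc s) (Suc i + 1)" using k that by (auto simp: families_def)
    then have "elt r (f (i, s)) < elt r (f (Suc i, s))" using ef(1)[of i s] ef(1)[of "Suc i" s] that by simp
    then show ?thesis using ef(2)[of i s] ef(2)[of "Suc i" s] that by (simp add: elt_less_iff)
  qed
  have "f \<in> tableaux d (\<lambda>_. ?M) b"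
    unfolding tableaux_iff
  proof (intro conjI allI impI)
    show "f \<in> extensional (tab_shape d (\<lambda>_. ?M))" unfolding f_def by (rule restrict_extensional)
    show "f (i, s) \<le> f (i, Suc s)" if "i < d" "Suc s < ?M" for i s
    proof -
      have "\<kappa>' (Suc s) (Suc i) \<le> \<kappa>' (Suc s + 1) (Suc i)" using k that by (auto simp: families_def)
      then have "elt r (f (i, s)) \<le> elt r (f (i, Suc s))" using ef(1)[of i s] ef(1)[of i "Suc s"] that by simp
      then show ?thesis using ef(2)[of i s] ef(2)[of i "Suc s"] that by (simp add: elt_le_iff)
    qed
    show "f (i, s) < b i" if i: "i < d" "s < ?M" for i s
    proof (cases "i < a")
      case True
      then have "Suc i \<in> {1..d}" "Suc i \<le> r - m'" "Suc s \<in> {1..?M}" using i by (auto simp: a_def)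
      then have "\<kappa>' (Suc s) (Suc i) \<le> Plain (m' + Suc i)" using k unfolding families_def by blast
      then have "elt r (f (i, s)) \<le> Plain (m' + Suc i)" using ef(1)[OF i] by simp
      then have "f (i, s) < m' + Suc i"
        using elt_le_Plain[of "m' + Suc i" r "f (i, s)"] ef(2)[OF i] True m' by (simp add: a_def)
      then show ?thesis using True by (simp add: b_def)
    next
      case False
      \<comment> \<open>The d - 1 - i strictly larger entries beneath a box lie below 2 * r, which
        yields the flag of the barred rows.\<close>
      have "f (i, s) + n \<le> f (i + n, s)" if "i + n < d" for n
        using that
      proof (induction n)
        case (Suc n)
        then show ?case using col[of "i + n" s] i by simp
      qed simp
      from this[of "d - Suc i"] have "f (i, s) + (d - Suc i) \<le> f (d - 1, s)" using i by simp
      then show ?thesis using ef(2)[of "d - 1" s] i d False by (simp add: b_def)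
    qed
  qed (rule col)
  then show "?from \<kappa>' \<in> tableaux d (\<lambda>_. ?M) b" by (simp add: f_def)
qed

section \<open>From the generalized minor to the path determinant\<close>

lemma det_cong: "(\<And>i j. i < n \<Longrightarrow> j < n \<Longrightarrow> f (i, j) = g (i, j)) \<Longrightarrow> det (mat n n f) = det (mat n n g)"
  by (rule arg_cong[of _ _ det]) (auto intro!: eq_matI)

text \<open>Multiplying by the inverse of the representative moves row
  \<open>cox_pos r (m' + i)\<close> of the matrix into row i. In the exponent of the sign the
  truncated subtraction leaves the plain rows i < r - m' unsigned.\<close>

lemma DeltaL_eq_det:
  assumes m: "1 \<le> m" "m \<le> r" and d: "1 \<le> d" "d \<le> r" and m': "1 \<le> m'" "m' \<le> m"
    and k: "k = (m' - 1) * r + d" and letter: "word r m d ! (k - 1) = d"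
    and Y: "\<forall>(l, i)\<in>set (cycle_letters r m d). Y l i \<noteq> 0"
  shows "DeltaL r m d k Y = det (mat d d (\<lambda>(i, c). (- 1) ^ (i - (r - m')) * xL r m d Y $$ (cox_pos r (m' + i), c)))"
proof -
  have r: "0 < r" using d by simp
  define js where "js = coxeter_word r k"
  have "k \<le> (m - 1) * r + d" using k mult_le_mono1[OF diff_le_mono[OF m'(2), of 1], of r] by linarith
  then have tk: "take k (word r m d) = js" by (simp add: word_eq[OF m(1) d(2)] js_def take_map)
  have js: "set js \<subseteq> {1..r}" unfolding js_def by (rule coxeter_word_letters[OF r])
  have kr: "k \<le> r * r"
  proof -
    have "k \<le> (m' - 1) * r + r" using k d by simp
    also have "\<dots> = m' * r" using m' by (cases m') auto
    also have "\<dots> \<le> r * r" using m m' by simp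
    finally show ?thesis .
  qed
  have red: "length2 r (wperm r (rev js)) = 2 * length js"
    using wperm_coxeter_word(1)[OF r kr] by (simp add: js_def)
  let ?u = "gprod (Sp r) (map (s_bar r) js)"
  obtain js' where js': "set js' \<subseteq> {1..r}" "weyl_word r js' = weyl_word r js" "length js' \<le> length js"
    "weyl_rep r (weyl_word r js) = gprod (Sp r) (map (s_bar r) js')"
    using weyl_rep_word[OF js] .
  \<comment> \<open>The prefix has \<open>length2\<close> equal to twice its length, so the reduced
    word hidden in the choice gives the same product as the prefix itself.\<close>
  have rep: "weyl_rep r (weyl_word r js) = ?u"
    unfolding js'(4) by (rule s_bar_word_unique[OF js js'(1-3) red])
  have u: "?u \<in> xty_group r" by (rule xty_group_gprod) (use js xty_group_s_bar in auto)
  note x = xL_columns(3)[OF m(1) d(2) Y]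
  have xc: "xL r m d Y \<in> carrier_mat (2 * r) (2 * r)" by (rule Sp_carrier_mat[OF xty_group_Sp[OF x]])
  have "DeltaL r m d k Y = lead_minor d (adj r ?u * xL r m d Y)"
    unfolding DeltaL_def Delta_def tk letter
    using gen_minor_eq_lead_minor[of d r "weyl_word r js" "xL r m d Y"] rep u x d by simp
  also have "\<dots> = det (mat d d (\<lambda>(i, c). (- 1) ^ (i - (r - m')) * xL r m d Y $$ (cox_pos r (m' + i), c)))"
    unfolding lead_minor_def
  proof (rule det_cong)
    fix i c assume ic: "i < d" "c < d"
    let ?\<pi> = "wperm r (rev js)" and ?\<epsilon> = "wsign r (rev js)"
    have rjs: "set (rev js) \<subseteq> {1..r}" using js by simp
    have sgn: "?\<epsilon> q = (- 1) ^ inversions ?\<pi> q" if "q < 2 * r" for q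
      by (rule wsign_reduced(2)[OF rjs _ that]) (use red in simp)
    have "(adj r ?u * xL r m d Y) $$ (i, c) = ?\<epsilon> i * xL r m d Y $$ (?\<pi> i, c)"
    proof (rule adj_signed_perm_mult[OF _ xty_group_Sp[OF u] wperm_inj[OF rjs] wperm_lt[OF rjs] _ xc])
      show "signed_perm (2 * r) ?u ?\<pi> ?\<epsilon>" using signed_perm_word[OF rjs] by simp
      show "?\<epsilon> q * ?\<epsilon> q = 1" if "q < 2 * r" for q
        unfolding sgn[OF that] by (simp flip: power_mult_distrib)
    qed (use ic d in auto)
    moreover have "?\<pi> i = cox_pos r (m' + i)" "inversions ?\<pi> i = i - (r - m')"
      using wperm_coxeter_word_prefix[of "m' - 1" r d i] inversions_coxeter_word_prefix[of "m' - 1" r d i] m m' d ic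
      unfolding js_def k by simp_all
    ultimately show "(adj r ?u * xL r m d Y) $$ (i, c) =
        (case (i, c) of (i, c) \<Rightarrow> (- 1) ^ (i - (r - m')) * xL r m d Y $$ (cox_pos r (m' + i), c))"
      using ic d sgn[of i] by simp
  qed
  finally show ?thesis .
qed

text \<open>The total number of steps comes out as m for every plain row and as m - m' + 2 * r - d
  for every barred row. Both equal m - m' + b i - Suc i, which is the form needed for m - m' boxes
  in every row.\<close>

lemma det_cox_rows_eq_det_paths:
  fixes Y :: "nat \<Rightarrow> nat \<Rightarrow> complex"
  assumes Y: "\<And>l i. l \<in> {1..m} \<Longrightarrow> i \<in> {1..r} \<Longrightarrow> Y l i \<noteq> 0" and m': "1 \<le> m'" "m' \<le> m" "m \<le> r"
    and d: "1 \<le> d" "d \<le> r"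
  defines "a \<equiv> r - m'"
  defines "b \<equiv> \<lambda>i. if i < a then m' + i + 1 else 2 * r - d + i + 1"
  shows "det (mat d d (\<lambda>(i, c). (- 1) ^ (i - a) * tail_mat r m Y m $$ (cox_pos r (m' + i), c))) =
    det (mat d d (\<lambda>(i, c). paths (stay_weight r m Y) (m - m' + b i - Suc i) (b i) c))"
proof -
  let ?T = "tail_mat r m Y"
  \<comment> \<open>If d < a, no row is barred; the minimum lets the reversal lemma apply to the
    empty block.\<close>
  let ?a = "min a d"
  have "det (mat d d (\<lambda>(i, c). (- 1) ^ (i - a) * ?T m $$ (cox_pos r (m' + i), c))) =
      det (mat d d (\<lambda>(i, c). (- 1) ^ (i - ?a) * ?T m $$ (cox_pos r (m' + i), c)))"
    by (rule det_cong) (auto simp: min_def)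
  also have "\<dots> = det (mat d d (\<lambda>(i, c). ?T m $$ (cox_pos r (m' + (if i < ?a then i else ?a + d - Suc i)), c)))"
    by (rule det_reverse_rows) simp
  also have "\<dots> = det (mat d d (\<lambda>(i, c). ?T m $$ (if i < a then m' + i else 2 * r - d + i, c)))"
    by (rule det_cong) (use m' d in \<open>auto simp: cox_pos_def a_def min_def\<close>)
  also have "\<dots> = det (mat d d (\<lambda>(i, c). if i < a then ?T m $$ (m' + i, c)
      else Yconv r Y (i - a + 1) (d - Suc i) * ?T (m - (i - a)) $$ (2 * r - d + i, c)))"
    unfolding a_def by (rule det_barred_rows) (use Y m' d in auto)
  also have "\<dots> = det (mat d d (\<lambda>(i, c). paths (stay_weight r m Y) (m - m' + b i - Suc i) (b i) c))"
  proof (rule det_cong)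
    fix i c assume ic: "i < d" "c < d"
    have "paths (stay_weight r m Y) (m - m' + b i - Suc i) (b i) c =
      (if i < a then ?T m $$ (m' + i, c)
       else Yconv r Y (i - a + 1) (d - Suc i) * ?T (m - (i - a)) $$ (2 * r - d + i, c))"
    proof (cases "i < a")
      case True
      then have "m - m' + b i - Suc i = m" "b i = Suc (m' + i)" "m' + i < r"
        using m' by (auto simp: b_def a_def)
      then show ?thesis using paths_plain[of m r Y m "m' + i" c] Y True ic d by simp
    next
      case False
      define \<kappa> where "\<kappa> = 2 * r - d + i"
      have am: "a + m' = r" using m' by (simp add: a_def)
      \<comment> \<open>Stripping i - a cycles compensates the growth of the delay \<kappa> - r with
        i, so all barred rows stop at the same step.\<close>
      have e: "m - m' + b i - Suc i = (m - (i - a)) + (\<kappa> - r)" "b i = Suc \<kappa>" "r \<le> \<kappa>" "\<kappa> < 2 * r"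
        "m + 1 - (m - (i - a)) = i - a + 1" "2 * r - Suc \<kappa> = d - Suc i"
        using False m' d ic am by (auto simp: b_def \<kappa>_def)
      have "paths (stay_weight r m Y) ((m - (i - a)) + (\<kappa> - r)) (Suc \<kappa>) c =
          Yconv r Y (m + 1 - (m - (i - a))) (2 * r - Suc \<kappa>) * ?T (m - (i - a)) $$ (\<kappa>, c)"
        by (rule paths_barred) (use Y ic d e in auto)
      then have eqn: "paths (stay_weight r m Y) ((m - (i - a)) + (\<kappa> - r)) (Suc \<kappa>) c =
          Yconv r Y (i - a + 1) (d - Suc i) * ?T (m - (i - a)) $$ (\<kappa>, c)"
        unfolding e(5,6) .
      show ?thesis unfolding e(1) unfolding e(2) eqn using False by (simp add: \<kappa>_def)
    qed
    then show "(case (i, c) of (i, c) \<Rightarrow> if i < a then ?T m $$ (m' + i, c)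
        else Yconv r Y (i - a + 1) (d - Suc i) * ?T (m - (i - a)) $$ (2 * r - d + i, c)) =
      (case (i, c) of (i, c) \<Rightarrow> paths (stay_weight r m Y) (m - m' + b i - Suc i) (b i) c)"
      by simp
  qed
  finally show ?thesis .
qed

theorem theorem5p7:
  fixes r m m' n k d :: nat
    and Y :: "nat \<Rightarrow> nat \<Rightarrow> complex"
  assumes "1 \<le> m" and "m \<le> r"
    and "1 \<le> d" and "d \<le> r"
    and "n = (m - 1) * r + d"
    and "1 \<le> k" and "k \<le> n"
    and "fst (cycle_letters r m d ! (k - 1)) = m'"
    and "word r m d ! (k - 1) = d"
    and "\<forall>(l, i)\<in>set (cycle_letters r m d). Y l i \<noteq> 0"
  shows "DeltaL r m d k Y = (\<Sum>\<kappa>\<in>families r m m' d. monomial r m m' d Y \<kappa>)"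
proof -
  have kn: "k - 1 < (m - 1) * r + d" using assms(5,6,7) by simp
  have m'k: "m' = Suc ((k - 1) div r)"
    using assms(8) kn by (simp add: cycle_letters_eq[OF assms(1,4)])
  have dk: "d = Suc ((k - 1) mod r)"
    using assms(9) kn by (simp add: word_eq[OF assms(1,4)])
  have "k - 1 = (k - 1) div r * r + (k - 1) mod r" by simp
  moreover have "m' - 1 = (k - 1) div r" using m'k by simp
  \<comment> \<open>Cycle number and letter are quotient and remainder of k - 1, so together they
    determine the position k.\<close>
  ultimately have k: "k = (m' - 1) * r + d" using dk assms(6) by (metis Suc_diff_1 Suc_le_eq add_Suc_right One_nat_def)
  have m'1: "1 \<le> m'" using m'k by simp
  have m'm: "m' \<le> m"
  proof -
    have "(m - 1) * r + d \<le> m * r" using assms(1,4) by (cases m) auto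
    then have "(k - 1) div r < m" using kn by (simp add: less_mult_imp_div_less)
    then show ?thesis using m'k by simp
  qed
  define a where "a = r - m'"
  \<comment> \<open>The last cycle is completed by parameters 1;
    \<open>sum_tableaux_families\<close> returns to the original Y.\<close>
  define Y' where "Y' = (\<lambda>l i. if l = m \<and> d < i then 1 else Y l i)"
  define b where "b = (\<lambda>i. if i < a then m' + i + 1 else 2 * r - d + i + 1)"
  note xL = xL_columns[OF assms(1,4,10), folded Y'_def]
  have Y': "Y' l i \<noteq> 0" if "l \<in> {1..m}" "i \<in> {1..r}" for l i
    using xL_columns(1)[OF assms(1,4,10) that] by (simp add: Y'_def)
  have "DeltaL r m d k Y = det (mat d d (\<lambda>(i, c). (- 1) ^ (i - a) * xL r m d Y $$ (cox_pos r (m' + i), c)))"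
    unfolding a_def by (rule DeltaL_eq_det[OF assms(1-4) m'1 m'm k assms(9,10)])
  also have "\<dots> = det (mat d d (\<lambda>(i, c). (- 1) ^ (i - a) * tail_mat r m Y' m $$ (cox_pos r (m' + i), c)))"
  proof (rule det_cong)
    fix i c assume ic: "i < d" "c < d"
    have "cox_pos r (m' + i) < 2 * r" using ic assms(2,4) m'm m'1 by (auto simp: cox_pos_def)
    then show "(case (i, c) of (i, c) \<Rightarrow> (- 1) ^ (i - a) * xL r m d Y $$ (cox_pos r (m' + i), c)) =
        (case (i, c) of (i, c) \<Rightarrow> (- 1) ^ (i - a) * tail_mat r m Y' m $$ (cox_pos r (m' + i), c))"
      using xL(2) ic by simp
  qed
  also have "\<dots> = det (mat d d (\<lambda>(i, c). paths (stay_weight r m Y') (m - m' + b i - Suc i) (b i) c))"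
    unfolding a_def b_def by (rule det_cox_rows_eq_det_paths) (use Y' m'1 m'm assms(1-4) in auto)
  also have "\<dots> = (\<Sum>\<kappa>\<in>tableaux d (\<lambda>_. m - m') b. tab_weight (stay_weight r m Y') d (\<lambda>_. m - m') \<kappa>)"
    by (rule det_paths_eq_sum_tableaux) (use m'1 m'm assms(1-4) in \<open>auto simp: b_def a_def\<close>)
  also have "\<dots> = (\<Sum>\<kappa>\<in>families r m m' d. monomial r m m' d Y \<kappa>)"
    unfolding b_def a_def Y'_def by (rule sum_tableaux_families) (use m'1 m'm assms(1-4) in auto)
  finally show ?thesis .
qed

end
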